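(* Let $S\subset\mathbb{E}^3$ be a closed convex $C^2$-smooth surface of constant width $w$ with support function $r(\xi,\bar\xi)$, and let $\psi$ and $\sigma$ be the associated slopes (defined in the context). Then $$\int\int_{S^2}\left[\,|\sigma|^2-\left(r-\tfrac12 w+\psi\right)^2\right]\frac{d\xi\, d\bar\xi}{(1+\xi\bar\xi)^2}\;\geq\;0,$$ and equality occurs only in the case where $S$ is a (round) 2-sphere of width $w$.
   Context: Let $S$ be the boundary surface of a closed convex body in Euclidean 3-space $\mathbb{E}^3$, at least $C^2$-smooth. The unit sphere $S^2$ carries the complex coordinate $\xi=\tan(\theta/2)e^{i\phi}$ (stereographic projection from the south pole, $(\theta,\phi)$ standard spherical polar angles), and $S$ is parameterized by the direction $\xi\in S^2$ of its oriented (outward) normal. The support function $r:S^2\to\mathbb{R}$ gives the (signed) distance from the origin to the tangent plane of $S$ with normal direction $\xi$. With $\tau:S^2\to S^2$ the antipodal map, $\tau(\xi)=-1/\bar\xi$, the width of $S$ is $r+r\circ\tau:S^2\to\mathbb{R}$; $S$ has constant width $w$ if this function is identically $w$. Define $$F=\tfrac12(1+\xi\bar\xi)^2\frac{\partial r}{\partial\bar\xi},\qquad \psi=(1+\xi\bar\xi)^2\frac{\partial}{\partial\xi}\left(\frac{F}{(1+\xi\bar\xi)^2}\right),\qquad \sigma=-\frac{\partial\bar F}{\partial\xi}.$$ The functions $\psi$ (which is real) and $|\sigma|$ are well defined on $S^2$. The expression $\frac{d\xi\,d\bar\xi}{(1+\xi\bar\xi)^2}$ denotes the standard area measure of the unit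 sphere, of total mass $4\pi$ (i.e. $4\,dx\,dy/(1+|\xi|^2)^2$ for $\xi=x+iy$). A 2-sphere of width $w$ is a round sphere of radius $w/2$. *)

theory Defs
  imports "HOL-Analysis.Analysis"
begin

definition convex_body :: "'a::euclidean_space set \<Rightarrow> bool" where
  "convex_body K \<longleftrightarrow> compact K \<and> convex K \<and> interior K \<noteq> {}"

definition C2_on :: "'a::real_normed_vector set \<Rightarrow> ('a \<Rightarrow> 'b::real_normed_vector) \<Rightarrow> bool" where
  "C2_on U f \<longleftrightarrow> (\<exists>(f' :: 'a \<Rightarrow> 'a \<Rightarrow>\<^sub>L 'b) f''.
     (\<forall>x\<in>U. (f has_derivative blinfun_apply (f' x)) (at x)) \<and>
     (\<forall>x\<in>U. (f' has_derivative blinfun_apply (f'' x)) (at x)) \<and>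
     continuous_on U f'')"

(* Embedded hypersurfaces: locally the zero set of a C2 function without critical points. *)
definition C2_hypersurface :: "'a::euclidean_space set \<Rightarrow> bool" where
  "C2_hypersurface S \<longleftrightarrow> (\<forall>p\<in>S. \<exists>U (g :: 'a \<Rightarrow> real).
     open U \<and> p \<in> U \<and> C2_on U g \<and>
     (\<forall>x\<in>U. frechet_derivative g (at x) \<noteq> (\<lambda>_. 0)) \<and>
     S \<inter> U = {x \<in> U. g x = 0})"

definition support_function :: "'a::euclidean_space set \<Rightarrow> 'a \<Rightarrow> real" where
  "support_function S u = (SUP x\<in>S. x \<bullet> u)"

(* The support function is the signed distance, in direction u, from the origin to the
   supporting (tangent) plane {y. y \<bullet> u = x \<bullet> u} with outward unit normal u. *)
lemma support_function_eq:
  assumes "x \<in> S" and "\<And>y. y \<in> S \<Longrightarrow> (y - x) \<bullet> u \<le> 0"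
  shows "support_function S u = x \<bullet> u"
  unfolding support_function_def
proof (rule cSup_eq_maximum)
  show "x \<bullet> u \<in> (\<lambda>x. x \<bullet> u) ` S" using assms(1) by blast
next
  fix t assume "t \<in> (\<lambda>x. x \<bullet> u) ` S"
  then show "t \<le> x \<bullet> u" using assms(2) by (force simp: inner_diff_left)
qed

definition has_constant_width :: "'a::euclidean_space set \<Rightarrow> real \<Rightarrow> bool" where
  "has_constant_width S w \<longleftrightarrow>
     (\<forall>u. norm u = 1 \<longrightarrow> support_function S u + support_function S (- u) = w)"

(* Inverse of stereographic projection from the south pole; only the south pole itself
   (\<xi> = \<infinity>) is not of this form. *)
definition sphere_point :: "complex \<Rightarrow> real ^ 3" where
  "sphere_point \<xi> = (1 / (1 + (cmod \<xi>)\<^sup>2)) *\<^sub>R vector [2 * Re \<xi>, 2 * Im \<xi>, 1 - (cmod \<xi>)\<^sup>2]"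

lemma one_plus_cmod_pos: "1 + (cmod \<xi>)\<^sup>2 > 0"
  by (simp add: add_pos_nonneg)

lemma norm_sphere_point: "norm (sphere_point \<xi>) = 1"
proof -
  let ?v = "vector [2 * Re \<xi>, 2 * Im \<xi>, 1 - (cmod \<xi>)\<^sup>2] :: real ^ 3"
  have "(norm ?v)\<^sup>2 = (1 + (cmod \<xi>)\<^sup>2)\<^sup>2"
    unfolding power2_norm_eq_inner[of ?v]
    by (simp add: inner_vec_def sum_3 cmod_power2) (simp add: power2_eq_square algebra_simps)
  then have "norm ?v = 1 + (cmod \<xi>)\<^sup>2"
    by (metis abs_of_pos norm_ge_zero one_plus_cmod_pos power2_abs power2_eq_imp_eq less_imp_le)
  then show ?thesis
    using one_plus_cmod_pos[of \<xi>] by (simp add: sphere_point_def)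
qed

lemma sphere_point_polar:
  assumes "0 \<le> \<theta>" "\<theta> < pi"
  shows "sphere_point (of_real (tan (\<theta> / 2)) * cis \<phi>) =
           vector [sin \<theta> * cos \<phi>, sin \<theta> * sin \<phi>, cos \<theta>]"
proof -
  define c s where "c = cos (\<theta> / 2)" and "s = sin (\<theta> / 2)"
  have c: "c > 0" unfolding c_def using assms by (intro cos_gt_zero_pi) auto
  have cs: "c\<^sup>2 + s\<^sup>2 = 1" by (simp add: c_def s_def)
  have sin: "sin \<theta> = 2 * s * c" using sin_double[of "\<theta> / 2"] by (simp add: c_def s_def)
  have cos: "cos \<theta> = c\<^sup>2 - s\<^sup>2" using cos_double[of "\<theta> / 2"] by (simp add: c_def s_def)
  have t: "tan (\<theta> / 2) = s / c" by (simp add: tan_def c_def s_def)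
  have n: "(cmod (of_real (tan (\<theta> / 2)) * cis \<phi>))\<^sup>2 = s\<^sup>2 / c\<^sup>2"
    by (simp add: norm_mult norm_divide t power_divide)
  have q: "1 + s\<^sup>2 / c\<^sup>2 = 1 / c\<^sup>2" using c cs by (simp add: field_simps)
  show ?thesis
    unfolding sphere_point_def n q using c
    by (simp add: vec_eq_iff forall_3 t sin cos field_simps power2_eq_square)
qed

lemma sphere_point_antipodal:
  assumes "\<xi> \<noteq> 0"
  shows "sphere_point (- 1 / cnj \<xi>) = - sphere_point \<xi>"
proof -
  define m where "m = (cmod \<xi>)\<^sup>2"
  have m: "m > 0" using assms by (simp add: m_def)
  have e: "- 1 / cnj \<xi> = - (\<xi> / of_real m)"
    using assms unfolding m_def complex_norm_square by (simp add: field_simps)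
  have n: "(cmod (- 1 / cnj \<xi>))\<^sup>2 = 1 / m"
    by (simp add: norm_divide power_divide m_def)
  have "1 + m \<noteq> 0" using m by simp
  then show ?thesis
    unfolding sphere_point_def n unfolding e m_def[symmetric] using m
    by (simp add: vec_eq_iff forall_3 field_simps)
qed

(* Wirtinger operators d/dxi and d/dxibar, for functions that are only real differentiable. *)
definition dd_xi :: "(complex \<Rightarrow> complex) \<Rightarrow> complex \<Rightarrow> complex" where
  "dd_xi f \<xi> =
     (frechet_derivative f (at \<xi>) 1 - \<i> * frechet_derivative f (at \<xi>) \<i>) / 2"

definition dd_xibar :: "(complex \<Rightarrow> complex) \<Rightarrow> complex \<Rightarrow> complex" where
  "dd_xibar f \<xi> =
     (frechet_derivative f (at \<xi>) 1 + \<i> * frechet_derivative f (at \<xi>) \<i>) / 2"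

definition slope_F :: "(complex \<Rightarrow> real) \<Rightarrow> complex \<Rightarrow> complex" where
  "slope_F r \<xi> = 1/2 * (1 + \<xi> * cnj \<xi>)\<^sup>2 * dd_xibar (\<lambda>\<zeta>. of_real (r \<zeta>)) \<xi>"

(* Complex-valued by its type only: for r of class C2 the mixed second derivatives commute
   and the value is the real number (1 + |\<xi>|^2)^2 * (r_xx + r_yy) / 8. *)
definition slope_psi :: "(complex \<Rightarrow> real) \<Rightarrow> complex \<Rightarrow> complex" where
  "slope_psi r \<xi> =
     (1 + \<xi> * cnj \<xi>)\<^sup>2 * dd_xi (\<lambda>\<zeta>. slope_F r \<zeta> / (1 + \<zeta> * cnj \<zeta>)\<^sup>2) \<xi>"

definition slope_sigma :: "(complex \<Rightarrow> real) \<Rightarrow> complex \<Rightarrow> complex" where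
  "slope_sigma r \<xi> = - dd_xi (\<lambda>\<zeta>. cnj (slope_F r \<zeta>)) \<xi>"

(* Standard area measure of the unit sphere in the coordinate \<xi>; the missing south pole
   is a null set. *)
definition sphere_area :: "complex measure" where
  "sphere_area = density lborel (\<lambda>\<xi>. ennreal (4 / (1 + (cmod \<xi>)\<^sup>2)\<^sup>2))"

end

theory Submission
  imports Defs
begin

text \<open>
  Write \<open>H\<close> for the 1-homogeneous support function of the body. On the unit sphere, \<open>\<psi>\<close> is half the
  Laplacian of \<open>r\<close>, and the numbers \<open>r + \<psi>\<close> and \<open>|\<sigma>|\<close> are half the sum and half the difference
  of the principal radii of curvature. The integrand is therefore minus the determinant of
  \<open>Hess p + p\<close>, where \<open>p = r - w/2\<close>; constant width says that \<open>p\<close> is odd under the antipodal map.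
  Integration by parts turns the integral into the Dirichlet-type form \<open>\<integral> (|grad p|^2 / 2 - p^2)\<close>,
  which is nonnegative on functions of mean zero and vanishes only on first spherical harmonics,
  that is, when \<open>p\<close> is the restriction of a linear form and the body is a ball.

  There are two difficulties. The first is that the hypothesis concerns the smoothness of the
  surface, while the slopes need a support function of class C2. A body of constant width touches
  each support plane in a single point, and that point is a Lipschitz function of the direction,
  because the body lies in a ball of radius \<open>w\<close> tangent to the support plane there. The gradient of
  \<open>H\<close> is this contact point. The unit normal of the surface is a C1 function of the point and
  inverts the contact map; since the contact map is Lipschitz, the differential of the normal map is
  invertible, and the contact map is C1 (\<open>contact_C1\<close>).

  The second is to carry out the integration by parts with two derivatives only, and to prove the
  spectral inequality. For \<open>V = (1 + |\<xi>|^2) p\<close> the integrand becomes a Monge-Ampere expression in \<open>V\<close>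
  (\<open>slope_integrand\<close>), and it does not change when a linear form, restricted to the sphere, is added to \<open>p\<close>;
  the linear form is chosen so that \<open>V\<close> and its differential vanish at \<open>\<xi> = 0\<close>. With \<open>\<xi> = e^(s + i phi)\<close> and
  \<open>u = V / (2 |\<xi>|)\<close>, the sphere becomes a cylinder, on which \<open>u\<close> and its derivatives decay exponentially and
  \<open>u(-s, phi + pi) = -u(s, phi)\<close>. There the integral of the integrand over a circle is an exact derivative plus
  the integral of \<open>(u_s^2 + u_phi^2 - u^2) / (2 cosh^2 s)\<close> (\<open>flux_deriv\<close>).

  The part of \<open>u\<close> even in \<open>s\<close> is antiperiodic in \<open>phi\<close>, so Wirtinger's inequality bounds its square by its
  angular derivative. The part odd in \<open>s\<close> vanishes on the circle \<open>s = 0\<close>, so it may be divided by the solution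
  \<open>sinh s\<close> of the Euler equation, which completes the square. What remains is a sum of squares;
  if the integral is zero, these squares and, by the decay at infinity, \<open>u\<close> itself vanish
  (\<open>J_integral_nonneg\<close>).
\<close>

section \<open>Integrals depending on a parameter\<close>

lemma integral_parameter_has_derivative:
  fixes f g :: "real \<Rightarrow> real \<Rightarrow> real"
  assumes "\<And>s p. ((\<lambda>s. f s p) has_real_derivative g s p) (at s)"
    and "continuous_on UNIV (\<lambda>z. f (fst z) (snd z))"
    and "continuous_on UNIV (\<lambda>z. g (fst z) (snd z))"
  shows "((\<lambda>s. integral {a..b} (f s)) has_real_derivative integral {a..b} (g s)) (at s)"
proof -
  have "continuous_on {a..b} (f s)" for s
    using continuous_on_compose2[OF assms(2), of "{a..b}" "\<lambda>p. (s, p)"]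
    by (simp add: continuous_intros)
  then have i: "f s integrable_on cbox a b" for s
    by (simp add: integrable_continuous_real)
  have "((\<lambda>s. integral (cbox a b) (f s)) has_real_derivative integral (cbox a b) (g s)) (at s within UNIV)"
    by (rule leibniz_rule_field_derivative[OF _ i])
       (use assms in \<open>auto simp: case_prod_unfold intro: continuous_on_subset\<close>)
  then show ?thesis by simp
qed

lemma integral_parameter_continuous:
  fixes f :: "'a::topological_space \<Rightarrow> real \<Rightarrow> real"
  assumes "continuous_on UNIV (\<lambda>z. f (fst z) (snd z))"
  shows "continuous_on UNIV (\<lambda>x. integral {a..b} (f x))"
  using integral_continuous_on_param[of UNIV a b f] assms
  by (auto simp: case_prod_unfold intro: continuous_on_subset)

text \<open>
  For smooth functions this is differentiation under the integral followed by an integration by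
  parts that removes the mixed derivative of \<open>b\<close>. With first derivatives only, the difference quotient
  is summed by parts instead: the integrals of \<open>as\<close> and \<open>bs\<close> over the segment from \<open>s\<close> to \<open>z\<close> replace the
  quotients, and they are jointly continuous in \<open>z\<close> and \<open>p\<close>. This is the Jacobian identity through
  which the Hessian determinant of a C2 function is a divergence.
\<close>
lemma circle_integral_jacobian_derivative:
  fixes a as ap b bs bp :: "real \<Rightarrow> real \<Rightarrow> real"
  assumes das: "\<And>s p. ((\<lambda>s. a s p) has_real_derivative as s p) (at s)"
    and dap: "\<And>s p. ((\<lambda>p. a s p) has_real_derivative ap s p) (at p)"
    and dbs: "\<And>s p. ((\<lambda>s. b s p) has_real_derivative bs s p) (at s)"
    and dbp: "\<And>s p. ((\<lambda>p. b s p) has_real_derivative bp s p) (at p)"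
    and cont: "continuous_on UNIV (\<lambda>z. a (fst z) (snd z))" "continuous_on UNIV (\<lambda>z. as (fst z) (snd z))"
      "continuous_on UNIV (\<lambda>z. ap (fst z) (snd z))" "continuous_on UNIV (\<lambda>z. b (fst z) (snd z))"
      "continuous_on UNIV (\<lambda>z. bs (fst z) (snd z))" "continuous_on UNIV (\<lambda>z. bp (fst z) (snd z))"
    and per: "\<And>s. a s (2 * pi) = a s 0" "\<And>s. b s (2 * pi) = b s 0"
  shows "((\<lambda>s. integral {0..2*pi} (\<lambda>p. a s p * bp s p)) has_real_derivative
           integral {0..2*pi} (\<lambda>p. as s p * bp s p - ap s p * bs s p)) (at s)"
proof -
  have ci: "continuous_on S (\<lambda>x. a (f x) (g x))" "continuous_on S (\<lambda>x. as (f x) (g x))"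
    "continuous_on S (\<lambda>x. ap (f x) (g x))" "continuous_on S (\<lambda>x. b (f x) (g x))"
    "continuous_on S (\<lambda>x. bs (f x) (g x))" "continuous_on S (\<lambda>x. bp (f x) (g x))"
    if "continuous_on S f" "continuous_on S g" for S f and g :: "'z::topological_space \<Rightarrow> real"
    using cont[THEN continuous_on_compose2, of S "\<lambda>x. (f x, g x)"] that
    by (auto intro!: continuous_intros)
  define Da where "Da z p = integral {0..1} (\<lambda>\<tau>. as (s + \<tau> * (z - s)) p)" for z p
  define Db where "Db z p = integral {0..1} (\<lambda>\<tau>. bs (s + \<tau> * (z - s)) p)" for z p
  have avg: "f z p - f s p = integral {0..1} (\<lambda>\<tau>. fs (s + \<tau> * (z - s)) p) * (z - s)"
    if d: "\<And>s p. ((\<lambda>s. f s p) has_real_derivative fs s p) (at s)" for f fs :: "real \<Rightarrow> real \<Rightarrow> real" and z p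
  proof -
    have "((\<lambda>\<tau>. fs (s + \<tau> * (z - s)) p * (z - s)) has_integral
        f (s + 1 * (z - s)) p - f (s + 0 * (z - s)) p) {0..1}"
    proof (rule fundamental_theorem_of_calculus)
      fix \<tau> :: real
      have "((\<lambda>\<tau>. f (s + \<tau> * (z - s)) p) has_real_derivative fs (s + \<tau> * (z - s)) p * (z - s)) (at \<tau>)"
        by (rule DERIV_chain2[OF d]) (auto intro!: derivative_eq_intros)
      then show "((\<lambda>\<tau>. f (s + \<tau> * (z - s)) p) has_vector_derivative fs (s + \<tau> * (z - s)) p * (z - s)) (at \<tau> within {0..1})"
        using has_field_derivative_at_within has_real_derivative_iff_has_vector_derivative by blast
    qed simp
    then have "integral {0..1} (\<lambda>\<tau>. fs (s + \<tau> * (z - s)) p * (z - s))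
        = f (s + 1 * (z - s)) p - f (s + 0 * (z - s)) p"
      by (rule integral_unique)
    then show ?thesis by simp
  qed
  have cDa: "continuous_on UNIV (\<lambda>z. Da (fst z) (snd z))" "continuous_on UNIV (\<lambda>z. Db (fst z) (snd z))"
    unfolding Da_def Db_def
    by (intro integral_parameter_continuous ci continuous_intros)+
  have ciD: "continuous_on S (\<lambda>x. Da (f x) (g x))" "continuous_on S (\<lambda>x. Db (f x) (g x))"
    if "continuous_on S f" "continuous_on S g" for S f and g :: "'z::topological_space \<Rightarrow> real"
    using cDa[THEN continuous_on_compose2, of S "\<lambda>x. (f x, g x)"] that
    by (auto intro!: continuous_intros)
  note cc = ci ciD continuous_intros
  define \<Psi> where "\<Psi> z = integral {0..2*pi} (\<lambda>p. Da z p * bp z p - ap s p * Db z p)" for z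
  have \<Psi>: "continuous_on UNIV \<Psi>"
    unfolding \<Psi>_def by (intro integral_parameter_continuous cc)
  show ?thesis
  proof (subst CARAT_DERIV, intro exI conjI allI)
    show "isCont \<Psi> s" using \<Psi> by (simp add: continuous_on_eq_continuous_at)
    show "\<Psi> s = integral {0..2*pi} (\<lambda>p. as s p * bp s p - ap s p * bs s p)"
      by (simp add: \<Psi>_def Da_def Db_def)
    fix z
    (* summation by parts: the boundary terms cancel by periodicity *)
    have parts: "((\<lambda>p. ap s p * (b z p - b s p) + a s p * (bp z p - bp s p)) has_integral
         a s (2*pi) * (b z (2*pi) - b s (2*pi)) - a s 0 * (b z 0 - b s 0)) {0..2*pi}"
    proof (rule fundamental_theorem_of_calculus)
      fix p :: real
      have "((\<lambda>p. a s p * (b z p - b s p)) has_real_derivative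
         ap s p * (b z p - b s p) + a s p * (bp z p - bp s p)) (at p)"
        by (auto intro!: derivative_eq_intros dap dbp)
      then show "((\<lambda>p. a s p * (b z p - b s p)) has_vector_derivative
         ap s p * (b z p - b s p) + a s p * (bp z p - bp s p)) (at p within {0..2*pi})"
        using has_field_derivative_at_within has_real_derivative_iff_has_vector_derivative by blast
    qed simp
    have I: "(\<lambda>p. a z p * bp z p) integrable_on {0..2*pi}" "(\<lambda>p. a s p * bp s p) integrable_on {0..2*pi}"
       "(\<lambda>p. ap s p * (b z p - b s p) + a s p * (bp z p - bp s p)) integrable_on {0..2*pi}"
      by (intro integrable_continuous_real cc)+
    have "integral {0..2*pi} (\<lambda>p. a z p * bp z p) - integral {0..2*pi} (\<lambda>p. a s p * bp s p)
       = integral {0..2*pi} (\<lambda>p. a z p * bp z p) - integral {0..2*pi} (\<lambda>p. a s p * bp s p)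
         - integral {0..2*pi} (\<lambda>p. ap s p * (b z p - b s p) + a s p * (bp z p - bp s p))"
      using parts by (simp add: per integral_unique)
    also have "\<dots> = integral {0..2*pi} (\<lambda>p. a z p * bp z p - a s p * bp s p
         - (ap s p * (b z p - b s p) + a s p * (bp z p - bp s p)))"
      using I by (simp add: integral_diff integrable_diff)
    also have "\<dots> = integral {0..2*pi} (\<lambda>p. (Da z p * bp z p - ap s p * Db z p) * (z - s))"
    proof (rule integral_cong)
      fix p
      have "a z p - a s p = Da z p * (z - s)" "b z p - b s p = Db z p * (z - s)"
        unfolding Da_def Db_def by (intro avg das dbs)+
      moreover have "a z p * bp z p - a s p * bp s p - (ap s p * (b z p - b s p) + a s p * (bp z p - bp s p))
         = (a z p - a s p) * bp z p - ap s p * (b z p - b s p)"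
        by (simp add: algebra_simps)
      ultimately show "a z p * bp z p - a s p * bp s p - (ap s p * (b z p - b s p) + a s p * (bp z p - bp s p))
         = (Da z p * bp z p - ap s p * Db z p) * (z - s)"
        by (simp only: left_diff_distrib) (simp only: mult.assoc mult.commute mult.left_commute)
    qed
    finally show "integral {0..2*pi} (\<lambda>p. a z p * bp z p) - integral {0..2*pi} (\<lambda>p. a s p * bp s p) = \<Psi> z * (z - s)"
      by (simp add: \<Psi>_def)
  qed
qed

text \<open>
  Integrating the derivative in \<open>y\<close> and differentiating under the integral in \<open>x\<close> shows that \<open>fx\<close> is a
  primitive of \<open>fyx\<close>.
\<close>
lemma mixed_partials_commute:
  fixes f fx fy fxy fyx :: "real \<Rightarrow> real \<Rightarrow> real"
  assumes dx: "\<And>x y. ((\<lambda>x. f x y) has_real_derivative fx x y) (at x)"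
    and dy: "\<And>x y. ((\<lambda>y. f x y) has_real_derivative fy x y) (at y)"
    and dxy: "\<And>x y. ((\<lambda>y. fx x y) has_real_derivative fxy x y) (at y)"
    and dyx: "\<And>x y. ((\<lambda>x. fy x y) has_real_derivative fyx x y) (at x)"
    and cont: "continuous_on UNIV (\<lambda>z. fy (fst z) (snd z))" "continuous_on UNIV (\<lambda>z. fyx (fst z) (snd z))"
  shows "fxy x y = fyx x y"
proof -
  (* any base point below y will do; it keeps y in the interior of the interval of integration *)
  define a where "a = y - 1"
  have fx: "fx x z = fx x a + integral {a..z} (fyx x)" if "a \<le> z" for z
  proof -
    have "f x' z - f x' a = integral {a..z} (fy x')" for x'
      using that dy
      by (intro integral_unique[symmetric] fundamental_theorem_of_calculus)
         (auto simp: has_real_derivative_iff_has_vector_derivative[symmetric] intro: has_field_derivative_at_within)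
    then have eq: "(\<lambda>x'. f x' z - f x' a) = (\<lambda>x'. integral {a..z} (fy x'))" by simp
    have "((\<lambda>x'. integral {a..z} (fy x')) has_real_derivative integral {a..z} (fyx x)) (at x)"
      by (rule integral_parameter_has_derivative[OF dyx cont])
    moreover have "((\<lambda>x'. integral {a..z} (fy x')) has_real_derivative fx x z - fx x a) (at x)"
      unfolding eq[symmetric] by (intro DERIV_diff dx)
    ultimately have "integral {a..z} (fyx x) = fx x z - fx x a" by (rule DERIV_unique)
    then show ?thesis by simp
  qed
  have "continuous_on {a..y+1} (fyx x)"
    using continuous_on_compose2[OF cont(2), of "{a..y+1}" "\<lambda>y. (x, y)"] by (simp add: continuous_intros)
  then have "((\<lambda>z. integral {a..z} (fyx x)) has_real_derivative fyx x y) (at y within {a..y+1})"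
    by (rule integral_has_real_derivative) (simp add: a_def)
  then have "((\<lambda>z. integral {a..z} (fyx x)) has_real_derivative fyx x y) (at y)"
    by (simp add: a_def at_within_Icc_at)
  then have "((\<lambda>z. fx x a + integral {a..z} (fyx x)) has_real_derivative 0 + fyx x y) (at y)"
    by (intro DERIV_add DERIV_const)
  then have "((\<lambda>z. fx x z) has_real_derivative 0 + fyx x y) (at y)"
  proof (rule has_field_derivative_transform_within_open[of _ _ _ "{a<..}"])
    show "fx x a + integral {a..z} (fyx x) = fx x z" if "z \<in> {a<..}" for z
      using fx[of z] that by simp
  qed (simp_all add: a_def)
  then have "((\<lambda>z. fx x z) has_real_derivative fyx x y) (at y)" by simp
  with dxy show ?thesis by (rule DERIV_unique)
qed

section \<open>Wirtinger's inequality for antiperiodic functions\<close>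

text \<open>
  Squaring one of two functions with a common zero is enough to remove the pole of their quotient
  when the other zero is simple.
\<close>
lemma square_over_vanishing:
  fixes g h :: "real \<Rightarrow> real"
  assumes "(g has_real_derivative g') (at a)" "g a = 0" "(h has_real_derivative h') (at a)" "h a = 0" "h' \<noteq> 0"
  shows "((\<lambda>x. (g x)\<^sup>2 / h x) \<longlongrightarrow> 0) (at a)"
proof -
  have 1: "((\<lambda>x. g x / (x - a)) \<longlongrightarrow> g') (at a)" "((\<lambda>x. h x / (x - a)) \<longlongrightarrow> h') (at a)"
    using assms by (simp_all add: has_field_derivative_iff)
  have "((\<lambda>x. (g x / (x - a)) * g x / (h x / (x - a))) \<longlongrightarrow> g' * g a / h') (at a)"
    using assms DERIV_isCont[OF assms(1)] by (intro tendsto_intros 1) (auto simp: isCont_def)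
  then have "((\<lambda>x. (g x / (x - a)) * g x / (h x / (x - a))) \<longlongrightarrow> 0) (at a)"
    using assms by simp
  then show ?thesis
    by (rule Lim_transform_eventually)
       (auto simp: eventually_at_filter power2_eq_square)
qed

text \<open>
  Subtracting \<open>f 0 * cos\<close> changes the difference of the two integrals by a boundary term only, and
  antiperiodicity makes the remaining function \<open>g\<close> vanish at every multiple of \<open>pi\<close>. For such
  a \<open>g\<close> the expression \<open>g'^2 - g^2 - (g' - g cot)^2\<close> is the derivative of \<open>g^2 cot\<close>, which extends
  continuously by zero over the poles of the cotangent.
\<close>
lemma wirtinger_antiperiodic:
  fixes f f' :: "real \<Rightarrow> real"
  assumes d: "\<And>x. (f has_real_derivative f' x) (at x)"
    and c: "continuous_on UNIV f'"
    and anti: "\<And>x. f (x + pi) = - f x"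
  shows "integral {0..2*pi} (\<lambda>x. (f x)\<^sup>2) \<le> integral {0..2*pi} (\<lambda>x. (f' x)\<^sup>2)"
proof -
  define k where "k = f 0"
  define g where "g x = f x - k * cos x" for x
  define g' where "g' x = f' x + k * sin x" for x
  have dg: "(g has_real_derivative g' x) (at x)" for x
    unfolding g_def g'_def by (auto intro!: derivative_eq_intros d)
  have cf: "continuous_on S f" "continuous_on S g" for S
    using DERIV_isCont[OF d] DERIV_isCont[OF dg] by (auto simp: continuous_at_imp_continuous_on)
  have fpi: "f pi = - k" "f (2 * pi) = k"
    using anti[of 0] anti[of pi] by (simp_all add: k_def)
  have g0: "g 0 = 0" "g pi = 0" "g (2 * pi) = 0"
    by (simp_all add: g_def fpi) (simp add: k_def)
  define W where "W x = (g x)\<^sup>2 / sin x * cos x - 2 * k * g x * sin x - k\<^sup>2 * sin x * cos x" for x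
  have sin0: "x = 0 \<or> x = pi \<or> x = 2 * pi" if "x \<in> {0..2*pi}" "sin x = 0" for x
    using that by (smt (verit) atLeastAtMost_iff sin_eq_0_pi sin_gt_zero sin_lt_zero)
  have "((\<lambda>x. (f' x)\<^sup>2 - (f x)\<^sup>2 - (g' x - g x * cos x / sin x)\<^sup>2) has_integral W (2*pi) - W 0) {0..2*pi}"
  proof (rule fundamental_theorem_of_calculus_strong[of "{0, pi, 2*pi}"])
    fix x assume x: "x \<in> {0..2*pi} - {0, pi, 2*pi}"
    then have s: "sin x \<noteq> 0" using sin0 by blast
    have "(W has_real_derivative (f' x)\<^sup>2 - (f x)\<^sup>2 - (g' x - g x * cos x / sin x)\<^sup>2) (at x)"
    proof -
      have f: "f x = g x + k * cos x" "f' x = g' x - k * sin x" by (simp_all add: g_def g'_def)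
      have cs: "(cos x)\<^sup>2 = 1 - (sin x)\<^sup>2" by (simp add: cos_squared_eq)
      show ?thesis
        unfolding W_def
        apply (rule derivative_eq_intros dg refl s)+
        using s
        apply (simp add: f field_simps power2_eq_square)
        done
    qed
    then show "(W has_vector_derivative (f' x)\<^sup>2 - (f x)\<^sup>2 - (g' x - g x * cos x / sin x)\<^sup>2) (at x)"
      by (simp add: has_real_derivative_iff_has_vector_derivative)
  next
    have W0: "isCont W a" if a: "g a = 0" "sin a = 0" for a
    proof -
      have "cos a \<noteq> 0" using a(2) sin_zero_abs_cos_one by fastforce
      have "((\<lambda>x. (g x)\<^sup>2 / sin x * cos x - 2 * k * g x * sin x - k\<^sup>2 * sin x * cos x)
         \<longlongrightarrow> 0 * cos a - 2 * k * g a * sin a - k\<^sup>2 * sin a * cos a) (at a)"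
        using \<open>cos a \<noteq> 0\<close> a DERIV_isCont[OF dg, of a]
        by (intro tendsto_intros square_over_vanishing[OF dg _ DERIV_sin]) (auto simp: isCont_def)
      then show ?thesis unfolding isCont_def W_def using a by simp
    qed
    show "continuous_on {0..2*pi} W"
    proof (intro continuous_at_imp_continuous_on ballI)
      fix x assume x: "x \<in> {0..2*pi}"
      show "isCont W x"
      proof (cases "sin x = 0")
        case True
        then show ?thesis using sin0[OF x] W0 g0 by auto
      next
        case False
        then show ?thesis
          unfolding W_def using DERIV_isCont[OF dg, of x] by (intro continuous_intros) auto
      qed
    qed
  qed simp_all
  moreover have "W (2*pi) = 0" "W 0 = 0" by (simp_all add: W_def)
  ultimately have 0: "((\<lambda>x. (f' x)\<^sup>2 - (f x)\<^sup>2 - (g' x - g x * cos x / sin x)\<^sup>2) has_integral 0) {0..2*pi}"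
    by simp
  have I: "(\<lambda>x. (f' x)\<^sup>2) integrable_on {0..2*pi}" "(\<lambda>x. (f x)\<^sup>2) integrable_on {0..2*pi}"
    by (intro integrable_continuous_real continuous_intros cf continuous_on_subset[OF c] subset_UNIV)+
  have "0 \<le> integral {0..2*pi} (\<lambda>x. (f' x)\<^sup>2 - (f x)\<^sup>2)"
    by (rule has_integral_le[OF 0]) (use I in \<open>auto intro!: integrable_integral integrable_diff\<close>)
  then show ?thesis using I by (simp add: integral_diff)
qed

section \<open>The energy identity and inequality on the cylinder\<close>

lemma exp_minus_two_abs_integrable: "integrable lborel (\<lambda>s::real. exp (- 2 * \<bar>s\<bar>))"
proof -
  have i: "(\<lambda>s::real. exp (- 2 * s)) absolutely_integrable_on {0..}"
    by (rule nonnegative_absolutely_integrable_1) (use integrable_on_exp_minus_to_infinity[of 2 0] in simp_all)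
  have 1: "integrable lborel (\<lambda>s::real. indicator {0..} s * exp (- 2 * s))"
    using i unfolding set_integrable_def by (simp add: integrable_completion)
  have 2: "integrable lborel (\<lambda>s::real. indicator {0..} (- s) * exp (2 * s))"
    using lborel_integrable_real_affine[OF 1, of "- 1" 0] by simp
  show ?thesis
    by (rule Bochner_Integration.integrable_bound[OF Bochner_Integration.integrable_add[OF 1 2]])
       (auto simp: indicator_def)
qed

text \<open>
  The suffixes \<open>s\<close> and \<open>p\<close> denote partial derivatives along and around the cylinder. The decay
  is assumed at one end only; the antipodal symmetry carries it to the other end.
\<close>
locale antipodal_cylinder =
  fixes u us up uss usp upp :: "real \<Rightarrow> real \<Rightarrow> real" and C :: real
  assumes du: "((\<lambda>s. u s p) has_real_derivative us s p) (at s)"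
      "((\<lambda>p. u s p) has_real_derivative up s p) (at p)"
    and dus: "((\<lambda>s. us s p) has_real_derivative uss s p) (at s)"
      "((\<lambda>p. us s p) has_real_derivative usp s p) (at p)"
    and dup: "((\<lambda>s. up s p) has_real_derivative usp s p) (at s)"
      "((\<lambda>p. up s p) has_real_derivative upp s p) (at p)"
    and cont2: "continuous_on UNIV (\<lambda>z. uss (fst z) (snd z))" "continuous_on UNIV (\<lambda>z. usp (fst z) (snd z))"
      "continuous_on UNIV (\<lambda>z. upp (fst z) (snd z))"
    and cont1: "continuous_on UNIV (\<lambda>z. u (fst z) (snd z))" "continuous_on UNIV (\<lambda>z. us (fst z) (snd z))"
      "continuous_on UNIV (\<lambda>z. up (fst z) (snd z))"
    and periodic: "u s (p + 2 * pi) = u s p"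
    and antipodal: "u (- s) (p + pi) = - u s p"
    and decay: "s \<le> 0 \<Longrightarrow> \<bar>u s p\<bar> \<le> C * exp s" "s \<le> 0 \<Longrightarrow> \<bar>us s p\<bar> \<le> C * exp s"
      "s \<le> 0 \<Longrightarrow> \<bar>up s p\<bar> \<le> C * exp s" "s \<le> 0 \<Longrightarrow> \<bar>uss s p\<bar> \<le> C * exp s"
      "s \<le> 0 \<Longrightarrow> \<bar>usp s p\<bar> \<le> C * exp s" "s \<le> 0 \<Longrightarrow> \<bar>upp s p\<bar> \<le> C * exp s"
begin

lemma continuous_compose [continuous_intros]:
  fixes f g :: "'z::topological_space \<Rightarrow> real"
  assumes "continuous_on S f" "continuous_on S g"
  shows "continuous_on S (\<lambda>x. u (f x) (g x))" "continuous_on S (\<lambda>x. us (f x) (g x))"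
    "continuous_on S (\<lambda>x. up (f x) (g x))" "continuous_on S (\<lambda>x. uss (f x) (g x))"
    "continuous_on S (\<lambda>x. usp (f x) (g x))" "continuous_on S (\<lambda>x. upp (f x) (g x))"
  using cont1[THEN continuous_on_compose2, of S "\<lambda>x. (f x, g x)"]
    cont2[THEN continuous_on_compose2, of S "\<lambda>x. (f x, g x)"] assms
  by (auto intro!: continuous_intros)

lemma periodic_derivatives: "us s (p + 2 * pi) = us s p" "up s (p + 2 * pi) = up s p"
proof -
  have "((\<lambda>s. u s p) has_real_derivative us s (p + 2 * pi)) (at s)"
    using du(1)[of "p + 2 * pi" s] by (simp add: periodic)
  then show "us s (p + 2 * pi) = us s p" using DERIV_unique du(1) by blast
  have "((\<lambda>p. u s (p + 2 * pi)) has_real_derivative up s (p + 2 * pi)) (at p)"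
    using du(2)[of s "p + 2 * pi"] DERIV_shift by blast
  then show "up s (p + 2 * pi) = up s p" using DERIV_unique du(2)[of s p] by (simp add: periodic)
qed

lemma antipodal_transfer:
  fixes f fs fp :: "real \<Rightarrow> real \<Rightarrow> real"
  assumes "\<And>s p. f (- s) (p + pi) = k * f s p"
    and "\<And>s p. ((\<lambda>s. f s p) has_real_derivative fs s p) (at s)"
    and "\<And>s p. ((\<lambda>p. f s p) has_real_derivative fp s p) (at p)"
  shows "fs (- s) (p + pi) = - k * fs s p" "fp (- s) (p + pi) = k * fp s p"
proof -
  have "((\<lambda>s. f (- s) (p + pi)) has_real_derivative - fs (- s) (p + pi)) (at s)"
    using DERIV_chain2[OF assms(2)[where s="- s"] DERIV_minus[OF DERIV_ident], of "p + pi"] by simp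
  moreover have "((\<lambda>s. f (- s) (p + pi)) has_real_derivative k * fs s p) (at s)"
    unfolding assms(1) by (auto intro!: derivative_eq_intros assms)
  ultimately have "- fs (- s) (p + pi) = k * fs s p" by (rule DERIV_unique)
  then show "fs (- s) (p + pi) = - k * fs s p" by simp
  have "((\<lambda>p. f (- s) (p + pi)) has_real_derivative fp (- s) (p + pi)) (at p)"
    using assms(3)[of "- s" "p + pi"] DERIV_shift by blast
  moreover have "((\<lambda>p. f (- s) (p + pi)) has_real_derivative k * fp s p) (at p)"
    unfolding assms(1) by (auto intro!: derivative_eq_intros assms)
  ultimately show "fp (- s) (p + pi) = k * fp s p" by (rule DERIV_unique)
qed

lemma antipodal_derivatives:
  "us (- s) (p + pi) = us s p" "up (- s) (p + pi) = - up s p"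
  "uss (- s) (p + pi) = - uss s p" "usp (- s) (p + pi) = usp s p" "upp (- s) (p + pi) = - upp s p"
proof -
  note 1 = antipodal_transfer[of u "- 1" us up, simplified, OF antipodal du]
  note 2 = antipodal_transfer[of us 1 uss usp, simplified, OF 1(1) dus]
  note 3 = antipodal_transfer[of up "- 1" usp upp, simplified, OF 1(2) dup]
  show "us (- s) (p + pi) = us s p" "up (- s) (p + pi) = - up s p"
  "uss (- s) (p + pi) = - uss s p" "usp (- s) (p + pi) = usp s p" "upp (- s) (p + pi) = - upp s p"
    using 1 2 3 by simp_all
qed

lemma decay_abs:
  "\<bar>u s p\<bar> \<le> C * exp (- \<bar>s\<bar>)" "\<bar>us s p\<bar> \<le> C * exp (- \<bar>s\<bar>)" "\<bar>up s p\<bar> \<le> C * exp (- \<bar>s\<bar>)"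
  "\<bar>uss s p\<bar> \<le> C * exp (- \<bar>s\<bar>)" "\<bar>usp s p\<bar> \<le> C * exp (- \<bar>s\<bar>)" "\<bar>upp s p\<bar> \<le> C * exp (- \<bar>s\<bar>)"
proof -
  have neg: "- s \<le> 0" if "\<not> s \<le> 0" using that by simp
  note d = decay(1-6)[of "- s" "p + pi", unfolded antipodal antipodal_derivatives abs_minus_cancel]
  have m: "- \<bar>s\<bar> = (if s \<le> 0 then s else - s)" by simp
  show "\<bar>u s p\<bar> \<le> C * exp (- \<bar>s\<bar>)" "\<bar>us s p\<bar> \<le> C * exp (- \<bar>s\<bar>)" "\<bar>up s p\<bar> \<le> C * exp (- \<bar>s\<bar>)"
    "\<bar>uss s p\<bar> \<le> C * exp (- \<bar>s\<bar>)" "\<bar>usp s p\<bar> \<le> C * exp (- \<bar>s\<bar>)" "\<bar>upp s p\<bar> \<le> C * exp (- \<bar>s\<bar>)"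
    unfolding m using decay(1-6)[of s p] d neg by presburger+
qed

text \<open>
  The integrand of the theorem, multiplied by the area density of the sphere, in cylinder
  coordinates; it vanishes for \<open>u = sinh s\<close> and for \<open>u = cos p\<close> and \<open>u = sin p\<close>, the three linear forms.
\<close>
definition J :: "real \<Rightarrow> real \<Rightarrow> real" where
  "J s p = (uss s p - tanh s * us s p) * (tanh s * us s p - upp s p - u s p) + (usp s p)\<^sup>2"

definition circle_J :: "real \<Rightarrow> real" where "circle_J s = integral {0..2*pi} (J s)"

definition energy :: "real \<Rightarrow> real" where
  "energy s = integral {0..2*pi} (\<lambda>p. (1 - (tanh s)\<^sup>2) * ((us s p)\<^sup>2 + (up s p)\<^sup>2 - (u s p)\<^sup>2) / 2)"

definition flux :: "real \<Rightarrow> real" where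
  "flux s = integral {0..2*pi} (\<lambda>p. tanh s * ((us s p)\<^sup>2 - (up s p)\<^sup>2 + (u s p)\<^sup>2) / 2 - u s p * us s p)
     - integral {0..2*pi} (\<lambda>p. us s p * upp s p)"

text \<open>
  The energy identity. The Jacobian part \<open>usp^2 - uss * upp\<close> of \<open>J\<close> is minus the derivative of
  the second integral in \<open>flux\<close>; in the remaining terms the second derivatives occur only in total derivatives,
  along the cylinder or around it.
\<close>
lemma flux_deriv: "(flux has_real_derivative circle_J s - energy s) (at s)"
proof -
  let ?q = "1 - (tanh s)\<^sup>2"
  let ?A = "\<lambda>s p. (1 - (tanh s)\<^sup>2) * ((us s p)\<^sup>2 - (up s p)\<^sup>2 + (u s p)\<^sup>2) / 2
       + tanh s * (us s p * uss s p - up s p * usp s p + u s p * us s p) - (us s p)\<^sup>2 - u s p * uss s p"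
  let ?B = "\<lambda>p. uss s p * upp s p - usp s p * usp s p"
  let ?D = "\<lambda>p. us s p * upp s p + usp s p * up s p"
  have 1: "((\<lambda>s. integral {0..2*pi} (\<lambda>p. tanh s * ((us s p)\<^sup>2 - (up s p)\<^sup>2 + (u s p)\<^sup>2) / 2 - u s p * us s p))
    has_real_derivative integral {0..2*pi} (?A s)) (at s)"
  proof (rule integral_parameter_has_derivative)
    show "((\<lambda>s. tanh s * ((us s p)\<^sup>2 - (up s p)\<^sup>2 + (u s p)\<^sup>2) / 2 - u s p * us s p) has_real_derivative ?A s p) (at s)" for s p
      by (auto intro!: derivative_eq_intros du dus dup simp: power2_eq_square)
  qed (intro continuous_intros; simp)+
  have 2: "((\<lambda>s. integral {0..2*pi} (\<lambda>p. us s p * upp s p)) has_real_derivative integral {0..2*pi} ?B) (at s)"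
    by (rule circle_integral_jacobian_derivative[OF dus dup])
       (intro continuous_intros; simp; fail | use periodic_derivatives[of _ 0] in simp)+
  have 3: "(?D has_integral us s (2*pi) * up s (2*pi) - us s 0 * up s 0) {0..2*pi}"
  proof (rule fundamental_theorem_of_calculus)
    fix p
    have "((\<lambda>p. us s p * up s p) has_real_derivative ?D p) (at p within {0..2*pi})"
      by (rule derivative_eq_intros dus[THEN has_field_derivative_at_within] dup[THEN has_field_derivative_at_within] refl)+ simp
    then show "((\<lambda>p. us s p * up s p) has_vector_derivative ?D p) (at p within {0..2*pi})"
      by (simp add: has_real_derivative_iff_has_vector_derivative)
  qed simp
  have D0: "integral {0..2*pi} ?D = 0"
    using 3 periodic_derivatives[of s 0] by (simp add: integral_unique)
  have "circle_J s = integral {0..2*pi} (\<lambda>p. ?A s p - ?B p + ?q * ((us s p)\<^sup>2 + (up s p)\<^sup>2 - (u s p)\<^sup>2) / 2 + tanh s * ?D p)"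
    unfolding circle_J_def J_def by (rule integral_cong) (simp add: field_simps power2_eq_square)
  also have "\<dots> = integral {0..2*pi} (?A s) - integral {0..2*pi} ?B + energy s + tanh s * integral {0..2*pi} ?D"
    unfolding energy_def
    by (intro integral_unique has_integral_add has_integral_diff has_integral_mult_right integrable_integral
        integrable_continuous_real continuous_intros) simp_all
  finally have "circle_J s - energy s = integral {0..2*pi} (?A s) - integral {0..2*pi} ?B" by (simp add: D0)
  then show ?thesis unfolding flux_def[abs_def] using DERIV_diff[OF 1 2] by simp
qed

lemma decay_const_nonneg: "0 \<le> C * exp (- \<bar>s\<bar>)"
  using decay_abs(1)[of s 0] by linarith

lemma circle_integral_bound:
  fixes f :: "real \<Rightarrow> real"
  assumes "continuous_on {0..2*pi} f" "\<And>p. \<bar>f p\<bar> \<le> B"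
  shows "\<bar>integral {0..2*pi} f\<bar> \<le> B * (2 * pi)"
  using integral_bound[of 0 "2 * pi" f B] assms by simp

lemma prod_decay:
  fixes x y b :: real
  assumes "\<bar>x\<bar> \<le> b" "\<bar>y\<bar> \<le> b"
  shows "\<bar>x * y\<bar> \<le> b\<^sup>2" "x\<^sup>2 \<le> b\<^sup>2"
  using assms mult_mono[OF assms] abs_le_square_iff[of x b] by (auto simp: abs_mult power2_eq_square)

lemma abs_tanh_le: "\<bar>tanh s\<bar> \<le> (1::real)"
  using tanh_real_lt_1[of s] tanh_real_gt_neg1[of s] by linarith

lemma J_bound: "\<bar>J s p\<bar> \<le> 7 * (C * exp (- \<bar>s\<bar>))\<^sup>2"
proof -
  let ?b = "C * exp (- \<bar>s\<bar>)"
  note d = decay_abs[of s p]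
  have t: "\<bar>tanh s * us s p\<bar> \<le> ?b"
    using mult_mono[OF abs_tanh_le d(2)] by (simp add: abs_mult)
  have "\<bar>(uss s p - tanh s * us s p) * (tanh s * us s p - upp s p - u s p)\<bar> \<le> (2 * ?b) * (3 * ?b)"
    unfolding abs_mult using t d decay_const_nonneg[of s] by (intro mult_mono) linarith+
  also have "\<dots> = 6 * ?b\<^sup>2" by (simp add: power2_eq_square)
  finally show ?thesis
    using prod_decay(2)[OF d(5) d(5)] zero_le_power2[of "usp s p"] unfolding J_def by linarith
qed

lemma flux_bound: "\<bar>flux s\<bar> \<le> 6 * pi * (C * exp (- \<bar>s\<bar>))\<^sup>2"
proof -
  let ?b = "C * exp (- \<bar>s\<bar>)"
  have 1: "\<bar>integral {0..2*pi} (\<lambda>p. tanh s * ((us s p)\<^sup>2 - (up s p)\<^sup>2 + (u s p)\<^sup>2) / 2 - u s p * us s p)\<bar> \<le> (2 * ?b\<^sup>2) * (2 * pi)"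
  proof (rule circle_integral_bound)
    fix p
    note d = decay_abs[of s p]
    have "\<bar>(us s p)\<^sup>2 - (up s p)\<^sup>2 + (u s p)\<^sup>2\<bar> \<le> 2 * ?b\<^sup>2"
      using prod_decay(2)[OF d(1) d(1)] prod_decay(2)[OF d(2) d(2)] prod_decay(2)[OF d(3) d(3)]
        zero_le_power2[of "u s p"] zero_le_power2[of "us s p"] zero_le_power2[of "up s p"]
      by linarith
    then have "\<bar>tanh s * ((us s p)\<^sup>2 - (up s p)\<^sup>2 + (u s p)\<^sup>2)\<bar> \<le> 1 * (2 * ?b\<^sup>2)"
      unfolding abs_mult by (intro mult_mono abs_tanh_le) auto
    then show "\<bar>tanh s * ((us s p)\<^sup>2 - (up s p)\<^sup>2 + (u s p)\<^sup>2) / 2 - u s p * us s p\<bar> \<le> 2 * ?b\<^sup>2"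
      using prod_decay(1)[OF d(1) d(2)] by linarith
  qed (intro continuous_intros; simp)
  have 2: "\<bar>integral {0..2*pi} (\<lambda>p. us s p * upp s p)\<bar> \<le> ?b\<^sup>2 * (2 * pi)"
    by (intro circle_integral_bound continuous_intros prod_decay(1) decay_abs)
  show ?thesis using 1 2 unfolding flux_def by (simp add: algebra_simps)
qed

text \<open>
  The parts of \<open>u\<close> that are odd and even under \<open>s \<mapsto> - s\<close>. By the antipodal symmetry they are
  also the parts that are \<open>pi\<close>-periodic and \<open>pi\<close>-antiperiodic in the angle.
\<close>
definition u_odd :: "real \<Rightarrow> real \<Rightarrow> real" where "u_odd s p = (u s p - u (- s) p) / 2"
definition u_odd_s :: "real \<Rightarrow> real \<Rightarrow> real" where "u_odd_s s p = (us s p + us (- s) p) / 2"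
definition u_odd_p :: "real \<Rightarrow> real \<Rightarrow> real" where "u_odd_p s p = (up s p - up (- s) p) / 2"
definition u_even :: "real \<Rightarrow> real \<Rightarrow> real" where "u_even s p = (u s p + u (- s) p) / 2"
definition u_even_s :: "real \<Rightarrow> real \<Rightarrow> real" where "u_even_s s p = (us s p - us (- s) p) / 2"
definition u_even_p :: "real \<Rightarrow> real \<Rightarrow> real" where "u_even_p s p = (up s p + up (- s) p) / 2"

lemma deriv_u_neg: "((\<lambda>s. u (- s) p) has_real_derivative - us (- s) p) (at s)"
  using DERIV_chain2[OF du(1)[where s="- s"] DERIV_minus[OF DERIV_ident], of p] by simp

lemma parts_deriv:
  "((\<lambda>s. u_odd s p) has_real_derivative u_odd_s s p) (at s)"
  "((\<lambda>s. u_even s p) has_real_derivative u_even_s s p) (at s)"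
  "((\<lambda>p. u_even s p) has_real_derivative u_even_p s p) (at p)"
  unfolding u_odd_def u_odd_s_def u_even_def u_even_s_def u_even_p_def
  by (auto intro!: derivative_eq_intros du deriv_u_neg)

lemma continuous_parts [continuous_intros]:
  fixes f g :: "'z::topological_space \<Rightarrow> real"
  assumes "continuous_on S f" "continuous_on S g"
  shows "continuous_on S (\<lambda>x. u_odd (f x) (g x))" "continuous_on S (\<lambda>x. u_odd_s (f x) (g x))"
    "continuous_on S (\<lambda>x. u_odd_p (f x) (g x))" "continuous_on S (\<lambda>x. u_even (f x) (g x))"
    "continuous_on S (\<lambda>x. u_even_s (f x) (g x))" "continuous_on S (\<lambda>x. u_even_p (f x) (g x))"
  unfolding u_odd_def u_odd_s_def u_odd_p_def u_even_def u_even_s_def u_even_p_def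
  by (intro continuous_intros assms; simp)+

lemma u_even_wirtinger:
  "integral {0..2*pi} (\<lambda>p. (u_even s p)\<^sup>2) \<le> integral {0..2*pi} (\<lambda>p. (u_even_p s p)\<^sup>2)"
proof (rule wirtinger_antiperiodic[OF parts_deriv(3)])
  show "u_even s (p + pi) = - u_even s p" for p
  proof -
    have "u s (p + pi) + u (- s) (p + pi) = - (u s p + u (- s) p)"
      using antipodal[of s p] antipodal[of "- s" p] by simp
    then have "(u s (p + pi) + u (- s) (p + pi)) / 2 = - (u s p + u (- s) p) / 2" by (rule arg_cong)
    also have "\<dots> = - ((u s p + u (- s) p) / 2)" by (rule minus_divide_left[symmetric])
    finally show ?thesis unfolding u_even_def .
  qed
qed (intro continuous_intros)

definition odd_mass :: "real \<Rightarrow> real" where "odd_mass s = integral {0..2*pi} (\<lambda>p. (u_odd s p)\<^sup>2)"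

lemma odd_mass_deriv: "(odd_mass has_real_derivative integral {0..2*pi} (\<lambda>p. 2 * u_odd s p * u_odd_s s p)) (at s)"
  unfolding odd_mass_def[abs_def]
  by (rule integral_parameter_has_derivative)
     (auto intro!: derivative_eq_intros parts_deriv continuous_intros)

lemma odd_mass_bound: "\<bar>odd_mass s\<bar> \<le> 2 * pi * (C * exp (- \<bar>s\<bar>))\<^sup>2"
proof -
  have "\<bar>odd_mass s\<bar> \<le> (C * exp (- \<bar>s\<bar>))\<^sup>2 * (2 * pi)"
    unfolding odd_mass_def
  proof (rule circle_integral_bound)
    fix p
    have "\<bar>u_odd s p\<bar> \<le> C * exp (- \<bar>s\<bar>)"
      using decay_abs(1)[of s p] decay_abs(1)[of "- s" p] unfolding u_odd_def by (simp add: abs_le_iff)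
    then show "\<bar>(u_odd s p)\<^sup>2\<bar> \<le> (C * exp (- \<bar>s\<bar>))\<^sup>2" using prod_decay(2) by simp
  qed (intro continuous_intros)
  then show ?thesis by (simp add: mult.commute)
qed

text \<open>
  The squares that are left over in the energy; the first one vanishes exactly when \<open>u_odd\<close> is
  proportional to \<open>sinh s\<close>.
\<close>
definition defect :: "real \<Rightarrow> real \<Rightarrow> real" where
  "defect s p = (1 - (tanh s)\<^sup>2) * ((u_odd_s s p - u_odd s p / tanh s)\<^sup>2 + (u_odd_p s p)\<^sup>2 + (u_even_s s p)\<^sup>2)"

text \<open>
  The boundary terms of both integrations by parts on \<open>- s .. s\<close>. The factor \<open>1 / tanh s - tanh s\<close> is
  \<open>coth s / cosh^2 s\<close>, which completes the square for the odd part.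
\<close>
definition boundary :: "real \<Rightarrow> real" where
  "boundary s = flux s - flux (- s) + odd_mass s * (1 / tanh s - tanh s)"

lemma one_minus_tanh_sq_pos: "0 < 1 - (tanh (s::real))\<^sup>2"
  using tanh_real_lt_1[of s] tanh_real_gt_neg1[of s] by (simp add: abs_square_less_1 abs_less_iff)

text \<open>
  By the parallelogram law the energies at \<open>s\<close> and \<open>- s\<close> add up to twice those of the even and the odd part. Wirtinger's
  inequality disposes of the even part. For the odd part, \<open>(v_s^2 - v^2) / cosh^2\<close> differs from
  \<open>(v_s - v coth)^2 / cosh^2\<close> by the derivative of \<open>v^2 coth / cosh^2\<close>.
\<close>
lemma boundary_deriv:
  assumes "s > 0"
  obtains d where "(boundary has_real_derivative d) (at s)" "d + integral {0..2*pi} (defect s) \<le> circle_J s + circle_J (- s)"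
proof -
  let ?t = "tanh s" and ?q = "1 - (tanh s)\<^sup>2"
  have t: "?t \<noteq> 0" using assms by simp
  define n' where "n' = integral {0..2*pi} (\<lambda>p. 2 * u_odd s p * u_odd_s s p)"
  define d where "d = (circle_J s - energy s) + (circle_J (- s) - energy (- s)) + (n' * (1 / ?t - ?t) - odd_mass s * ((1 / ?t\<^sup>2 + 1) * ?q))"
  have neg: "((\<lambda>s. flux (- s)) has_real_derivative - (circle_J (- s) - energy (- s))) (at s)"
    using DERIV_chain2[OF flux_deriv[of "- s"] DERIV_minus[OF DERIV_ident]] by simp
  have "(boundary has_real_derivative d) (at s)"
    unfolding boundary_def[abs_def] d_def
    using t by (auto intro!: derivative_eq_intros flux_deriv neg odd_mass_deriv simp: n'_def field_simps power2_eq_square)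
  moreover have "d + integral {0..2*pi} (defect s) \<le> circle_J s + circle_J (- s)"
  proof -
    let ?P = "\<lambda>s p. (1 - (tanh s)\<^sup>2) * ((us s p)\<^sup>2 + (up s p)\<^sup>2 - (u s p)\<^sup>2) / 2"
    have eq: "defect s p + ?q * ((u_even_p s p)\<^sup>2 - (u_even s p)\<^sup>2) = ?P s p + ?P (- s) p
         - ((1 / ?t - ?t) * (2 * u_odd s p * u_odd_s s p) - ((1 / ?t\<^sup>2 + 1) * ?q) * (u_odd s p)\<^sup>2)" for p
    proof -
      define X where "X = 2 * u_odd s p * u_odd_s s p / ?t"
      define Y where "Y = (1 / ?t\<^sup>2 + 1) * (u_odd s p)\<^sup>2"
      have 1: "?P s p + ?P (- s) p = ?q * ((u_odd_s s p)\<^sup>2 + (u_odd_p s p)\<^sup>2 - (u_odd s p)\<^sup>2 + (u_even_s s p)\<^sup>2 + (u_even_p s p)\<^sup>2 - (u_even s p)\<^sup>2)"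
        unfolding u_odd_def u_odd_s_def u_odd_p_def u_even_def u_even_s_def u_even_p_def by (simp add: field_simps power2_eq_square)
      have 2: "(u_odd_s s p - u_odd s p / ?t)\<^sup>2 = (u_odd_s s p)\<^sup>2 - (u_odd s p)\<^sup>2 - (X - Y)"
        unfolding X_def Y_def by (simp add: power2_diff power_divide algebra_simps)
      have 3: "(1 / ?t - ?t) * (2 * u_odd s p * u_odd_s s p) = ?q * X"
        unfolding X_def using t by (simp add: field_simps power2_eq_square)
      have 4: "((1 / ?t\<^sup>2 + 1) * ?q) * (u_odd s p)\<^sup>2 = ?q * Y"
        unfolding Y_def by (simp only: mult.assoc mult.commute mult.left_commute)
      show ?thesis
        unfolding defect_def 1 2 3 4 by (simp add: algebra_simps)
    qed
    have "integral {0..2*pi} (defect s) + ?q * (integral {0..2*pi} (\<lambda>p. (u_even_p s p)\<^sup>2) - integral {0..2*pi} (\<lambda>p. (u_even s p)\<^sup>2))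
       = integral {0..2*pi} (\<lambda>p. defect s p + ?q * ((u_even_p s p)\<^sup>2 - (u_even s p)\<^sup>2))"
      unfolding defect_def
      by (intro integral_unique[symmetric] has_integral_add has_integral_diff has_integral_mult_right integrable_integral
        integrable_continuous_real continuous_intros) (use t in simp_all)
    also have "\<dots> = energy s + energy (- s) - ((1 / ?t - ?t) * n' - ((1 / ?t\<^sup>2 + 1) * ?q) * odd_mass s)"
      unfolding eq energy_def n'_def odd_mass_def
      by (intro integral_unique has_integral_add has_integral_diff has_integral_mult_right integrable_integral
        integrable_continuous_real continuous_intros) simp_all
    finally have "integral {0..2*pi} (defect s) + ?q * (integral {0..2*pi} (\<lambda>p. (u_even_p s p)\<^sup>2) - integral {0..2*pi} (\<lambda>p. (u_even s p)\<^sup>2))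
      = circle_J s + circle_J (- s) - d"
      unfolding d_def by (simp add: algebra_simps)
    moreover have "0 \<le> ?q * (integral {0..2*pi} (\<lambda>p. (u_even_p s p)\<^sup>2) - integral {0..2*pi} (\<lambda>p. (u_even s p)\<^sup>2))"
      using u_even_wirtinger[of s] one_minus_tanh_sq_pos[of s] by simp
    ultimately show ?thesis by linarith
  qed
  ultimately show ?thesis by (rule that)
qed

lemma decay_limit: "((\<lambda>s. k * (C * exp (- \<bar>s\<bar>))\<^sup>2) \<longlongrightarrow> 0) at_top"
proof -
  have "((\<lambda>s. k * (C * exp (- s))\<^sup>2) \<longlongrightarrow> k * (C * 0)\<^sup>2) at_top"
    by (intro tendsto_intros filterlim_compose[OF exp_at_bot] filterlim_uminus_at_bot_at_top)
  then have "((\<lambda>s. k * (C * exp (- s))\<^sup>2) \<longlongrightarrow> 0) at_top" by simp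
  then show ?thesis
    by (rule Lim_transform_eventually) (auto intro: eventually_mono[OF eventually_ge_at_top[of 0]])
qed

text \<open>
  At \<open>0\<close> the pole of the hyperbolic cotangent in \<open>boundary\<close> is harmless because \<open>odd_mass\<close> vanishes there to second order.
\<close>
lemma boundary_limits: "(boundary \<longlongrightarrow> 0) at_top" "(boundary \<longlongrightarrow> 0) (at_right 0)"
proof -
  have z: "(f \<longlongrightarrow> 0) at_top" if "\<And>s. \<bar>f s\<bar> \<le> k * (C * exp (- \<bar>s\<bar>))\<^sup>2" for f :: "real \<Rightarrow> real" and k
    by (rule Lim_null_comparison[OF _ decay_limit[of k]]) (use that in simp)
  have "((\<lambda>s. flux s - flux (- s) + odd_mass s * (1 / tanh s - tanh s)) \<longlongrightarrow> 0 - 0 + 0 * (1 / 1 - 1)) at_top"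
    by (intro tendsto_intros z[of flux, OF flux_bound] z[of odd_mass, OF odd_mass_bound] tanh_real_at_top
        z[of "\<lambda>s. flux (- s)" "6 * pi"]) (use flux_bound[of "- s" for s] in simp_all)
  then show "(boundary \<longlongrightarrow> 0) at_top" by (simp add: boundary_def[abs_def])
  have N0: "odd_mass 0 = 0" by (simp add: odd_mass_def u_odd_def)
  have "(odd_mass has_real_derivative 0) (at 0)"
    using odd_mass_deriv[of 0] by (simp add: u_odd_def)
  then have 1: "((\<lambda>s. odd_mass s / s) \<longlongrightarrow> 0) (at 0)" by (simp add: has_field_derivative_iff N0)
  have "(tanh has_real_derivative 1) (at 0)"
    by (auto intro!: derivative_eq_intros)
  then have 2: "((\<lambda>s::real. tanh s / s) \<longlongrightarrow> 1) (at 0)" by (simp add: has_field_derivative_iff)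
  have "((\<lambda>s. (odd_mass s / s) / (tanh s / s)) \<longlongrightarrow> 0) (at 0)"
    using tendsto_divide[OF 1 2] by simp
  then have "((\<lambda>s. odd_mass s / tanh s) \<longlongrightarrow> 0) (at 0)"
    by (rule Lim_transform_eventually[OF _ ]) (auto simp: eventually_at_filter)
  moreover have c: "isCont flux 0" "isCont (\<lambda>s. flux (- s)) 0" "isCont odd_mass 0"
    using DERIV_isCont[OF flux_deriv] DERIV_isCont[OF odd_mass_deriv] by (auto intro!: continuous_intros simp: isCont_o2)
  ultimately have "((\<lambda>s. flux s - flux (- s) + (odd_mass s / tanh s - odd_mass s * tanh s)) \<longlongrightarrow> flux 0 - flux (- 0) + (0 - odd_mass 0 * tanh 0)) (at 0)"
    by (intro tendsto_intros) (auto simp: isCont_def)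
  then have "(boundary \<longlongrightarrow> 0) (at 0)"
    by (simp add: boundary_def[abs_def] algebra_simps)
  then show "(boundary \<longlongrightarrow> 0) (at_right 0)" by (rule tendsto_mono[OF at_le, rotated]) simp
qed

text \<open>
  By \<open>boundary_deriv\<close> the function \<open>M\<close>, the integral of \<open>circle_J\<close> over \<open>- s .. s\<close> minus \<open>boundary s\<close>,
  increases at least at the rate of the integrated defect. It rises from \<open>0\<close> to \<open>I\<close>, so \<open>I\<close> is
  nonnegative; if \<open>I = 0\<close>, then \<open>M\<close> is constant and the defect vanishes identically. Then
  the even part does not depend on \<open>s\<close> and the odd part is a multiple of \<open>sinh s\<close>, and
  the decay at infinity makes both zero.
\<close>
theorem J_integral_nonneg:
  assumes lim: "((\<lambda>L. integral {-L..L} circle_J) \<longlongrightarrow> I) at_top"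
  shows "0 \<le> I" and "I = 0 \<Longrightarrow> p \<in> {0..2*pi} \<Longrightarrow> u s p = 0"
proof -
  have cj: "continuous_on S circle_J" for S
    unfolding circle_J_def[abs_def] J_def
    by (rule continuous_on_subset[of UNIV], intro integral_parameter_continuous continuous_intros) simp_all
  have cj': "continuous_on S (\<lambda>s. circle_J s + circle_J (- s))" for S
    by (intro continuous_intros cj continuous_on_compose2[OF cj[of UNIV], of _ uminus]) auto
  define M where "M s = integral {0..s} (\<lambda>s. circle_J s + circle_J (- s)) - boundary s" for s
  have sym: "integral {0..L} (\<lambda>s. circle_J s + circle_J (- s)) = integral {-L..L} circle_J" if "0 \<le> L" for L
  proof -
    have i: "circle_J integrable_on {a..b}" for a b by (rule integrable_continuous_real[OF cj])
    have "((\<lambda>s. circle_J (- s)) has_integral integral {-L..0} circle_J) {0..L}"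
      using has_integral_reflect_lemma_real[OF integrable_integral[OF i[of "-L" 0]]] by simp
    then have "integral {0..L} (\<lambda>s. circle_J s + circle_J (- s)) = integral {0..L} circle_J + integral {-L..0} circle_J"
      by (intro integral_unique has_integral_add integrable_integral i)
    also have "\<dots> = integral {-L..L} circle_J"
      using Henstock_Kurzweil_Integration.integral_combine[of "-L" 0 L circle_J] i that by simp
    finally show ?thesis .
  qed
  have dM: "\<exists>m. (M has_real_derivative m) (at s) \<and> integral {0..2*pi} (defect s) \<le> m" if s: "s > 0" for s
  proof -
    obtain d where d: "(boundary has_real_derivative d) (at s)" "d + integral {0..2*pi} (defect s) \<le> circle_J s + circle_J (- s)"
      using boundary_deriv[OF s] by blast
    have "((\<lambda>s. integral {0..s} (\<lambda>s. circle_J s + circle_J (- s))) has_real_derivative circle_J s + circle_J (- s)) (at s within {0..s+1})"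
      using s by (intro integral_has_real_derivative cj') auto
    then have "((\<lambda>s. integral {0..s} (\<lambda>s. circle_J s + circle_J (- s))) has_real_derivative circle_J s + circle_J (- s)) (at s)"
      using s by (simp add: at_within_Icc_at)
    from DERIV_diff[OF this d(1)] show ?thesis
      unfolding M_def[abs_def] using d(2) by (intro exI conjI) auto
  qed
  have cK: "continuous_on {0..2*pi} (defect s)" if "s > 0" for s
    unfolding defect_def[abs_def] using that by (intro continuous_intros) simp_all
  have K0: "0 \<le> defect s p" for s p
    unfolding defect_def using one_minus_tanh_sq_pos[of s] by simp
  have IK: "0 \<le> integral {0..2*pi} (defect s)" if "s > 0" for s
    using that by (intro integral_nonneg integrable_continuous_real cK K0)
  have mono: "M a \<le> M b" if "0 < a" "a \<le> b" for a b
    by (rule DERIV_nonneg_imp_nondecreasing[OF that(2)]) (use dM IK that in \<open>meson less_le_trans order_trans\<close>)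
  have Mtop: "(M \<longlongrightarrow> I) at_top"
  proof -
    have "((\<lambda>s. integral {-s..s} circle_J - boundary s) \<longlongrightarrow> I - 0) at_top"
      by (intro tendsto_diff lim boundary_limits)
    then have "((\<lambda>s. integral {-s..s} circle_J - boundary s) \<longlongrightarrow> I) at_top" by simp
    then show ?thesis
      by (rule Lim_transform_eventually) (auto simp: M_def sym intro: eventually_mono[OF eventually_ge_at_top[of 0]])
  qed
  have M0: "(M \<longlongrightarrow> 0) (at_right 0)"
  proof -
    have d: "((\<lambda>s. integral {0..s} (\<lambda>s. circle_J s + circle_J (- s))) has_real_derivative circle_J 0 + circle_J (- 0)) (at 0 within {0..1})"
      by (intro integral_has_real_derivative cj') auto
    have "((\<lambda>s. integral {0..s} (\<lambda>s. circle_J s + circle_J (- s))) \<longlongrightarrow> 0) (at 0 within {0..1})"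
      using DERIV_continuous[OF d] by (simp add: continuous_within)
    then have "((\<lambda>s. integral {0..s} (\<lambda>s. circle_J s + circle_J (- s))) \<longlongrightarrow> 0) (at_right 0)"
      by (simp add: at_within_Icc_at_right)
    from tendsto_diff[OF this boundary_limits(2)] show ?thesis by (simp add: M_def[abs_def])
  qed
  have lower: "0 \<le> M s" if "s > 0" for s
  proof (rule tendsto_upperbound[OF M0])
    show "\<forall>\<^sub>F a in at_right 0. M a \<le> M s"
      using that mono by (auto simp: eventually_at_right_field intro!: exI[of _ s])
  qed simp
  have upper: "M s \<le> I" if "s > 0" for s
  proof (rule tendsto_lowerbound[OF Mtop])
    show "\<forall>\<^sub>F b in at_top. M s \<le> M b"
      using that mono by (auto intro: eventually_mono[OF eventually_ge_at_top[of s]])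
  qed simp
  show "0 \<le> I" using lower[of 1] upper[of 1] by simp
  assume I: "I = 0" and p: "p \<in> {0..2*pi}"
  have M_eq: "M s = 0" if "s > 0" for s using lower[OF that] upper[OF that] I by simp
  have K_eq: "defect s p = 0" if s: "s > 0" for s
  proof -
    obtain m where m: "(M has_real_derivative m) (at s)" "integral {0..2*pi} (defect s) \<le> m" using dM[OF s] by blast
    have "((\<lambda>_. 0) has_real_derivative m) (at s)"
      by (rule has_field_derivative_transform_within_open[OF m(1), of "{0<..}"]) (use M_eq s in auto)
    then have "m = 0" using DERIV_unique DERIV_const by blast
    then have "integral {0..2*pi} (defect s) = 0" using m(2) IK[OF s] by simp
    then show ?thesis using integral_eq_0_iff[OF cK[OF s]] K0 p by simp
  qed
  have K_eq': "u_even_s s p = 0" "u_odd_s s p = u_odd s p / tanh s" if "s > 0" for s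
  proof -
    have "(u_odd_s s p - u_odd s p / tanh s)\<^sup>2 + (u_odd_p s p)\<^sup>2 + (u_even_s s p)\<^sup>2 = 0"
      using K_eq[OF that] one_minus_tanh_sq_pos[of s] unfolding defect_def by simp
    then show "u_even_s s p = 0" "u_odd_s s p = u_odd s p / tanh s"
      by (simp_all add: add_nonneg_eq_0_iff)
  qed
  have small: "((\<lambda>s. C * exp (- \<bar>s\<bar>)) \<longlongrightarrow> 0) at_top"
  proof -
    have "((\<lambda>s. C * exp (- s)) \<longlongrightarrow> C * 0) at_top"
      by (intro tendsto_intros filterlim_compose[OF exp_at_bot] filterlim_uminus_at_bot_at_top)
    then have "((\<lambda>s. C * exp (- s)) \<longlongrightarrow> 0) at_top" by simp
    then show ?thesis
      by (rule Lim_transform_eventually) (auto intro: eventually_mono[OF eventually_ge_at_top[of 0]])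
  qed
  have vanishing: "f s = 0"
    if s: "s > 0" and df: "\<And>s. s > 0 \<Longrightarrow> (f has_real_derivative 0) (at s)"
      and bd: "\<And>s. s \<ge> 2 \<Longrightarrow> \<bar>f s\<bar> \<le> C * exp (- \<bar>s\<bar>)" for f :: "real \<Rightarrow> real" and s
  proof -
    have eq: "f t = f s" if "t > 0" for t
      using DERIV_isconst3[of 0 "max s t + 1" t s f] df s that by force
    have "(f \<longlongrightarrow> 0) at_top"
      by (rule Lim_null_comparison[OF _ small]) (use bd in \<open>auto intro: eventually_mono[OF eventually_ge_at_top[of 2]]\<close>)
    moreover have "(f \<longlongrightarrow> f s) at_top"
      by (rule tendsto_eventually) (use eq in \<open>auto intro: eventually_mono[OF eventually_gt_at_top[of 0]]\<close>)
    ultimately show ?thesis using tendsto_unique[OF trivial_limit_at_top_linorder] by blast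
  qed
  have u_even0: "u_even s p = 0" if "s > 0" for s
  proof (rule vanishing[of s "\<lambda>s. u_even s p", OF that])
    show "((\<lambda>s. u_even s p) has_real_derivative 0) (at s)" if "s > 0" for s
      using parts_deriv(2)[of p s] K_eq'(1)[OF that] by simp
    show "\<bar>u_even s p\<bar> \<le> C * exp (- \<bar>s\<bar>)" for s
      using decay_abs(1)[of s p] decay_abs(1)[of "- s" p] unfolding u_even_def by (simp add: abs_le_iff)
  qed
  have u_odd0: "u_odd s p = 0" if "s > 0" for s
  proof -
    have "u_odd s p / sinh s = 0"
    proof (rule vanishing[of s "\<lambda>s. u_odd s p / sinh s", OF that])
      show "((\<lambda>s. u_odd s p / sinh s) has_real_derivative 0) (at s)" if s: "s > 0" for s
        using s K_eq'(2)[OF s] cosh_real_pos[of s]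
        by (auto intro!: derivative_eq_intros parts_deriv simp: tanh_def)
      show "\<bar>u_odd s p / sinh s\<bar> \<le> C * exp (- \<bar>s\<bar>)" if s: "s \<ge> 2" for s
      proof -
        have "1 \<le> sinh s"
        proof -
          have "1 + s \<le> exp s" "exp (- s) \<le> 1" using s by simp_all
          then have "2 \<le> exp s - exp (- s)" using s by linarith
          then show ?thesis by (simp add: sinh_field_def)
        qed
        moreover have "\<bar>u_odd s p\<bar> \<le> C * exp (- \<bar>s\<bar>)"
          using decay_abs(1)[of s p] decay_abs(1)[of "- s" p] unfolding u_odd_def by (simp add: abs_le_iff)
        ultimately have "\<bar>u_odd s p\<bar> \<le> C * exp (- \<bar>s\<bar>) * sinh s" and "\<bar>sinh s\<bar> = sinh s" "0 < sinh s"
          using mult_left_mono[of 1 "sinh s" "C * exp (- \<bar>s\<bar>)"] decay_const_nonneg[of s] s by simp_all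
        then show ?thesis by (simp only: abs_divide pos_divide_le_eq)
      qed
    qed
    then show ?thesis using that by simp
  qed
  have pos: "u s p = 0 \<and> u (- s) p = 0" if "s > 0" for s
    using u_even0[OF that] u_odd0[OF that] unfolding u_even_def u_odd_def by simp
  show "u s p = 0"
  proof -
    consider "s > 0" | "- s > 0" | "s = 0" by linarith
    then show ?thesis
    proof cases
      case 1 then show ?thesis using pos by blast
    next
      case 2 then show ?thesis using pos[of "- s"] by simp
    next
      case 3
      have "((\<lambda>s. u s p) \<longlongrightarrow> u 0 p) (at 0)" using DERIV_isCont[OF du(1)] by (simp add: isCont_def)
      then have a: "((\<lambda>s. u s p) \<longlongrightarrow> u 0 p) (at_right 0)" by (rule tendsto_mono[OF at_le, rotated]) simp
      have "((\<lambda>s. u s p) \<longlongrightarrow> 0) (at_right 0)"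
        by (rule tendsto_eventually) (use pos in \<open>auto simp: eventually_at_filter\<close>)
      then show ?thesis using tendsto_unique[OF trivial_limit_at_right_real a] 3 by simp
    qed
  qed
qed

lemma integrable_J:
  "integrable (lborel \<Otimes>\<^sub>M lborel) (\<lambda>(s, p). indicator {0..2*pi} p * J s p)"
proof -
  have J: "continuous_on UNIV (\<lambda>z. J (fst z) (snd z))"
    unfolding J_def by (intro continuous_intros; simp)
  then have [measurable]: "(\<lambda>z. J (fst z) (snd z)) \<in> borel_measurable (lborel \<Otimes>\<^sub>M lborel)"
    using borel_measurable_continuous_onI lborel_prod by (metis measurable_lborel2)
  define g where "g z = exp (- 2 * \<bar>fst z\<bar>) * (indicator {0..2*pi} (snd z) :: real)" for z :: "real \<times> real"
  have 1: "integrable (lborel \<Otimes>\<^sub>M lborel) g"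
  proof (rule lborel_pair.Fubini_integrable)
    show "g \<in> borel_measurable (lborel \<Otimes>\<^sub>M lborel)" unfolding g_def by measurable
    show "integrable lborel (\<lambda>s. LINT p|lborel. norm (g (s, p)))"
      using exp_minus_two_abs_integrable by (simp add: g_def abs_mult)
    show "AE s in lborel. integrable lborel (\<lambda>p. g (s, p))" by (simp add: g_def)
  qed
  have bound: "\<bar>J s p\<bar> \<le> 7 * C\<^sup>2 * exp (- 2 * \<bar>s\<bar>)" for s p
  proof -
    have "exp (- \<bar>s\<bar>) * exp (- \<bar>s\<bar>) = exp (- 2 * \<bar>s\<bar>)" by (simp flip: exp_add)
    moreover have "7 * (C * exp (- \<bar>s\<bar>))\<^sup>2 = 7 * C\<^sup>2 * (exp (- \<bar>s\<bar>) * exp (- \<bar>s\<bar>))"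
      by (simp only: power2_eq_square mult.assoc mult.commute mult.left_commute)
    ultimately show ?thesis using J_bound[of s p] by simp
  qed
  show ?thesis
  proof (rule Bochner_Integration.integrable_bound[OF integrable_mult_right[OF 1, of "7 * C\<^sup>2"]])
    show "(\<lambda>(s, p). indicator {0..2*pi} p * J s p) \<in> borel_measurable (lborel \<Otimes>\<^sub>M lborel)"
      unfolding case_prod_unfold by measurable
    show "AE z in lborel \<Otimes>\<^sub>M lborel. norm (case z of (s, p) \<Rightarrow> indicator {0..2*pi} p * J s p)
       \<le> norm (7 * C\<^sup>2 * g z)"
      using bound by (auto simp: g_def indicator_def abs_mult)
  qed
qed

lemma LINT_J_eq_circle_J: "(LINT p|lborel. indicator {0..2*pi} p * J s p) = circle_J s"
proof -
  have "continuous_on {0..2*pi} (J s)" unfolding J_def by (intro continuous_intros; simp)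
  then have "set_integrable lborel {0..2*pi} (J s)" by (rule borel_integrable_atLeastAtMost')
  from set_borel_integral_eq_integral(2)[OF this] show ?thesis
    by (simp add: circle_J_def set_lebesgue_integral_def)
qed

lemma circle_J_integral_limit: "((\<lambda>L. integral {-L..L} circle_J) \<longlongrightarrow> integral\<^sup>L lborel circle_J) at_top"
proof -
  have int: "integrable lborel circle_J"
    using lborel_pair.integrable_fst'[OF integrable_J] by (simp add: LINT_J_eq_circle_J)
  have cj: "continuous_on S circle_J" for S
    unfolding circle_J_def[abs_def] J_def
    by (rule continuous_on_subset[of UNIV], intro integral_parameter_continuous continuous_intros) simp_all
  have eq: "integral {-L..L} circle_J = (LINT s|lborel. indicator {-L..L} s * circle_J s)" for L
    using set_borel_integral_eq_integral(2)[OF borel_integrable_atLeastAtMost'[OF cj], of "-L" L]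
    by (simp add: set_lebesgue_integral_def)
  show ?thesis
    unfolding eq
  proof (rule integral_dominated_convergence_at_top[where w = "\<lambda>s. \<bar>circle_J s\<bar>"])
    show "AE s in lborel. ((\<lambda>L. indicator {-L..L} s * circle_J s) \<longlongrightarrow> circle_J s) at_top"
    proof (rule AE_I2)
      fix s
      show "((\<lambda>L. indicator {-L..L} s * circle_J s) \<longlongrightarrow> circle_J s) at_top"
        by (rule tendsto_eventually)
           (auto simp: indicator_def intro!: eventually_mono[OF eventually_ge_at_top[of "\<bar>s\<bar>"]])
    qed
    show "\<forall>\<^sub>F L in at_top. AE s in lborel. norm (indicator {-L..L} s * circle_J s) \<le> \<bar>circle_J s\<bar>"
      by (auto simp: indicator_def)
  qed (use int borel_measurable_integrable[OF int] in auto)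
qed

end

section \<open>Integration over the plane in logarithmic polar coordinates\<close>

text \<open>
  Such a map only relabels coordinates, so boxes go to boxes of the same volume. It serves to move
  between \<open>real \<times> real\<close>, \<open>real^2\<close> and \<open>complex\<close>.
\<close>
lemma lborel_distr_basis_iso:
  fixes f :: "'a::euclidean_space \<Rightarrow> 'b::euclidean_space"
  assumes lin: "linear f" and bij: "bij_betw f Basis Basis"
    and inner: "\<And>x b. b \<in> Basis \<Longrightarrow> f x \<bullet> f b = x \<bullet> b"
  shows "distr lborel borel f = lborel"
proof (rule lborel_eqI[symmetric])
  have m [measurable]: "f \<in> borel_measurable borel"
    by (intro borel_measurable_continuous_onI linear_continuous_on linear_conv_bounded_linear[THEN iffD1] lin)
  fix l u :: 'b assume le: "\<And>b. b \<in> Basis \<Longrightarrow> l \<bullet> b \<le> u \<bullet> b"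
  define pb where "pb y = (\<Sum>b\<in>Basis. (y \<bullet> f b) *\<^sub>R b)" for y
  have pb: "pb y \<bullet> b = y \<bullet> f b" if "b \<in> Basis" for y b
    unfolding pb_def using that by (simp add: inner_sum_left_Basis)
  have img: "f ` Basis = Basis" using bij by (simp add: bij_betw_def)
  have vim: "f -` box l u = box (pb l) (pb u)"
  proof -
    have "f x \<in> box l u \<longleftrightarrow> (\<forall>b\<in>Basis. l \<bullet> f b < f x \<bullet> f b \<and> f x \<bullet> f b < u \<bullet> f b)" for x
      unfolding mem_box img[symmetric] by blast
    then show ?thesis by (auto simp: mem_box pb inner)
  qed
  have "emeasure (distr lborel borel f) (box l u) = emeasure lborel (box (pb l) (pb u))"
    using vim by (subst emeasure_distr) auto
  also have "\<dots> = (\<Prod>b\<in>Basis. (pb u - pb l) \<bullet> b)"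
  proof (rule emeasure_lborel_box)
    show "pb l \<bullet> b \<le> pb u \<bullet> b" if "b \<in> Basis" for b
      using le[of "f b"] img that by (auto simp: pb)
  qed
  also have "(\<Prod>b\<in>Basis. (pb u - pb l) \<bullet> b) = (\<Prod>b\<in>Basis. (u - l) \<bullet> f b)"
    by (intro prod.cong refl) (simp add: inner_diff_left pb)
  also have "\<dots> = (\<Prod>b\<in>Basis. (u - l) \<bullet> b)"
    by (rule prod.reindex_bij_betw[OF bij])
  finally show "emeasure (distr lborel borel f) (box l u) = (\<Prod>b\<in>Basis. (u - l) \<bullet> b)" .
qed simp

lemma lborel_distr_Complex: "distr lborel borel (\<lambda>x::real^2. Complex (x $ 1) (x $ 2)) = lborel"
proof (rule lborel_distr_basis_iso)
  show "linear (\<lambda>x::real^2. Complex (x $ 1) (x $ 2))"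
    by (rule linearI) (simp_all add: complex_eq_iff)
  have B: "(Basis::(real^2) set) = {axis 1 1, axis 2 1}"
    by (auto simp: Basis_vec_def UNIV_2)
  show "bij_betw (\<lambda>x::real^2. Complex (x $ 1) (x $ 2)) Basis Basis"
    unfolding B by (auto simp: bij_betw_def inj_on_def axis_def Basis_complex_def complex_eq_iff axis_eq_axis)
  show "Complex (x $ 1) (x $ 2) \<bullet> Complex (b $ 1) (b $ 2) = x \<bullet> b" for x b :: "real^2"
    by (simp add: inner_complex_def inner_vec_def sum_2)
qed

lemma lborel_distr_vector2: "distr lborel borel (\<lambda>z::real\<times>real. vector [fst z, snd z] :: real^2) = lborel"
proof (rule lborel_distr_basis_iso)
  show "linear (\<lambda>z::real\<times>real. vector [fst z, snd z] :: real^2)"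
    by (rule linearI) (simp_all add: vec_eq_iff forall_2)
  have B: "(Basis::(real^2) set) = {axis 1 1, axis 2 1}"
    by (auto simp: Basis_vec_def UNIV_2)
  have P: "(Basis::(real\<times>real) set) = {(1,0),(0,1)}"
    by (auto simp: Basis_prod_def)
  have "vector [1, 0] = (axis 1 1 :: real^2)" "vector [0, 1] = (axis 2 1 :: real^2)"
    by (simp_all add: vec_eq_iff forall_2 axis_def)
  then show "bij_betw (\<lambda>z::real\<times>real. vector [fst z, snd z] :: real^2) Basis Basis"
    unfolding B P by (auto simp: bij_betw_def axis_eq_axis)
  show "(vector [fst x, snd x] :: real^2) \<bullet> vector [fst b, snd b] = x \<bullet> b" for x b :: "real\<times>real"
    by (simp add: inner_prod_def inner_vec_def sum_2)
qed

lemma exp_strip_image: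
  "(\<lambda>z. exp z) ` {z. 0 < Im z \<and> Im z < 2 * pi} = - {z. Im z = 0 \<and> 0 \<le> Re z}"
proof (intro set_eqI iffI)
  fix w assume "w \<in> (\<lambda>z. exp z) ` {z. 0 < Im z \<and> Im z < 2 * pi}"
  then obtain z where z: "w = exp z" "0 < Im z" "Im z < 2 * pi" by auto
  have "\<not> (sin (Im z) = 0 \<and> 0 \<le> cos (Im z))"
  proof
    assume h: "sin (Im z) = 0 \<and> 0 \<le> cos (Im z)"
    then have "Im z = pi"
      using z by (smt (verit) sin_eq_0_pi sin_gt_zero sin_lt_zero)
    then show False using h by simp
  qed
  then show "w \<in> - {z. Im z = 0 \<and> 0 \<le> Re z}"
    using z by (auto simp: Im_exp Re_exp zero_le_mult_iff)
next
  fix w :: complex assume w: "w \<in> - {z. Im z = 0 \<and> 0 \<le> Re z}"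
  then have w0: "w \<noteq> 0" by auto
  have "Arg2pi w \<noteq> 0" using w by (auto simp: Arg2pi_eq_0 complex_is_Real_iff)
  then have a: "0 < Arg2pi w" "Arg2pi w < 2 * pi" using Arg2pi[of w] by linarith+
  have "w = exp (Complex (ln (cmod w)) (Arg2pi w))"
  proof -
    have "w = of_real (cmod w) * cis (Arg2pi w)"
      using Arg2pi_eq[of w] by (simp add: cis_conv_exp)
    also have "\<dots> = exp (Complex (ln (cmod w)) (Arg2pi w))"
      using w0 by (simp add: exp_eq_polar)
    finally show ?thesis .
  qed
  then show "w \<in> (\<lambda>z. exp z) ` {z. 0 < Im z \<and> Im z < 2 * pi}" using a by force
qed

text \<open>
  The exponential maps the strip \<open>0 < Im z < 2 * pi\<close> bijectively onto the plane slit along the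
  nonnegative real axis, a null set, and its real Jacobian is \<open>|exp z|^2 = exp (2 * Re z)\<close>.
\<close>
theorem integral_log_polar:
  fixes f :: "complex \<Rightarrow> real"
  assumes f [measurable]: "f \<in> borel_measurable borel"
    and int: "integrable (lborel \<Otimes>\<^sub>M lborel) (\<lambda>(s, p). indicator {0..2*pi} p * (exp (2 * s) * f (exp (Complex s p))))"
  shows "integral\<^sup>L lborel f = (LINT s|lborel. LINT p|lborel. indicator {0..2*pi} p * (exp (2 * s) * f (exp (Complex s p))))"
proof -
  define S :: "(real^2) set" where "S = {x. 0 < x $ 2 \<and> x $ 2 < 2 * pi}"
  define cx :: "real^2 \<Rightarrow> complex" where "cx = (\<lambda>x. Complex (x $ 1) (x $ 2))"
  define vx :: "complex \<Rightarrow> real^2" where "vx z = vector [Re z, Im z]" for z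
  define g where "g x = vx (exp (cx x))" for x
  define g' where "g' x h = vx (exp (cx x) * cx h)" for x h
  define F where "F x = f (cx x)" for x
  define G where "G x = exp (2 * x $ 1) * f (exp (cx x))" for x :: "real^2"
  have cv [simp]: "cx (vx z) = z" "vx (cx x) = x" for z x
    by (simp_all add: cx_def vx_def vec_eq_iff forall_2)
  have lin: "bounded_linear cx" "bounded_linear vx"
    unfolding cx_def vx_def
    by (rule linear_conv_bounded_linear[THEN iffD1], rule linearI; simp add: complex_eq_iff vec_eq_iff forall_2)+
  have [measurable]: "cx \<in> borel_measurable borel"
    by (intro borel_measurable_continuous_onI linear_continuous_on lin)
  have [measurable]: "(\<lambda>x::real^2. x $ i) \<in> borel_measurable borel" for i
    by (intro borel_measurable_continuous_onI continuous_intros)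
  have [measurable]: "S \<in> sets borel" unfolding S_def by measurable
  have [measurable]: "(exp :: complex \<Rightarrow> complex) \<in> borel_measurable borel"
    by (intro borel_measurable_continuous_onI continuous_intros)
  have mF [measurable]: "F \<in> borel_measurable borel" unfolding F_def by measurable
  have mG [measurable]: "G \<in> borel_measurable borel" unfolding G_def by measurable
  have mv [measurable]: "(\<lambda>z::real\<times>real. vector [fst z, snd z] :: real^2) \<in> borel_measurable borel"
    by (intro borel_measurable_continuous_onI linear_continuous_on linear_conv_bounded_linear[THEN iffD1] linearI)
       (simp_all add: vec_eq_iff forall_2)
  have der: "(g has_derivative g' x) (at x within S)" for x
  proof -
    have "((\<lambda>x. exp (cx x)) has_derivative (\<lambda>h. exp (cx x) * cx h)) (at x within S)"
      by (rule has_derivative_compose[OF bounded_linear_imp_has_derivative[OF lin(1)],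
          of exp "\<lambda>h. exp (cx x) * h"]) (simp add: has_field_derivative_imp_has_derivative DERIV_exp)
    then show ?thesis
      unfolding g_def g'_def by (rule bounded_linear.has_derivative[OF lin(2)])
  qed
  have inj: "inj_on g S"
  proof (rule inj_onI)
    fix x y assume xy: "x \<in> S" "y \<in> S" "g x = g y"
    then have "exp (cx x) = exp (cx y)" unfolding g_def by (metis cv(1))
    moreover have "0 < x $ 2" "x $ 2 < 2 * pi" "0 < y $ 2" "y $ 2 < 2 * pi" using xy(1,2) by (auto simp: S_def)
    then have "\<bar>Im (cx x) - Im (cx y)\<bar> < 2 * pi" unfolding cx_def complex.sel by linarith
    ultimately have "cx x = cx y" using exp_complex_eqI by blast
    then show "x = y" by (metis cv(2))
  qed
  have det: "\<bar>det (matrix (g' x))\<bar> = exp (2 * x $ 1)" for x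
  proof -
    have e: "exp (2 * x $ 1) = exp (x $ 1) * exp (x $ 1)" by (simp only: exp_add[symmetric] mult_2)
    have "det (matrix (g' x)) = (exp (x $ 1) * cos (x $ 2)) * (exp (x $ 1) * cos (x $ 2))
        + (exp (x $ 1) * sin (x $ 2)) * (exp (x $ 1) * sin (x $ 2))"
      unfolding det_2 matrix_def g'_def vx_def cx_def
      by (simp add: axis_def Re_exp Im_exp)
    also have "\<dots> = (exp (x $ 1) * exp (x $ 1)) * ((cos (x $ 2))\<^sup>2 + (sin (x $ 2))\<^sup>2)"
      by (simp only: power2_eq_square distrib_left mult.assoc mult.commute mult.left_commute)
    finally have "det (matrix (g' x)) = exp (x $ 1) * exp (x $ 1)" by simp
    then show ?thesis by (simp add: e)
  qed
  have img: "g ` S = vx ` (- {z. Im z = 0 \<and> 0 \<le> Re z})"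
  proof -
    have "cx ` S = {z. 0 < Im z \<and> Im z < 2 * pi}"
      unfolding S_def cx_def image_def by (auto simp: complex_eq_iff intro!: exI[of _ "vx _"] simp: vx_def)
    then have "g ` S = vx ` ((\<lambda>z. exp z) ` {z. 0 < Im z \<and> Im z < 2 * pi})"
      unfolding g_def by (metis (no_types, lifting) image_cong image_image)
    then show ?thesis by (simp only: exp_strip_image)
  qed
  have neg: "negligible (UNIV - g ` S)"
  proof (rule negligible_subset)
    show "negligible {x::real^2. x $ 2 = 0}" by (rule negligible_standard_hyperplane_cart)
    show "UNIV - g ` S \<subseteq> {x. x $ 2 = 0}"
    proof
      fix x assume "x \<in> UNIV - g ` S"
      then have "x \<notin> vx ` (- {z. Im z = 0 \<and> 0 \<le> Re z})" using img by simp
      then have "cx x \<notin> - {z. Im z = 0 \<and> 0 \<le> Re z}" by (metis cv(2) image_eqI)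
      then show "x \<in> {x. x $ 2 = 0}" by (simp add: cx_def)
    qed
  qed
  define P where "P = (\<lambda>(s, p). indicator {0..2*pi} p * (exp (2 * s) * f (exp (Complex s p))) :: real)"
  define Q where "Q = (\<lambda>x. indicator S x * G x)"
  have [measurable]: "Q \<in> borel_measurable borel" unfolding Q_def by measurable
  have ae: "AE z in lborel \<Otimes>\<^sub>M lborel. Q (vector [fst z, snd z]) = P z"
  proof -
    have "AE z in (lborel :: (real\<times>real) measure). snd z \<noteq> 0 \<and> snd z \<noteq> 2 * pi"
    proof -
      have "{z::real\<times>real. snd z = c} \<in> null_sets lborel" for c
      proof -
        have "{z::real\<times>real. snd z = c} = {z. (0::real, 1::real) \<bullet> z = c}" by (auto simp: inner_prod_def)
        moreover have "negligible {z. (0::real, 1::real) \<bullet> z = c}"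
          by (rule negligible_hyperplane) (simp add: zero_prod_def)
        moreover have "{z::real\<times>real. snd z = c} \<in> sets lborel"
          by (simp add: borel_closed closed_Collect_eq continuous_on_snd)
        ultimately show ?thesis by (simp add: negligible_iff_null_sets null_sets_completion_iff)
      qed
      then have "AE z in (lborel :: (real\<times>real) measure). snd z \<noteq> c" for c
        by (rule AE_I') auto
      then show ?thesis by (simp add: AE_conj_iff)
    qed
    then show ?thesis
      unfolding lborel_prod
      by eventually_elim (auto simp: P_def Q_def G_def S_def cx_def indicator_def split: prod.splits)
  qed
  have mP: "P \<in> borel_measurable (lborel \<Otimes>\<^sub>M lborel)" using int unfolding P_def by (rule borel_measurable_integrable)
  have intP: "integrable (lborel \<Otimes>\<^sub>M lborel) P" using int unfolding P_def .
  have "integrable (lborel \<Otimes>\<^sub>M lborel) (\<lambda>z. Q (vector [fst z, snd z]))"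
  proof (rule integrable_cong_AE_imp[OF intP])
    show "AE z in lborel \<Otimes>\<^sub>M lborel. P z = Q (vector [fst z, snd z])"
      using ae by eventually_elim simp
  qed (simp add: lborel_prod)
  then have intQ: "integrable lborel Q"
    by (subst lborel_distr_vector2[symmetric]) (simp add: integrable_distr_eq lborel_prod)
  have QP: "integral\<^sup>L lborel Q = integral\<^sup>L (lborel \<Otimes>\<^sub>M lborel) P"
  proof -
    have "integral\<^sup>L lborel Q = integral\<^sup>L lborel (\<lambda>z. Q (vector [fst z, snd z]))"
      by (subst lborel_distr_vector2[symmetric]) (simp add: integral_distr)
    also have "\<dots> = integral\<^sup>L (lborel \<Otimes>\<^sub>M lborel) P"
      unfolding lborel_prod using ae[unfolded lborel_prod] mP by (intro integral_cong_AE) (auto simp: lborel_prod)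
    finally show ?thesis .
  qed
  have abs: "G absolutely_integrable_on S"
    unfolding set_integrable_def using intQ by (simp add: integrable_completion Q_def)
  have intG: "integral S G = integral\<^sup>L lborel Q"
    using set_lebesgue_integral_eq_integral(2)[OF abs]
    by (simp add: set_lebesgue_integral_def integral_completion Q_def)
  let ?lift = "vec :: real \<Rightarrow> real^1"
  have "(\<lambda>x. ?lift (F x)) absolutely_integrable_on (g ` S) \<and> integral (g ` S) (\<lambda>x. ?lift (F x)) = ?lift (integral S G)"
  proof (subst has_absolute_integral_change_of_variables[symmetric, where g' = g'])
    have eq: "(\<lambda>x. \<bar>det (matrix (g' x))\<bar> *\<^sub>R ?lift (F (g x))) = (\<lambda>x. ?lift (G x))"
      by (simp add: det F_def g_def G_def fun_eq_iff vec_eq_iff)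
    show "(\<lambda>x. \<bar>det (matrix (g' x))\<bar> *\<^sub>R ?lift (F (g x))) absolutely_integrable_on S \<and>
      integral S (\<lambda>x. \<bar>det (matrix (g' x))\<bar> *\<^sub>R ?lift (F (g x))) = ?lift (integral S G)"
      unfolding eq using abs by (simp add: absolutely_integrable_on_1_iff integral_on_1_eq)
  qed (use der inj in auto)
  then have aF: "F absolutely_integrable_on g ` S" "integral (g ` S) F = integral S G"
    by (simp_all add: absolutely_integrable_on_1_iff integral_on_1_eq)
  have sp: "negligible {x \<in> g ` S - UNIV. F x \<noteq> 0}" "negligible {x \<in> UNIV - g ` S. F x \<noteq> 0}"
    by (auto intro: negligible_subset[OF neg])
  have aF': "F absolutely_integrable_on UNIV" "integral UNIV F = integral S G"
    using absolutely_integrable_spike_set_eq[OF sp] integral_spike_set[OF sp] aF by auto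
  have "integral\<^sup>L lborel f = integral\<^sup>L lborel F"
    by (subst lborel_distr_Complex[symmetric])
       (simp add: integral_distr F_def[abs_def] cx_def[symmetric])
  also have "\<dots> = integral UNIV F"
    using set_lebesgue_integral_eq_integral(2)[OF aF'(1)]
    by (simp add: set_lebesgue_integral_def integral_completion)
  also have "\<dots> = integral\<^sup>L (lborel \<Otimes>\<^sub>M lborel) P" by (simp add: aF' intG QP)
  also have "\<dots> = (LINT s|lborel. LINT p|lborel. P (s, p))"
    by (rule lborel_pair.integral_fst'[symmetric, OF intP])
  finally show ?thesis by (simp add: P_def)
qed

section \<open>The slopes in terms of second derivatives\<close>

lemma dd_xi_eq: "(f has_derivative f') (at \<xi>) \<Longrightarrow> dd_xi f \<xi> = (f' 1 - \<i> * f' \<i>) / 2"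
  and dd_xibar_eq: "(f has_derivative f') (at \<xi>) \<Longrightarrow> dd_xibar f \<xi> = (f' 1 + \<i> * f' \<i>) / 2"
  unfolding dd_xi_def dd_xibar_def by (simp_all add: frechet_derivative_at[symmetric])

text \<open>
  A C2 function given together with its partial derivatives; \<open>Vxy\<close> serves for both mixed ones.
\<close>
locale plane_C2 =
  fixes V Vx Vy Vxx Vxy Vyy :: "complex \<Rightarrow> real"
  assumes dV: "(V has_derivative (\<lambda>h. Re h * Vx \<xi> + Im h * Vy \<xi>)) (at \<xi>)"
    and dVx: "(Vx has_derivative (\<lambda>h. Re h * Vxx \<xi> + Im h * Vxy \<xi>)) (at \<xi>)"
    and dVy: "(Vy has_derivative (\<lambda>h. Re h * Vxy \<xi> + Im h * Vyy \<xi>)) (at \<xi>)"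
    and cont: "continuous_on UNIV Vxx" "continuous_on UNIV Vxy" "continuous_on UNIV Vyy"
begin

definition integrand :: "complex \<Rightarrow> real" where
  "integrand \<xi> = (1 + (cmod \<xi>)\<^sup>2)\<^sup>2 / 64 * ((Vxx \<xi> - Vyy \<xi>)\<^sup>2 + 4 * (Vxy \<xi>)\<^sup>2)
     - ((1 + (cmod \<xi>)\<^sup>2) / 8 * (Vxx \<xi> + Vyy \<xi>) - (Re \<xi> * Vx \<xi> + Im \<xi> * Vy \<xi>) / 2 + V \<xi> / 2)\<^sup>2"

text \<open>
  Multiplication by the conformal factor removes the first-order terms from \<open>\<sigma>\<close>: in terms of \<open>V\<close> it is
  \<open>- (1 + |\<xi>|^2) / 2\<close> times the pure second derivative \<open>\<partial>^2 V / \<partial>\<xi>^2\<close>.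
\<close>
lemma slope_integrand:
  assumes r: "r = (\<lambda>\<xi>. w / 2 + V \<xi> / (1 + (cmod \<xi>)\<^sup>2))"
  shows "(cmod (slope_sigma r \<xi>))\<^sup>2 - (r \<xi> - w / 2 + Re (slope_psi r \<xi>))\<^sup>2 = integrand \<xi>"
proof -
  define D where "D \<xi> = 1 + (Re \<xi>)\<^sup>2 + (Im \<xi>)\<^sup>2" for \<xi>
  have D: "1 + (cmod \<xi>)\<^sup>2 = D \<xi>" "1 + \<xi> * cnj \<xi> = of_real (D \<xi>)" for \<xi>
    by (simp_all add: D_def cmod_power2 complex_mult_cnj)
  have D0: "D \<xi> \<noteq> 0" for \<xi> unfolding D(1)[symmetric] using one_plus_cmod_pos[of \<xi>] by simp
  have dRe: "(Re has_derivative Re) (at \<xi>)" "(Im has_derivative Im) (at \<xi>)" for \<xi>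
    by (auto intro!: bounded_linear_imp_has_derivative bounded_linear_Re bounded_linear_Im)
  have dD: "(D has_derivative (\<lambda>h. Re h * (2 * Re \<xi>) + Im h * (2 * Im \<xi>))) (at \<xi>)" for \<xi>
    unfolding D_def by (auto intro!: derivative_eq_intros dRe simp: fun_eq_iff)
  define a where "a \<xi> = Vx \<xi> * D \<xi> - 2 * Re \<xi> * V \<xi>" for \<xi>
  define b where "b \<xi> = Vy \<xi> * D \<xi> - 2 * Im \<xi> * V \<xi>" for \<xi>
  define ay where "ay \<xi> = Vxy \<xi> * D \<xi> + 2 * Im \<xi> * Vx \<xi> - 2 * Re \<xi> * Vy \<xi>" for \<xi>
  define bx where "bx \<xi> = Vxy \<xi> * D \<xi> + 2 * Re \<xi> * Vy \<xi> - 2 * Im \<xi> * Vx \<xi>" for \<xi>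
  have da: "(a has_derivative (\<lambda>h. Re h * (Vxx \<xi> * D \<xi> - 2 * V \<xi>) + Im h * ay \<xi>)) (at \<xi>)" for \<xi>
    unfolding a_def ay_def
    by (auto intro!: derivative_eq_intros dRe dD dV dVx simp: fun_eq_iff algebra_simps)
  have db: "(b has_derivative (\<lambda>h. Re h * bx \<xi> + Im h * (Vyy \<xi> * D \<xi> - 2 * V \<xi>))) (at \<xi>)" for \<xi>
    unfolding b_def bx_def
    by (auto intro!: derivative_eq_intros dRe dD dV dVy simp: fun_eq_iff algebra_simps)
  have dr: "(r has_derivative (\<lambda>h. Re h * (a \<xi> / (D \<xi>)\<^sup>2) + Im h * (b \<xi> / (D \<xi>)\<^sup>2))) (at \<xi>)" for \<xi>
    unfolding r D(1)
    by (rule has_derivative_eq_rhs, (rule derivative_eq_intros refl dV dD D0)+)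
       (simp add: fun_eq_iff a_def b_def field_simps power2_eq_square D0)
  have F: "slope_F r \<xi> = (of_real (a \<xi>) + \<i> * of_real (b \<xi>)) / 4" for \<xi>
  proof -
    have "((\<lambda>\<zeta>. of_real (r \<zeta>) :: complex) has_derivative
        (\<lambda>h. of_real (Re h * (a \<xi> / (D \<xi>)\<^sup>2) + Im h * (b \<xi> / (D \<xi>)\<^sup>2)))) (at \<xi>)"
      by (intro bounded_linear.has_derivative[OF bounded_linear_of_real] dr)
    from dd_xibar_eq[OF this] show ?thesis
      unfolding slope_F_def D(2) using D0[of \<xi>] by (simp add: field_simps)
  qed
  have sigma: "slope_sigma r \<xi> = - of_real (D \<xi> / 8) * (of_real (Vxx \<xi> - Vyy \<xi>) - 2 * \<i> * of_real (Vxy \<xi>))"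
  proof -
    have "((\<lambda>\<zeta>. cnj (slope_F r \<zeta>)) has_derivative
      (\<lambda>h. (of_real (Re h * (Vxx \<xi> * D \<xi> - 2 * V \<xi>) + Im h * ay \<xi>)
           - \<i> * of_real (Re h * bx \<xi> + Im h * (Vyy \<xi> * D \<xi> - 2 * V \<xi>))) / 4)) (at \<xi>)"
      unfolding F
      by (auto intro!: derivative_eq_intros bounded_linear.has_derivative[OF bounded_linear_of_real] da db)
    from dd_xi_eq[OF this] show ?thesis
      unfolding slope_sigma_def ay_def bx_def by (simp add: complex_eq_iff field_simps)
  qed
  have psi: "Re (slope_psi r \<xi>) = ((Vxx \<xi> + Vyy \<xi>) * D \<xi> - 4 * V \<xi> - 4 * (Re \<xi> * a \<xi> + Im \<xi> * b \<xi>) / D \<xi>) / 8"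
  proof -
    let ?A = "\<lambda>h. (Re h * (Vxx \<xi> * D \<xi> - 2 * V \<xi>) + Im h * ay \<xi>) / (D \<xi>)\<^sup>2
       - a \<xi> * (2 * (Re h * (2 * Re \<xi>) + Im h * (2 * Im \<xi>))) / (D \<xi>)^3"
    let ?B = "\<lambda>h. (Re h * bx \<xi> + Im h * (Vyy \<xi> * D \<xi> - 2 * V \<xi>)) / (D \<xi>)\<^sup>2
       - b \<xi> * (2 * (Re h * (2 * Re \<xi>) + Im h * (2 * Im \<xi>))) / (D \<xi>)^3"
    have quot: "((\<lambda>\<xi>. f \<xi> / (D \<xi>)\<^sup>2) has_derivative (\<lambda>h. f' h / (D \<xi>)\<^sup>2
       - f \<xi> * (2 * (Re h * (2 * Re \<xi>) + Im h * (2 * Im \<xi>))) / (D \<xi>)^3)) (at \<xi>)"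
      if "(f has_derivative f') (at \<xi>)" for f f'
    proof -
      have "((\<lambda>\<xi>. (D \<xi>)\<^sup>2) has_derivative (\<lambda>h. 2 * D \<xi> * (Re h * (2 * Re \<xi>) + Im h * (2 * Im \<xi>)))) (at \<xi>)"
        by (auto intro!: derivative_eq_intros dD simp: fun_eq_iff)
      from has_derivative_divide'[OF that this] show ?thesis
        by (rule has_derivative_eq_rhs) (use D0[of \<xi>] in \<open>simp_all add: fun_eq_iff field_simps power2_eq_square power3_eq_cube\<close>)
    qed
    have eq: "slope_F r \<zeta> / (1 + \<zeta> * cnj \<zeta>)\<^sup>2 = (of_real (a \<zeta> / (D \<zeta>)\<^sup>2) + \<i> * of_real (b \<zeta> / (D \<zeta>)\<^sup>2)) / 4" for \<zeta>
      unfolding F D(2) using D0[of \<zeta>] by (simp add: field_simps)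
    have "((\<lambda>\<zeta>. slope_F r \<zeta> / (1 + \<zeta> * cnj \<zeta>)\<^sup>2) has_derivative
      (\<lambda>h. (of_real (?A h) + \<i> * of_real (?B h)) / 4)) (at \<xi>)"
      unfolding eq
      by (rule has_derivative_eq_rhs, (rule derivative_eq_intros refl bounded_linear.has_derivative[OF bounded_linear_of_real]
         quot[OF da] quot[OF db])+) simp_all
    note dd = dd_xi_eq[OF this]
    have "Re (dd_xi (\<lambda>\<zeta>. slope_F r \<zeta> / (1 + \<zeta> * cnj \<zeta>)\<^sup>2) \<xi>) = (?A 1 + ?B \<i>) / 8"
    proof -
      have "Re (((of_real a1 + \<i> * of_real b1) / 4 - \<i> * ((of_real a2 + \<i> * of_real b2) / 4)) / 2) = (a1 + b2) / 8"
        for a1 b1 a2 b2 :: real by simp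
      then show ?thesis unfolding dd .
    qed
    then have "Re (slope_psi r \<xi>) = (D \<xi>)\<^sup>2 * ((?A 1 + ?B \<i>) / 8)"
      unfolding slope_psi_def D(2) by (simp flip: of_real_power)
    also have "\<dots> = ((Vxx \<xi> + Vyy \<xi>) * D \<xi> - 4 * V \<xi> - 4 * (Re \<xi> * a \<xi> + Im \<xi> * b \<xi>) / D \<xi>) / 8"
      using D0[of \<xi>] by (simp add: field_simps power2_eq_square power3_eq_cube)
    finally show ?thesis .
  qed
  have s2: "(cmod (slope_sigma r \<xi>))\<^sup>2 = (D \<xi>)\<^sup>2 / 64 * ((Vxx \<xi> - Vyy \<xi>)\<^sup>2 + 4 * (Vxy \<xi>)\<^sup>2)"
    unfolding sigma cmod_power2 by (simp add: power2_eq_square field_simps)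
  have "r \<xi> - w / 2 + Re (slope_psi r \<xi>)
     = D \<xi> / 8 * (Vxx \<xi> + Vyy \<xi>) - (Re \<xi> * Vx \<xi> + Im \<xi> * Vy \<xi>) / 2 + V \<xi> / 2"
  proof -
    have 1: "Re \<xi> * a \<xi> + Im \<xi> * b \<xi> = D \<xi> * (Re \<xi> * Vx \<xi> + Im \<xi> * Vy \<xi>) - 2 * (D \<xi> - 1) * V \<xi>"
      by (simp add: a_def b_def D_def algebra_simps power2_eq_square)
    show ?thesis
      unfolding psi 1 unfolding r D(1) using D0[of \<xi>] by (simp add: field_simps)
  qed
  then show ?thesis unfolding integrand_def D(1) s2 by simp
qed

end

section \<open>From the plane to the cylinder\<close>

text \<open>
  The weight \<open>(cmod \<xi>)\<^sup>2\<close> comes from the conformal factor \<open>1 + |\<xi>|^2\<close> in \<open>V\<close>; the function on the sphere is odd.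
\<close>
locale antipodal_plane = plane_C2 +
  assumes antipodal_plane: "\<xi> \<noteq> 0 \<Longrightarrow> V (- 1 / cnj \<xi>) = - V \<xi> / (cmod \<xi>)\<^sup>2"
    and zero: "V 0 = 0" "Vx 0 = 0" "Vy 0 = 0"
begin

definition pt :: "real \<Rightarrow> real \<Rightarrow> complex" where "pt s p = exp (Complex s p)"
abbreviation X where "X s p \<equiv> Re (pt s p)"
abbreviation Y where "Y s p \<equiv> Im (pt s p)"

lemma pt_simps: "X s p = exp s * cos p" "Y s p = exp s * sin p" "cmod (pt s p) = exp s"
  by (simp_all add: pt_def Re_exp Im_exp)

lemma pt_sq: "(X s p)\<^sup>2 + (Y s p)\<^sup>2 = (exp s)\<^sup>2"
  by (simp add: pt_simps power_mult_distrib flip: distrib_left)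

lemma deriv_pt:
  assumes "(f has_derivative (\<lambda>h. Re h * a + Im h * b)) (at (pt s p))"
  shows "((\<lambda>s. f (pt s p)) has_real_derivative X s p * a + Y s p * b) (at s)"
    and "((\<lambda>p. f (pt s p)) has_real_derivative X s p * b - Y s p * a) (at p)"
proof -
  have ed: "(exp has_derivative (\<lambda>h. exp z * h)) (at z)" for z :: complex
    by (simp add: has_field_derivative_imp_has_derivative DERIV_exp)
  have pt: "pt s p = exp (of_real s + \<i> * of_real p)" for s p by (simp add: pt_def Complex_eq)
  have "((\<lambda>s. pt s p) has_derivative (\<lambda>h. of_real h * pt s p)) (at s)"
  proof -
    have "((\<lambda>s. of_real s + \<i> * of_real p :: complex) has_derivative (\<lambda>h. of_real h + 0)) (at s)"
      by (intro derivative_intros bounded_linear_imp_has_derivative bounded_linear_of_real)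
    from has_derivative_compose[OF this ed]
    show ?thesis unfolding pt by (simp add: mult_ac)
  qed
  from has_derivative_compose[OF this assms]
  show "((\<lambda>s. f (pt s p)) has_real_derivative X s p * a + Y s p * b) (at s)"
    unfolding has_field_derivative_def
    by (rule has_derivative_eq_rhs) (simp add: fun_eq_iff algebra_simps)
  have "((\<lambda>p. pt s p) has_derivative (\<lambda>h. of_real h * (\<i> * pt s p))) (at p)"
  proof -
    have "((\<lambda>p. of_real s + \<i> * of_real p :: complex) has_derivative (\<lambda>h. 0 + \<i> * of_real h)) (at p)"
      by (intro derivative_intros has_derivative_mult_right bounded_linear_imp_has_derivative bounded_linear_of_real)
    from has_derivative_compose[OF this ed]
    show ?thesis unfolding pt by (simp add: mult_ac)
  qed
  from has_derivative_compose[OF this assms]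
  show "((\<lambda>p. f (pt s p)) has_real_derivative X s p * b - Y s p * a) (at p)"
    unfolding has_field_derivative_def
    by (rule has_derivative_eq_rhs) (simp add: fun_eq_iff algebra_simps)
qed

lemma deriv_XY:
  "((\<lambda>s. X s p) has_real_derivative X s p) (at s)" "((\<lambda>s. Y s p) has_real_derivative Y s p) (at s)"
  "((\<lambda>p. X s p) has_real_derivative - Y s p) (at p)" "((\<lambda>p. Y s p) has_real_derivative X s p) (at p)"
  by (auto simp: pt_simps intro!: derivative_eq_intros)

text \<open>
  The first and second differentials of \<open>V\<close> at \<open>\<xi>\<close> in the radial direction \<open>\<xi>\<close> and the angular
  direction \<open>\<i> * \<xi>\<close>.
\<close>
definition Vr where "Vr \<xi> = Re \<xi> * Vx \<xi> + Im \<xi> * Vy \<xi>"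
definition Va where "Va \<xi> = Re \<xi> * Vy \<xi> - Im \<xi> * Vx \<xi>"
definition Vrr where "Vrr \<xi> = (Re \<xi>)\<^sup>2 * Vxx \<xi> + 2 * Re \<xi> * Im \<xi> * Vxy \<xi> + (Im \<xi>)\<^sup>2 * Vyy \<xi>"
definition Vra where "Vra \<xi> = Re \<xi> * Im \<xi> * (Vyy \<xi> - Vxx \<xi>) + ((Re \<xi>)\<^sup>2 - (Im \<xi>)\<^sup>2) * Vxy \<xi>"
definition Vaa where "Vaa \<xi> = (Im \<xi>)\<^sup>2 * Vxx \<xi> - 2 * Re \<xi> * Im \<xi> * Vxy \<xi> + (Re \<xi>)\<^sup>2 * Vyy \<xi>"

text \<open>
  Up to the factor \<open>cosh s\<close>, this is the function on the sphere.
\<close>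
definition u where "u s p = exp (- s) / 2 * V (pt s p)"
definition us where "us s p = exp (- s) / 2 * (Vr (pt s p) - V (pt s p))"
definition up where "up s p = exp (- s) / 2 * Va (pt s p)"
definition uss where "uss s p = exp (- s) / 2 * (Vrr (pt s p) - Vr (pt s p) + V (pt s p))"
definition usp where "usp s p = exp (- s) / 2 * Vra (pt s p)"
definition upp where "upp s p = exp (- s) / 2 * (Vaa (pt s p) - Vr (pt s p))"

lemma derivs_pt:
  "((\<lambda>s. V (pt s p)) has_real_derivative Vr (pt s p)) (at s)"
  "((\<lambda>p. V (pt s p)) has_real_derivative Va (pt s p)) (at p)"
  "((\<lambda>s. Vr (pt s p)) has_real_derivative Vrr (pt s p) + Vr (pt s p)) (at s)"
  "((\<lambda>p. Vr (pt s p)) has_real_derivative Vra (pt s p) + Va (pt s p)) (at p)"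
  "((\<lambda>s. Va (pt s p)) has_real_derivative Vra (pt s p) + Va (pt s p)) (at s)"
  "((\<lambda>p. Va (pt s p)) has_real_derivative Vaa (pt s p) - Vr (pt s p)) (at p)"
proof -
  note x = deriv_pt[OF dVx, where s=s and p=p] and y = deriv_pt[OF dVy, where s=s and p=p]
  show "((\<lambda>s. V (pt s p)) has_real_derivative Vr (pt s p)) (at s)"
    "((\<lambda>p. V (pt s p)) has_real_derivative Va (pt s p)) (at p)"
    using deriv_pt[OF dV, where s=s and p=p] by (simp_all add: Vr_def Va_def)
  show "((\<lambda>s. Vr (pt s p)) has_real_derivative Vrr (pt s p) + Vr (pt s p)) (at s)"
    unfolding Vr_def Vrr_def
    by (rule DERIV_cong[OF DERIV_add[OF DERIV_mult[OF deriv_XY(1) x(1)] DERIV_mult[OF deriv_XY(2) y(1)]]])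
       (simp add: algebra_simps power2_eq_square)
  show "((\<lambda>p. Vr (pt s p)) has_real_derivative Vra (pt s p) + Va (pt s p)) (at p)"
    unfolding Vr_def Vra_def Va_def
    by (rule DERIV_cong[OF DERIV_add[OF DERIV_mult[OF deriv_XY(3) x(2)] DERIV_mult[OF deriv_XY(4) y(2)]]])
       (simp add: algebra_simps power2_eq_square)
  show "((\<lambda>s. Va (pt s p)) has_real_derivative Vra (pt s p) + Va (pt s p)) (at s)"
    unfolding Va_def Vra_def
    by (rule DERIV_cong[OF DERIV_diff[OF DERIV_mult[OF deriv_XY(1) y(1)] DERIV_mult[OF deriv_XY(2) x(1)]]])
       (simp add: algebra_simps power2_eq_square)
  show "((\<lambda>p. Va (pt s p)) has_real_derivative Vaa (pt s p) - Vr (pt s p)) (at p)"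
    unfolding Va_def Vaa_def Vr_def
    by (rule DERIV_cong[OF DERIV_diff[OF DERIV_mult[OF deriv_XY(3) y(2)] DERIV_mult[OF deriv_XY(4) x(2)]]])
       (simp add: algebra_simps power2_eq_square)
qed

lemma cont_all: "continuous_on S V" "continuous_on S Vx" "continuous_on S Vy"
  "continuous_on S Vxx" "continuous_on S Vxy" "continuous_on S Vyy"
  using has_derivative_continuous[OF dV] has_derivative_continuous[OF dVx] has_derivative_continuous[OF dVy]
    continuous_on_subset[OF cont(1)] continuous_on_subset[OF cont(2)] continuous_on_subset[OF cont(3)]
  by (auto intro!: continuous_at_imp_continuous_on)

lemma cont_pt: "continuous_on UNIV (\<lambda>z. pt (fst z) (snd z))"
  unfolding pt_def Complex_eq by (intro continuous_intros)

lemma cont_polar: "continuous_on UNIV V" "continuous_on UNIV Vr" "continuous_on UNIV Va"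
  "continuous_on UNIV Vrr" "continuous_on UNIV Vra" "continuous_on UNIV Vaa"
  unfolding Vr_def Va_def Vrr_def Vra_def Vaa_def
  by (intro continuous_intros cont_all)+

lemma continuous_integrand: "continuous_on UNIV integrand"
  unfolding integrand_def by (intro continuous_intros cont_all; simp)

lemma linear_onorm_le: "onorm (\<lambda>h. Re h * a + Im h * b) \<le> \<bar>a\<bar> + \<bar>b\<bar>"
proof (rule onorm_le)
  fix h :: complex
  have "\<bar>Re h * a + Im h * b\<bar> \<le> \<bar>Re h\<bar> * \<bar>a\<bar> + \<bar>Im h\<bar> * \<bar>b\<bar>"
    using abs_triangle_ineq[of "Re h * a" "Im h * b"] by (simp add: abs_mult)
  also have "\<dots> \<le> cmod h * \<bar>a\<bar> + cmod h * \<bar>b\<bar>"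
    by (intro add_mono mult_right_mono abs_Re_le_cmod abs_Im_le_cmod) auto
  finally show "norm (Re h * a + Im h * b) \<le> (\<bar>a\<bar> + \<bar>b\<bar>) * norm h" by (simp add: algebra_simps)
qed

lemma difference_bound:
  assumes f: "\<And>\<xi>. (f has_derivative (\<lambda>h. Re h * fx \<xi> + Im h * fy \<xi>)) (at \<xi>)"
    and B: "\<And>\<zeta>. cmod \<zeta> \<le> cmod \<xi> \<Longrightarrow> \<bar>fx \<zeta>\<bar> + \<bar>fy \<zeta>\<bar> \<le> B" and f0: "f 0 = (0::real)"
  shows "\<bar>f \<xi>\<bar> \<le> B * cmod \<xi>"
proof -
  have "norm (f \<xi> - f 0) \<le> B * norm (\<xi> - 0)"
    by (rule differentiable_bound[of "cball 0 (cmod \<xi>)" f "\<lambda>\<zeta> h. Re h * fx \<zeta> + Im h * fy \<zeta>"])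
       (use B in \<open>auto intro!: has_derivative_at_withinI[OF f] order_trans[OF linear_onorm_le]\<close>)
  then show ?thesis by (simp add: f0)
qed

text \<open>
  Vanishing of \<open>V\<close> to second order at \<open>0\<close>; applied at \<open>|\<xi>| = exp s\<close> this gives the decay \<open>exp s\<close>
  of \<open>u\<close>, in whose definition \<open>V\<close> is divided by \<open>2 * |\<xi>|\<close>.
\<close>
lemma quadratic_decay:
  obtains M where "\<And>\<xi>. cmod \<xi> \<le> 1 \<Longrightarrow> \<bar>V \<xi>\<bar> \<le> M * (cmod \<xi>)\<^sup>2" "\<And>\<xi>. cmod \<xi> \<le> 1 \<Longrightarrow> \<bar>Vr \<xi>\<bar> \<le> M * (cmod \<xi>)\<^sup>2"
    "\<And>\<xi>. cmod \<xi> \<le> 1 \<Longrightarrow> \<bar>Va \<xi>\<bar> \<le> M * (cmod \<xi>)\<^sup>2" "\<And>\<xi>. cmod \<xi> \<le> 1 \<Longrightarrow> \<bar>Vrr \<xi>\<bar> \<le> M * (cmod \<xi>)\<^sup>2"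
    "\<And>\<xi>. cmod \<xi> \<le> 1 \<Longrightarrow> \<bar>Vra \<xi>\<bar> \<le> M * (cmod \<xi>)\<^sup>2" "\<And>\<xi>. cmod \<xi> \<le> 1 \<Longrightarrow> \<bar>Vaa \<xi>\<bar> \<le> M * (cmod \<xi>)\<^sup>2"
proof -
  have "\<exists>m. \<forall>\<xi>\<in>cball 0 1. \<bar>Vxx \<xi>\<bar> + \<bar>Vxy \<xi>\<bar> + \<bar>Vyy \<xi>\<bar> \<le> m"
  proof -
    have "compact ((\<lambda>\<xi>. \<bar>Vxx \<xi>\<bar> + \<bar>Vxy \<xi>\<bar> + \<bar>Vyy \<xi>\<bar>) ` cball 0 1)"
      by (intro compact_continuous_image continuous_intros cont_all compact_cball)
    then have "bounded ((\<lambda>\<xi>. \<bar>Vxx \<xi>\<bar> + \<bar>Vxy \<xi>\<bar> + \<bar>Vyy \<xi>\<bar>) ` cball 0 1)" by (rule compact_imp_bounded)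
    then show ?thesis by (auto simp: bounded_iff)
  qed
  then obtain m where "\<forall>\<xi>\<in>cball 0 1. \<bar>Vxx \<xi>\<bar> + \<bar>Vxy \<xi>\<bar> + \<bar>Vyy \<xi>\<bar> \<le> m" by blast
  then have m: "\<bar>Vxx \<xi>\<bar> + \<bar>Vxy \<xi>\<bar> + \<bar>Vyy \<xi>\<bar> \<le> m" if "cmod \<xi> \<le> 1" for \<xi> using that by simp
  have m0: "0 \<le> m" using m[of 0] by simp
  have Vx: "\<bar>Vx \<xi>\<bar> \<le> m * cmod \<xi>" "\<bar>Vy \<xi>\<bar> \<le> m * cmod \<xi>" if "cmod \<xi> \<le> 1" for \<xi>
  proof -
    have "\<bar>Vxx \<zeta>\<bar> + \<bar>Vxy \<zeta>\<bar> \<le> m" "\<bar>Vxy \<zeta>\<bar> + \<bar>Vyy \<zeta>\<bar> \<le> m" if "cmod \<zeta> \<le> cmod \<xi>" for \<zeta>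
      using m[of \<zeta>] that \<open>cmod \<xi> \<le> 1\<close> by auto
    then show "\<bar>Vx \<xi>\<bar> \<le> m * cmod \<xi>" "\<bar>Vy \<xi>\<bar> \<le> m * cmod \<xi>"
      by (intro difference_bound[OF dVx] difference_bound[OF dVy] zero; blast)+
  qed
  have V: "\<bar>V \<xi>\<bar> \<le> 2 * m * (cmod \<xi>)\<^sup>2" if \<xi>: "cmod \<xi> \<le> 1" for \<xi>
  proof -
    have "\<bar>V \<xi>\<bar> \<le> (2 * m * cmod \<xi>) * cmod \<xi>"
    proof (rule difference_bound[OF dV _ zero(1)])
      fix \<zeta> assume \<zeta>: "cmod \<zeta> \<le> cmod \<xi>"
      have "m * cmod \<zeta> \<le> m * cmod \<xi>" using \<zeta> m0 by (rule mult_left_mono)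
      then show "\<bar>Vx \<zeta>\<bar> + \<bar>Vy \<zeta>\<bar> \<le> 2 * m * cmod \<xi>" using Vx[of \<zeta>] \<zeta> \<xi> by linarith
    qed
    then show ?thesis by (simp add: power2_eq_square mult.assoc)
  qed
  have prod: "\<bar>x * y\<bar> \<le> A * B" if "\<bar>x\<bar> \<le> A" "\<bar>y\<bar> \<le> B" for x y A B :: real
    unfolding abs_mult using that by (intro mult_mono) auto
  have first: "\<bar>Re \<xi> * Vx \<xi>\<bar> \<le> m * (cmod \<xi>)\<^sup>2" "\<bar>Re \<xi> * Vy \<xi>\<bar> \<le> m * (cmod \<xi>)\<^sup>2"
    "\<bar>Im \<xi> * Vx \<xi>\<bar> \<le> m * (cmod \<xi>)\<^sup>2" "\<bar>Im \<xi> * Vy \<xi>\<bar> \<le> m * (cmod \<xi>)\<^sup>2" if "cmod \<xi> \<le> 1" for \<xi>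
    using prod[OF abs_Re_le_cmod[of \<xi>] Vx(1)[OF that]] prod[OF abs_Re_le_cmod[of \<xi>] Vx(2)[OF that]]
      prod[OF abs_Im_le_cmod[of \<xi>] Vx(1)[OF that]] prod[OF abs_Im_le_cmod[of \<xi>] Vx(2)[OF that]]
    by (simp_all add: power2_eq_square algebra_simps)
  have coef: "\<bar>(Re \<xi>)\<^sup>2\<bar> \<le> (cmod \<xi>)\<^sup>2" "\<bar>(Im \<xi>)\<^sup>2\<bar> \<le> (cmod \<xi>)\<^sup>2" "\<bar>Re \<xi> * Im \<xi>\<bar> \<le> (cmod \<xi>)\<^sup>2" for \<xi>
    using prod[OF abs_Re_le_cmod[of \<xi>] abs_Im_le_cmod[of \<xi>]]
    by (simp_all add: cmod_power2[of \<xi>] power2_eq_square[of "cmod \<xi>", symmetric])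
  have entry: "\<bar>Vxx \<xi>\<bar> \<le> m" "\<bar>Vxy \<xi>\<bar> \<le> m" "\<bar>Vyy \<xi>\<bar> \<le> m" if "cmod \<xi> \<le> 1" for \<xi>
    using m[OF that] by auto
  have second: "\<bar>c * v\<bar> \<le> m * (cmod \<xi>)\<^sup>2" if "\<bar>c\<bar> \<le> (cmod \<xi>)\<^sup>2" "\<bar>v\<bar> \<le> m" for c v \<xi>
    using prod[OF that] by (simp add: mult.commute)
  have nn: "0 \<le> m * (cmod \<xi>)\<^sup>2" for \<xi> using m0 by simp
  show ?thesis
  proof (rule that[of "4 * m"])
    fix \<xi> :: complex assume \<xi>: "cmod \<xi> \<le> 1"
    note f = first[OF \<xi>] and n = nn[of \<xi>]
    note s = second[OF coef(1)[of \<xi>] entry(1)[OF \<xi>]] second[OF coef(1)[of \<xi>] entry(2)[OF \<xi>]] second[OF coef(1)[of \<xi>] entry(3)[OF \<xi>]]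
      second[OF coef(2)[of \<xi>] entry(1)[OF \<xi>]] second[OF coef(2)[of \<xi>] entry(2)[OF \<xi>]] second[OF coef(2)[of \<xi>] entry(3)[OF \<xi>]]
      second[OF coef(3)[of \<xi>] entry(1)[OF \<xi>]] second[OF coef(3)[of \<xi>] entry(2)[OF \<xi>]] second[OF coef(3)[of \<xi>] entry(3)[OF \<xi>]]
    show "\<bar>V \<xi>\<bar> \<le> 4 * m * (cmod \<xi>)\<^sup>2" using V[OF \<xi>] n by linarith
    show "\<bar>Vr \<xi>\<bar> \<le> 4 * m * (cmod \<xi>)\<^sup>2" unfolding Vr_def using f(1,4) n by linarith
    show "\<bar>Va \<xi>\<bar> \<le> 4 * m * (cmod \<xi>)\<^sup>2" unfolding Va_def using f(2,3) n by linarith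
    show "\<bar>Vrr \<xi>\<bar> \<le> 4 * m * (cmod \<xi>)\<^sup>2" unfolding Vrr_def using s(1,8,6) n by linarith
    show "\<bar>Vra \<xi>\<bar> \<le> 4 * m * (cmod \<xi>)\<^sup>2"
      unfolding Vra_def right_diff_distrib left_diff_distrib using s(9,7,2,5) n by linarith
    show "\<bar>Vaa \<xi>\<bar> \<le> 4 * m * (cmod \<xi>)\<^sup>2" unfolding Vaa_def using s(4,8,3) n by linarith
  qed
qed

lemma cylinder: "\<exists>C. antipodal_cylinder u us up uss usp upp C"
proof -
  obtain M where M: "\<And>\<xi>. cmod \<xi> \<le> 1 \<Longrightarrow> \<bar>V \<xi>\<bar> \<le> M * (cmod \<xi>)\<^sup>2" "\<And>\<xi>. cmod \<xi> \<le> 1 \<Longrightarrow> \<bar>Vr \<xi>\<bar> \<le> M * (cmod \<xi>)\<^sup>2"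
    "\<And>\<xi>. cmod \<xi> \<le> 1 \<Longrightarrow> \<bar>Va \<xi>\<bar> \<le> M * (cmod \<xi>)\<^sup>2" "\<And>\<xi>. cmod \<xi> \<le> 1 \<Longrightarrow> \<bar>Vrr \<xi>\<bar> \<le> M * (cmod \<xi>)\<^sup>2"
    "\<And>\<xi>. cmod \<xi> \<le> 1 \<Longrightarrow> \<bar>Vra \<xi>\<bar> \<le> M * (cmod \<xi>)\<^sup>2" "\<And>\<xi>. cmod \<xi> \<le> 1 \<Longrightarrow> \<bar>Vaa \<xi>\<bar> \<le> M * (cmod \<xi>)\<^sup>2"
    using quadratic_decay by blast
  have M0: "0 \<le> M" using M(1)[of 1] by simp
  have scale: "\<bar>exp (- s) / 2 * v\<bar> \<le> 2 * M * exp s" if "\<bar>v\<bar> \<le> 3 * (M * (exp s)\<^sup>2)" for s v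
  proof -
    have "\<bar>exp (- s) / 2 * v\<bar> \<le> exp (- s) / 2 * (3 * (M * (exp s)\<^sup>2))"
      unfolding abs_mult using that by (intro mult_mono) auto
    also have "\<dots> = 3 / 2 * (M * exp s)" by (simp add: exp_minus power2_eq_square field_simps)
    also have "\<dots> \<le> 2 * M * exp s" using M0 by simp
    finally show ?thesis .
  qed
  have comp: "continuous_on UNIV (\<lambda>z. f (pt (fst z) (snd z)))" if "continuous_on UNIV f" for f :: "complex \<Rightarrow> real"
    by (rule continuous_on_compose2[OF that cont_pt]) simp
  have "antipodal_cylinder u us up uss usp upp (2 * M)"
  proof unfold_locales
    show "u s (p + 2 * pi) = u s p" for s p 
    proof -
      have "pt s (p + 2 * pi) = pt s p" by (simp add: complex_eq_iff pt_simps)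
      then show ?thesis by (simp add: u_def)
    qed
    show "u (- s) (p + pi) = - u s p" for s p
    proof -
      have nz: "pt s p \<noteq> 0" by (simp add: pt_def)
      have e: "exp (- s) * exp s = 1" by (simp add: exp_minus)
      have "pt (- s) (p + pi) * cnj (pt s p) = of_real (- (exp (- s) * exp s) * (cos p * cos p + sin p * sin p))"
      proof -
        have gen: "Complex (E * - c) (E * - t) * cnj (Complex (F * c) (F * t)) = of_real (- (E * F) * (c * c + t * t))"
          for E F c t :: real by (simp add: complex_eq_iff algebra_simps)
        have "pt (- s) (p + pi) = Complex (exp (- s) * - cos p) (exp (- s) * - sin p)"
          "pt s p = Complex (exp s * cos p) (exp s * sin p)"
          by (simp_all add: complex_eq_iff pt_simps)
        then show ?thesis by (simp only: gen)
      qed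
      moreover have "cos p * cos p + sin p * sin p = 1"
        using sin_cos_squared_add2[of p] by (simp add: power2_eq_square)
      ultimately have "pt (- s) (p + pi) * cnj (pt s p) = - 1" by (simp add: e)
      then have "pt (- s) (p + pi) = - 1 / cnj (pt s p)" using nz by (simp add: field_simps)
      moreover note nz
      ultimately have "V (pt (- s) (p + pi)) = - V (pt s p) / (exp s)\<^sup>2"
        using antipodal_plane[of "pt s p"] by (simp add: pt_simps)
      then show ?thesis by (simp add: u_def exp_minus power2_eq_square field_simps)
    qed
    show "((\<lambda>s. u s p) has_real_derivative us s p) (at s)" "((\<lambda>p. u s p) has_real_derivative up s p) (at p)"
      "((\<lambda>s. us s p) has_real_derivative uss s p) (at s)" "((\<lambda>p. us s p) has_real_derivative usp s p) (at p)"
      "((\<lambda>s. up s p) has_real_derivative usp s p) (at s)" "((\<lambda>p. up s p) has_real_derivative upp s p) (at p)" for s p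
    proof -
      have ds: "((\<lambda>s. exp (- s) / 2 * f s) has_real_derivative exp (- s) / 2 * (f' - f s)) (at s)"
        if "(f has_real_derivative f') (at s)" for f f'
        using that by (auto intro!: derivative_eq_intros simp: field_simps)
      note d = derivs_pt[where s = s and p = p]
      show "((\<lambda>s. u s p) has_real_derivative us s p) (at s)" "((\<lambda>s. up s p) has_real_derivative usp s p) (at s)"
        "((\<lambda>p. u s p) has_real_derivative up s p) (at p)" "((\<lambda>p. up s p) has_real_derivative upp s p) (at p)"
        unfolding u_def us_def up_def usp_def upp_def
        using ds[OF d(1)] ds[OF d(5)] DERIV_cmult[OF d(2), of "exp (- s) / 2"] DERIV_cmult[OF d(6), of "exp (- s) / 2"] by simp_all
      show "((\<lambda>s. us s p) has_real_derivative uss s p) (at s)"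
        unfolding us_def uss_def
        by (rule DERIV_cong[OF ds[OF DERIV_diff[OF d(3) d(1)]]]) simp
      show "((\<lambda>p. us s p) has_real_derivative usp s p) (at p)"
        unfolding us_def usp_def
        by (rule DERIV_cong[OF DERIV_cmult[OF DERIV_diff[OF d(4) d(2)]]]) simp
    qed
    show "continuous_on UNIV (\<lambda>z. uss (fst z) (snd z))" "continuous_on UNIV (\<lambda>z. usp (fst z) (snd z))"
      "continuous_on UNIV (\<lambda>z. upp (fst z) (snd z))" "continuous_on UNIV (\<lambda>z. u (fst z) (snd z))"
      "continuous_on UNIV (\<lambda>z. us (fst z) (snd z))" "continuous_on UNIV (\<lambda>z. up (fst z) (snd z))"
      unfolding u_def us_def up_def uss_def usp_def upp_def
      by (intro continuous_intros comp cont_polar; simp)+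
    fix s p :: real assume s: "s \<le> 0"
    have c: "cmod (pt s p) \<le> 1" using s by (simp add: pt_simps)
    note b = M[OF c, unfolded pt_simps(3)]
    have n: "0 \<le> M * (exp s)\<^sup>2" using M0 by simp
    show "\<bar>u s p\<bar> \<le> 2 * M * exp s" "\<bar>us s p\<bar> \<le> 2 * M * exp s" "\<bar>up s p\<bar> \<le> 2 * M * exp s"
      "\<bar>uss s p\<bar> \<le> 2 * M * exp s" "\<bar>usp s p\<bar> \<le> 2 * M * exp s" "\<bar>upp s p\<bar> \<le> 2 * M * exp s"
      unfolding u_def us_def up_def uss_def usp_def upp_def
      by (intro scale; use b n in linarith)+
  qed
  then show ?thesis ..
qed

text \<open>
  Both sides are written in \<open>a\<close>, \<open>b\<close>, \<open>k\<close>, the entries of the Hessian of \<open>V\<close> in the basis \<open>\<xi>\<close>, \<open>\<i> * \<xi>\<close>. A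
  difference of two squares turns \<open>(a - b)^2 - (a + b - 2 e)^2\<close> into \<open>4 (a - e) (e - b)\<close>.
\<close>
lemma integrand_cylinder:
  assumes "antipodal_cylinder u us up uss usp upp C"
  shows "exp (2 * s) * (4 / (1 + (cmod (pt s p))\<^sup>2)\<^sup>2 * integrand (pt s p)) = antipodal_cylinder.J u us uss usp upp s p"
proof -
  define x where "x = X s p" define y where "y = Y s p"
  define E where "E = exp s"
  have E: "E > 0" and xy: "x\<^sup>2 + y\<^sup>2 = E\<^sup>2" using pt_sq[of s p] by (simp_all add: E_def x_def y_def)
  have es: "exp (2 * s) = E\<^sup>2" "exp (- s) = 1 / E" by (simp_all add: E_def exp_double exp_minus divide_inverse)
  define D where "D = 1 + E\<^sup>2"
  have D: "D > 0" by (simp add: D_def add_pos_nonneg)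
  have t: "tanh s = (E\<^sup>2 - 1) / D"
  proof -
    have "tanh s = (E - 1 / E) / (E + 1 / E)" by (simp add: tanh_altdef es E_def[symmetric])
    moreover have "E - 1 / E = (E\<^sup>2 - 1) / E" "E + 1 / E = D / E"
      using E by (simp_all add: D_def field_simps power2_eq_square)
    ultimately show ?thesis using E by simp
  qed
  define a where "a = Vrr (pt s p)" define b where "b = Vaa (pt s p)" define k where "k = Vra (pt s p)"
  define d where "d = Vr (pt s p) - V (pt s p)"
  have ab: "E\<^sup>2 * (Vxx (pt s p) + Vyy (pt s p)) = a + b"
    unfolding a_def b_def Vrr_def Vaa_def x_def[symmetric] y_def[symmetric] xy[symmetric]
    by (simp add: algebra_simps)
  have abk: "(E\<^sup>2)\<^sup>2 * ((Vxx (pt s p) - Vyy (pt s p))\<^sup>2 + 4 * (Vxy (pt s p))\<^sup>2) = (a - b)\<^sup>2 + 4 * k\<^sup>2"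
    unfolding a_def b_def k_def Vrr_def Vaa_def Vra_def x_def[symmetric] y_def[symmetric] xy[symmetric]
    by (simp add: algebra_simps power2_eq_square)
  define e where "e = 2 * E\<^sup>2 / D * d"
  have integrand: "integrand (pt s p) = D\<^sup>2 / (64 * (E\<^sup>2)\<^sup>2) * ((a - b)\<^sup>2 + 4 * k\<^sup>2) - (D / (8 * E\<^sup>2) * (a + b) - d / 2)\<^sup>2"
  proof -
    have 1: "(Vxx (pt s p) - Vyy (pt s p))\<^sup>2 + 4 * (Vxy (pt s p))\<^sup>2 = ((a - b)\<^sup>2 + 4 * k\<^sup>2) / (E\<^sup>2)\<^sup>2"
      and 2: "Vxx (pt s p) + Vyy (pt s p) = (a + b) / E\<^sup>2"
      using ab abk E by (simp_all add: field_simps)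
    have 3: "D / 8 * ((a + b) / E\<^sup>2) - Vr (pt s p) / 2 + V (pt s p) / 2 = D / (8 * E\<^sup>2) * (a + b) - d / 2"
      by (simp add: d_def diff_divide_distrib)
    have 4: "D\<^sup>2 / 64 * (((a - b)\<^sup>2 + 4 * k\<^sup>2) / (E\<^sup>2)\<^sup>2) = D\<^sup>2 / (64 * (E\<^sup>2)\<^sup>2) * ((a - b)\<^sup>2 + 4 * k\<^sup>2)"
      by simp
    show ?thesis
      unfolding integrand_def pt_simps(3) E_def[symmetric] D_def[symmetric] Vr_def[symmetric] 1 2 3 4 ..
  qed
  have "exp (2 * s) * (4 / (1 + (cmod (pt s p))\<^sup>2)\<^sup>2 * integrand (pt s p)) = ((a - e) * (e - b) + k\<^sup>2) / (4 * E\<^sup>2)"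
  proof -
    have d: "d = e * D / (2 * E\<^sup>2)" using D E by (simp add: e_def)
    have h: "D / (8 * E\<^sup>2) * (a + b) - d / 2 = D / (8 * E\<^sup>2) * (a + b - 2 * e)"
      unfolding d using E by (simp add: field_simps)
    have sq: "(D / (8 * E\<^sup>2) * q)\<^sup>2 = D\<^sup>2 / (64 * (E\<^sup>2)\<^sup>2) * q\<^sup>2" for q
      by (simp add: power_mult_distrib power_divide)
    have "integrand (pt s p) = D\<^sup>2 / (64 * (E\<^sup>2)\<^sup>2) * ((a - b)\<^sup>2 + 4 * k\<^sup>2 - (a + b - 2 * e)\<^sup>2)"
      unfolding integrand h sq by (rule right_diff_distrib[symmetric])
    moreover have "(a - b)\<^sup>2 + 4 * k\<^sup>2 - (a + b - 2 * e)\<^sup>2 = 4 * ((a - e) * (e - b) + k\<^sup>2)"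
      by (simp add: power2_eq_square algebra_simps)
    ultimately show ?thesis
      unfolding pt_simps(3) E_def[symmetric] D_def[symmetric] es using E D
      by (simp add: field_simps power2_eq_square)
  qed
  also have "\<dots> = antipodal_cylinder.J u us uss usp upp s p"
  proof -
    have 1: "uss s p - tanh s * us s p = (a - e) / (2 * E)"
      unfolding uss_def us_def es t e_def a_def[symmetric] d_def using E D
      by (simp add: field_simps) (simp add: D_def algebra_simps power2_eq_square)
    have 2: "tanh s * us s p - upp s p - u s p = (e - b) / (2 * E)"
      unfolding upp_def us_def u_def es t e_def b_def[symmetric] d_def using E D
      by (simp add: field_simps) (simp add: D_def algebra_simps power2_eq_square)
    have 3: "usp s p = k / (2 * E)" unfolding usp_def es k_def by simp
    show ?thesis
      unfolding antipodal_cylinder.J_def[OF assms] 1 2 3 using E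
      by (simp add: field_simps power2_eq_square)
  qed
  finally show ?thesis .
qed

theorem sphere_integral_nonneg:
  shows "0 \<le> (LINT \<xi>|sphere_area. integrand \<xi>)" and "(LINT \<xi>|sphere_area. integrand \<xi>) = 0 \<Longrightarrow> V \<xi> = 0"
proof -
  obtain C where cyl: "antipodal_cylinder u us up uss usp upp C" using cylinder by blast
  interpret antipodal_cylinder u us up uss usp upp C by (rule cyl)
  let ?f = "\<lambda>\<xi>. 4 / (1 + (cmod \<xi>)\<^sup>2)\<^sup>2 * integrand \<xi>"
  have nz: "1 + (cmod \<xi>)\<^sup>2 \<noteq> 0" for \<xi> using one_plus_cmod_pos[of \<xi>] by simp
  have [measurable]: "integrand \<in> borel_measurable borel" by (rule borel_measurable_continuous_onI[OF continuous_integrand])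
  have mf: "?f \<in> borel_measurable borel" by measurable
  have fJ: "exp (2 * s) * ?f (exp (Complex s p)) = J s p" for s p
    using integrand_cylinder[OF cyl, of s p] unfolding pt_def .
  have "(LINT \<xi>|sphere_area. integrand \<xi>) = integral\<^sup>L lborel ?f"
    unfolding sphere_area_def by (subst integral_density) auto
  also have "\<dots> = (LINT s|lborel. LINT p|lborel. indicator {0..2*pi} p * (exp (2 * s) * ?f (exp (Complex s p))))"
    by (rule integral_log_polar[OF mf]) (unfold fJ, rule integrable_J)
  also have "\<dots> = integral\<^sup>L lborel circle_J" by (simp only: fJ LINT_J_eq_circle_J)
  finally have I: "(LINT \<xi>|sphere_area. integrand \<xi>) = integral\<^sup>L lborel circle_J" .
  note main = J_integral_nonneg[OF circle_J_integral_limit]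
  show "0 \<le> (LINT \<xi>|sphere_area. integrand \<xi>)" unfolding I by (rule main(1))
  assume "(LINT \<xi>|sphere_area. integrand \<xi>) = 0"
  then have u0: "u s p = 0" if "p \<in> {0..2*pi}" for s p using main(2) that unfolding I by blast
  show "V \<xi> = 0"
  proof (cases "\<xi> = 0")
    case True then show ?thesis by (simp add: zero)
  next
    case False
    have "\<xi> = of_real (cmod \<xi>) * cis (Arg2pi \<xi>)" using Arg2pi_eq[of \<xi>] by (simp add: cis_conv_exp)
    also have "\<dots> = pt (ln (cmod \<xi>)) (Arg2pi \<xi>)"
      using False by (simp add: pt_def exp_eq_polar)
    finally have eq: "\<xi> = pt (ln (cmod \<xi>)) (Arg2pi \<xi>)" .
    have "u (ln (cmod \<xi>)) (Arg2pi \<xi>) = 0" using u0 Arg2pi[of \<xi>] by simp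
    then show ?thesis by (subst eq) (simp add: u_def)
  qed
qed

end

section \<open>Bodies of constant width and their contact points\<close>

text \<open>
  A remainder that is \<open>o\<close> of the increment of a Lipschitz map is \<open>o\<close> of the increment of its
  argument. Through this the chain rule applies to a map not yet known to be differentiable.
\<close>
lemma has_derivative_zero_compose_lipschitz:
  fixes R :: "'b::real_normed_vector \<Rightarrow> 'c::real_normed_vector" and X :: "'a::real_normed_vector \<Rightarrow> 'b"
  assumes R: "(R has_derivative (\<lambda>_. 0)) (at (X a))"
    and lip: "\<forall>\<^sub>F x in nhds a. norm (X x - X a) \<le> L * norm (x - a)"
  shows "((\<lambda>x. R (X x)) has_derivative (\<lambda>_. 0)) (at a)"
  unfolding has_derivative_at_alt
proof (intro conjI allI impI)
  fix e :: real assume e: "e > 0"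
  define L' where "L' = \<bar>L\<bar> + 1"
  have L': "L' > 0" by (simp add: L'_def)
  obtain d1 where d1: "d1 > 0" and 1: "\<And>x. dist x a < d1 \<Longrightarrow> norm (X x - X a) \<le> L * norm (x - a)"
    using lip by (auto simp: eventually_nhds_metric)
  have lip': "norm (X x - X a) \<le> L' * norm (x - a)" if "dist x a < d1" for x
    using order_trans[OF 1[OF that] mult_right_mono[of L L' "norm (x - a)"]] by (simp add: L'_def)
  have eL: "e / L' > 0" using e L' by simp
  obtain d2 where d2: "d2 > 0"
    and 2: "\<And>y. norm (y - X a) < d2 \<Longrightarrow> norm (R y - R (X a) - 0) \<le> (e / L') * norm (y - X a)"
    using R eL unfolding has_derivative_at_alt by blast
  show "\<exists>d>0. \<forall>y. norm (y - a) < d \<longrightarrow> norm (R (X y) - R (X a) - 0) \<le> e * norm (y - a)"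
  proof (intro exI[of _ "min d1 (d2 / L')"] conjI allI impI)
    show "0 < min d1 (d2 / L')" using d1 d2 L' by simp
    fix y assume y: "norm (y - a) < min d1 (d2 / L')"
    have a: "norm (X y - X a) \<le> L' * norm (y - a)" using lip'[of y] y by (simp add: dist_norm)
    also have "\<dots> < d2" using y L' by (simp add: pos_less_divide_eq mult.commute)
    finally have "norm (R (X y) - R (X a) - 0) \<le> (e / L') * norm (X y - X a)" by (rule 2)
    also have "\<dots> \<le> (e / L') * (L' * norm (y - a))" by (rule mult_left_mono[OF a]) (use eL in simp)
    also have "\<dots> = e * norm (y - a)" using L' by simp
    finally show "norm (R (X y) - R (X a) - 0) \<le> e * norm (y - a)" .
  qed
qed (rule bounded_linear_zero)

lemma norm_sgn_diff_le:
  fixes x y :: "'a::real_inner"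
  assumes "y \<noteq> 0"
  shows "norm (sgn x - sgn y) \<le> 2 / norm y * norm (x - y)"
proof (cases "x = 0")
  case True
  then show ?thesis using assms by (simp add: norm_sgn)
next
  case False
  have "sgn x - sgn y = (1 / norm y) *\<^sub>R ((x - y) + (norm y - norm x) *\<^sub>R sgn x)"
    using False assms by (simp add: sgn_div_norm algebra_simps divide_inverse)
  then have "norm (sgn x - sgn y) = (1 / norm y) * norm ((x - y) + (norm y - norm x) *\<^sub>R sgn x)"
    by simp
  also have "\<dots> \<le> (1 / norm y) * (norm (x - y) + \<bar>norm y - norm x\<bar>)"
    using norm_triangle_ineq[of "x - y" "(norm y - norm x) *\<^sub>R sgn x"] False
    by (intro mult_left_mono) (simp_all add: norm_sgn)
  also have "\<dots> \<le> (1 / norm y) * (norm (x - y) + norm (x - y))"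
    using norm_triangle_ineq3[of y x] by (intro mult_left_mono add_left_mono) (simp_all add: norm_minus_commute)
  finally show ?thesis by simp
qed

text \<open>
  Lagrange's multiplier rule for maximising a linear form on a level set. For a tangent vector \<open>v\<close>, the function \<open>g\<close> changes
  sign between \<open>p + t (v - \<delta> \<gamma>)\<close> and \<open>p + t (v + \<delta> \<gamma>)\<close> for small \<open>t\<close>, so the level set
  meets this segment; as \<open>\<delta>\<close> is arbitrary, \<open>v\<close> cannot point strictly out of the half space.
\<close>
lemma gradient_parallel_support_direction:
  fixes g :: "'a::real_inner \<Rightarrow> real"
  assumes U: "open U" "p \<in> U" and g0: "g p = 0"
    and dg: "(g has_derivative (\<lambda>h. \<gamma> \<bullet> h)) (at p)" and cont: "continuous_on U g"
    and \<gamma>: "\<gamma> \<noteq> 0" and x: "x \<noteq> 0"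
    and below: "\<And>z. z \<in> U \<Longrightarrow> g z = 0 \<Longrightarrow> (z - p) \<bullet> x \<le> 0"
  obtains k where "k \<noteq> 0" "\<gamma> = k *\<^sub>R x"
proof -
  obtain \<rho> where \<rho>: "\<rho> > 0" "ball p \<rho> \<subseteq> U" using U openE by blast
  have dir: "((\<lambda>t. g (p + t *\<^sub>R v)) has_real_derivative \<gamma> \<bullet> v) (at 0)" for v
  proof -
    have "((\<lambda>t. p + t *\<^sub>R v) has_derivative (\<lambda>t. t *\<^sub>R v)) (at 0)"
      by (auto intro!: derivative_eq_intros)
    moreover have "(g has_derivative (\<lambda>h. \<gamma> \<bullet> h)) (at (p + 0 *\<^sub>R v))" using dg by simp
    ultimately have "((\<lambda>t. g (p + t *\<^sub>R v)) has_derivative (\<lambda>t. \<gamma> \<bullet> (t *\<^sub>R v))) (at 0)"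
      by (rule has_derivative_compose)
    then show ?thesis by (simp add: has_field_derivative_def mult_commute_abs)
  qed
  have tangent_le: "v \<bullet> x \<le> 0" if v: "\<gamma> \<bullet> v = 0" for v
  proof (rule ccontr)
    assume "\<not> v \<bullet> x \<le> 0"
    then have vx: "v \<bullet> x > 0" by simp
    (* small enough that adding s \<gamma> with |s| at most \<delta> cannot change the sign of v \<bullet> x *)
    define \<delta> where "\<delta> = (v \<bullet> x) / (2 * (\<bar>\<gamma> \<bullet> x\<bar> + 1))"
    have \<delta>: "\<delta> > 0" using vx by (simp add: \<delta>_def)
    have \<delta>x: "\<delta> * \<bar>\<gamma> \<bullet> x\<bar> < v \<bullet> x"
    proof -
      have "\<delta> * \<bar>\<gamma> \<bullet> x\<bar> < \<delta> * (2 * (\<bar>\<gamma> \<bullet> x\<bar> + 1))" using \<delta> by (intro mult_strict_left_mono) auto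
      then show ?thesis by (simp add: \<delta>_def)
    qed
    have "\<gamma> \<bullet> (v + \<delta> *\<^sub>R \<gamma>) > 0" "\<gamma> \<bullet> (v - \<delta> *\<^sub>R \<gamma>) < 0"
      using \<delta> \<gamma> v by (simp_all add: inner_add_right inner_diff_right)
    note slope = this
    obtain d1 where d1: "d1 > 0" "\<forall>t>0. t < d1 \<longrightarrow> g p < g (p + t *\<^sub>R (v + \<delta> *\<^sub>R \<gamma>))"
      using has_real_derivative_pos_inc_right[OF dir slope(1)] by auto
    obtain d2 where d2: "d2 > 0" "\<forall>t>0. t < d2 \<longrightarrow> g (p + t *\<^sub>R (v - \<delta> *\<^sub>R \<gamma>)) < g p"
      using has_real_derivative_neg_dec_right[OF dir slope(2)] by auto
    have d: "d1 > 0" "\<And>t. 0 < t \<Longrightarrow> t < d1 \<Longrightarrow> g p < g (p + t *\<^sub>R (v + \<delta> *\<^sub>R \<gamma>))"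
      "d2 > 0" "\<And>t. 0 < t \<Longrightarrow> t < d2 \<Longrightarrow> g (p + t *\<^sub>R (v - \<delta> *\<^sub>R \<gamma>)) < g p"
      using d1 d2 by blast+
    define b where "b = norm v + \<delta> * norm \<gamma> + 1"
    have b: "b > 0" using \<delta> by (simp add: b_def add_nonneg_pos)
    (* b bounds the length of v + s \<gamma>, so that the segment at time t stays in the ball *)
    define t where "t = min (min d1 d2) (\<rho> / b) / 2"
    have t: "0 < t" "t < d1" "t < d2"
      using d(1,3) \<rho>(1) b by (auto simp: t_def min_def)
    have "t \<le> \<rho> / b / 2" by (simp add: t_def)
    then have "t * b \<le> \<rho> / 2" using b by (simp add: field_simps)
    then have tb: "t * b < \<rho>" using \<rho>(1) by simp
    have inU: "p + t *\<^sub>R (v + s *\<^sub>R \<gamma>) \<in> U" if "\<bar>s\<bar> \<le> \<delta>" for s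
    proof -
      have "norm (v + s *\<^sub>R \<gamma>) \<le> norm v + \<bar>s\<bar> * norm \<gamma>" using norm_triangle_ineq[of v "s *\<^sub>R \<gamma>"] by simp
      also have "\<dots> \<le> b" using mult_right_mono[OF that, of "norm \<gamma>"] by (simp add: b_def)
      finally have "t * norm (v + s *\<^sub>R \<gamma>) < \<rho>" using t tb mult_left_mono[of "norm (v + s *\<^sub>R \<gamma>)" b t] by linarith
      then have "p + t *\<^sub>R (v + s *\<^sub>R \<gamma>) \<in> ball p \<rho>" using t by (simp add: dist_norm)
      then show ?thesis using \<rho> by blast
    qed
    have "\<exists>s. - \<delta> \<le> s \<and> s \<le> \<delta> \<and> g (p + t *\<^sub>R (v + s *\<^sub>R \<gamma>)) = 0"
    proof (rule IVT')
      show "continuous_on {- \<delta>..\<delta>} (\<lambda>s. g (p + t *\<^sub>R (v + s *\<^sub>R \<gamma>)))"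
        by (rule continuous_on_compose2[OF cont]) (use inU in \<open>auto intro!: continuous_intros\<close>)
    qed (use d t g0 \<delta> in \<open>force+\<close>)
    then obtain s where s0: "- \<delta> \<le> s" "s \<le> \<delta>" and s2: "g (p + t *\<^sub>R (v + s *\<^sub>R \<gamma>)) = 0" by blast
    have s: "\<bar>s\<bar> \<le> \<delta>" "g (p + t *\<^sub>R (v + s *\<^sub>R \<gamma>)) = 0" using s0 s2 by auto
    have "t * (v \<bullet> x + s * (\<gamma> \<bullet> x)) \<le> 0"
      using below[OF inU[OF s(1)] s(2)] by (simp add: inner_add_left)
    then have "v \<bullet> x + s * (\<gamma> \<bullet> x) \<le> 0" using t by (simp add: mult_le_0_iff)
    moreover have "\<bar>s * (\<gamma> \<bullet> x)\<bar> \<le> \<delta> * \<bar>\<gamma> \<bullet> x\<bar>"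
      using mult_right_mono[OF s(1), of "\<bar>\<gamma> \<bullet> x\<bar>"] by (simp add: abs_mult)
    ultimately show False using \<delta>x by linarith
  qed
  have tangent: "v \<bullet> x = 0" if "\<gamma> \<bullet> v = 0" for v
    using tangent_le[of v] tangent_le[of "- v"] that by simp
  define m where "m = (\<gamma> \<bullet> x) / (\<gamma> \<bullet> \<gamma>)"
  define v where "v = x - m *\<^sub>R \<gamma>"
  have gv: "\<gamma> \<bullet> v = 0" using \<gamma> by (simp add: v_def m_def inner_diff_right)
  have "v \<bullet> v = 0" using tangent[OF gv] gv by (simp add: v_def inner_diff_right inner_commute)
  then have xm: "x = m *\<^sub>R \<gamma>" by (simp add: v_def)
  then have "m \<noteq> 0" using x by auto
  then show ?thesis using that[of "1 / m"] xm by simp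
qed

lemma gradient_blinfun:
  obtains G :: "('a::euclidean_space \<Rightarrow>\<^sub>L real) \<Rightarrow>\<^sub>L 'a" where "\<And>\<phi> h. blinfun_apply G \<phi> \<bullet> h = blinfun_apply \<phi> h"
proof -
  define grad where "grad \<phi> = (\<Sum>b\<in>Basis. blinfun_apply \<phi> b *\<^sub>R b)" for \<phi> :: "'a \<Rightarrow>\<^sub>L real"
  have bl: "bounded_linear grad"
    unfolding grad_def by (intro bounded_linear_intros)
  have "blinfun_apply (Blinfun grad) \<phi> \<bullet> h = blinfun_apply \<phi> h" for \<phi> h
  proof -
    have "grad \<phi> \<bullet> h = (\<Sum>b\<in>Basis. (h \<bullet> b) *\<^sub>R blinfun_apply \<phi> b)"
      unfolding grad_def inner_sum_left by (simp add: inner_commute mult.commute)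
    also have "\<dots> = blinfun_apply \<phi> (\<Sum>b\<in>Basis. (h \<bullet> b) *\<^sub>R b)"
      by (simp add: blinfun.sum_right blinfun.scaleR_right)
    finally show ?thesis by (simp add: bounded_linear_Blinfun_apply[OF bl] euclidean_representation)
  qed
  then show ?thesis by (rule that)
qed

text \<open>
  The inverse function rule when the inverse is known to be Lipschitz: \<open>B (\<Phi> p) - p\<close> has
  derivative zero at \<open>X a\<close>, so \<open>X\<close> and \<open>B (T x)\<close> agree to first order at \<open>a\<close>.
\<close>
lemma lipschitz_inverse_has_derivative:
  fixes \<Phi> :: "'b::real_normed_vector \<Rightarrow> 'c::real_normed_vector" and X :: "'a::real_normed_vector \<Rightarrow> 'b"
  assumes d\<Phi>: "(\<Phi> has_derivative A) (at (X a))" and B: "bounded_linear B" "\<And>h. B (A h) = h"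
    and dT: "(T has_derivative T') (at a)" and eq: "\<forall>\<^sub>F x in nhds a. \<Phi> (X x) = T x"
    and lip: "\<forall>\<^sub>F x in nhds a. norm (X x - X a) \<le> L * norm (x - a)"
  shows "(X has_derivative (\<lambda>h. B (T' h))) (at a)"
proof -
  have "((\<lambda>p. B (\<Phi> p) - p) has_derivative (\<lambda>h. B (A h) - h)) (at (X a))"
    by (intro derivative_intros bounded_linear.has_derivative[OF B(1)] d\<Phi>)
  then have "((\<lambda>p. B (\<Phi> p) - p) has_derivative (\<lambda>_. 0)) (at (X a))" by (simp add: B)
  then have 0: "((\<lambda>x. B (\<Phi> (X x)) - X x) has_derivative (\<lambda>_. 0)) (at a)"
    by (rule has_derivative_zero_compose_lipschitz[OF _ lip])
  have "((\<lambda>x. B (T x) - (B (\<Phi> (X x)) - X x)) has_derivative (\<lambda>h. B (T' h) - 0)) (at a)"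
    by (intro derivative_intros bounded_linear.has_derivative[OF B(1)] dT 0)
  then have 1: "((\<lambda>x. B (T x) - (B (\<Phi> (X x)) - X x)) has_derivative (\<lambda>h. B (T' h))) (at a)" by simp
  show ?thesis
  proof (rule has_derivative_transform_eventually[OF 1])
    show "\<forall>\<^sub>F x in at a. B (T x) - (B (\<Phi> (X x)) - X x) = X x"
      using eq unfolding eventually_nhds_conv_at by (auto elim!: eventually_mono)
    show "B (T a) - (B (\<Phi> (X a)) - X a) = X a" using eventually_nhds_x_imp_x[OF eq] by simp
  qed simp
qed

locale constant_width_body =
  fixes K S :: "'a::euclidean_space set" and w :: real
  assumes compact: "compact K" and convex: "convex K" and nonempty: "K \<noteq> {}"
    and S: "S = frontier K" and width: "has_constant_width S w"
begin

abbreviation H :: "'a \<Rightarrow> real" where "H \<equiv> support_function S"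

lemma S_subset: "S \<subseteq> K"
  using compact S compact_imp_closed frontier_subset_closed by blast

lemma support_attained:
  assumes x: "x \<noteq> 0"
  shows "\<exists>y\<in>S. y \<bullet> x = H x \<and> (\<forall>z\<in>K. z \<bullet> x \<le> H x)"
proof -
  have "continuous_on K (\<lambda>z. z \<bullet> x)" by (intro continuous_intros)
  then obtain y where y: "y \<in> K" "\<And>z. z \<in> K \<Longrightarrow> z \<bullet> x \<le> y \<bullet> x"
    using continuous_attains_sup[OF compact nonempty] by blast
  have "y \<notin> interior K"
  proof
    assume "y \<in> interior K"
    then obtain e where e: "e > 0" "cball y e \<subseteq> K" using mem_interior_cball by blast
    have "y + e *\<^sub>R sgn x \<in> cball y e" using e x by (simp add: dist_norm norm_sgn)
    then have "(y + e *\<^sub>R sgn x) \<bullet> x \<le> y \<bullet> x" using e y by blast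
    then have "e * (sgn x \<bullet> x) \<le> 0" by (simp add: inner_add_left)
    moreover have "sgn x \<bullet> x > 0" using x by (simp add: sgn_div_norm power2_norm_eq_inner[symmetric])
    ultimately show False using e by (simp add: mult_le_0_iff)
  qed
  then have yS: "y \<in> S" using y compact_imp_closed[OF compact] by (simp add: S frontier_def)
  have "H x = y \<bullet> x"
    by (rule support_function_eq[OF yS]) (use y S_subset in \<open>auto simp: inner_diff_left\<close>)
  then show ?thesis using y yS by auto
qed

text \<open>
  For \<open>x \<noteq> 0\<close> the choice is immaterial: by \<open>contact_ball\<close> below, the support plane meets the body in
  one point.
\<close>
definition contact :: "'a \<Rightarrow> 'a" where "contact x = (SOME y. y \<in> S \<and> y \<bullet> x = H x)"

lemma contact: assumes "x \<noteq> 0" shows "contact x \<in> S" "contact x \<bullet> x = H x" "contact x \<in> K"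
  using someI_ex[of "\<lambda>y. y \<in> S \<and> y \<bullet> x = H x"] support_attained[OF assms] S_subset
  unfolding contact_def by blast+

lemma inner_le_support: "x \<noteq> 0 \<Longrightarrow> z \<in> K \<Longrightarrow> z \<bullet> x \<le> H x"
  using support_attained by blast

lemma support_scaleR:
  assumes t: "t > 0"
  shows "H (t *\<^sub>R x) = t * H x"
proof (cases "x = 0")
  case True
  obtain b :: 'a where "b \<in> Basis" using nonempty_Basis by blast
  then have "S \<noteq> {}" using support_attained[of b] nonzero_Basis by blast
  then have "H 0 = 0" by (simp add: support_function_def)
  then show ?thesis using True by simp
next
  case False
  then have tx: "t *\<^sub>R x \<noteq> 0" using t by simp
  have "t * H x \<le> H (t *\<^sub>R x)"
    using inner_le_support[OF tx contact(3)[OF False]] contact(2)[OF False] by simp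
  moreover have "H (t *\<^sub>R x) \<le> t * H x"
    using inner_le_support[OF False contact(3)[OF tx]] contact(2)[OF tx] t by (metis inner_scaleR_right mult_left_mono less_imp_le)
  ultimately show ?thesis by simp
qed

lemma support_width: "x \<noteq> 0 \<Longrightarrow> H x + H (- x) = w * norm x"
proof -
  assume x: "x \<noteq> 0"
  have "H x = norm x * H (sgn x)" "H (- x) = norm x * H (- sgn x)"
    using support_scaleR[of "norm x" "sgn x"] support_scaleR[of "norm x" "- sgn x"] x
    by (simp_all add: norm_sgn sgn_div_norm)
  moreover have "H (sgn x) + H (- sgn x) = w"
    using width x by (simp add: has_constant_width_def norm_sgn)
  ultimately show ?thesis by (metis distrib_left mult.commute)
qed

text \<open>
  The extent of the body in the direction \<open>y - z\<close> is \<open>w\<close>.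
\<close>
lemma diameter_le: assumes "y \<in> K" "z \<in> K" shows "norm (y - z) \<le> w"
proof (cases "y = z")
  case True
  obtain b :: 'a where b: "b \<in> Basis" using nonempty_Basis by blast
  have "b \<noteq> 0" "- b \<noteq> 0" using b by auto
  then have "y \<bullet> b \<le> H b" "y \<bullet> - b \<le> H (- b)" using inner_le_support assms by blast+
  then have "0 \<le> w * norm b" using support_width[OF \<open>b \<noteq> 0\<close>] by simp
  then show ?thesis using True b by simp
next
  case False
  let ?d = "y - z"
  have d: "?d \<noteq> 0" "- ?d \<noteq> 0" using False by auto
  have "norm ?d * norm ?d = y \<bullet> ?d + z \<bullet> (- ?d)"
    by (simp add: inner_diff_left inner_diff_right flip: power2_eq_square power2_norm_eq_inner) (simp add: power2_norm_eq_inner inner_diff_left inner_diff_right)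
  also have "\<dots> \<le> H ?d + H (- ?d)"
    using inner_le_support[OF d(1) assms(1)] inner_le_support[OF d(2) assms(2)] by linarith
  also have "\<dots> = w * norm ?d" by (rule support_width[OF d(1)])
  finally show ?thesis using d by simp
qed

text \<open>
  The inequality says that the body lies in the ball of radius \<open>w\<close> about \<open>contact x - w *\<^sub>R sgn x\<close>. This centre is
  the contact point of the opposite support plane: the two contact points are at distance at most
  \<open>w\<close>, while their extent along \<open>x\<close> is \<open>w\<close>, so the chord is normal to both planes.
\<close>
lemma contact_ball:
  assumes x: "x \<noteq> 0" and y: "y \<in> K"
  shows "(norm (y - contact x))\<^sup>2 + 2 * w * ((y - contact x) \<bullet> sgn x) \<le> 0"
proof -
  let ?X = "contact x" and ?Z = "contact (- x)"
  have x': "- x \<noteq> 0" using x by simp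
  have w0: "0 \<le> w" using diameter_le[OF y y] by simp
  have sx: "x = norm x *\<^sub>R sgn x" using x by (simp add: sgn_div_norm)
  have "(?X - ?Z) \<bullet> x = w * norm x"
    using contact(2)[OF x] contact(2)[OF x'] support_width[OF x] by (simp add: inner_diff_left)
  then have i: "(?X - ?Z) \<bullet> sgn x = w" using x by (simp add: sgn_div_norm inner_scaleR_right)
  have "norm (?X - ?Z) \<le> w" by (intro diameter_le contact x x')
  then have n: "(norm (?X - ?Z))\<^sup>2 \<le> w\<^sup>2" by (simp add: power_mono)
  have s1: "sgn x \<bullet> sgn x = 1" using x by (simp add: norm_sgn flip: power2_norm_eq_inner)
  have "(norm (?X - ?Z - w *\<^sub>R sgn x))\<^sup>2 = (norm (?X - ?Z))\<^sup>2 - 2 * w * ((?X - ?Z) \<bullet> sgn x) + w\<^sup>2 * (sgn x \<bullet> sgn x)"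
    unfolding power2_norm_eq_inner
    by (simp add: inner_diff_left inner_diff_right inner_commute algebra_simps power2_eq_square)
  also have "\<dots> \<le> 0" using n i s1 by (simp add: power2_eq_square)
  finally have "?X - ?Z = w *\<^sub>R sgn x" by simp
  then have "?Z = ?X - w *\<^sub>R sgn x" by (simp add: algebra_simps)
  then have "norm (y - (?X - w *\<^sub>R sgn x)) \<le> w" using diameter_le[OF y contact(3)[OF x']] by simp
  then have "(norm ((y - ?X) + w *\<^sub>R sgn x))\<^sup>2 \<le> w\<^sup>2" by (simp add: power_mono algebra_simps)
  moreover have "(norm ((y - ?X) + w *\<^sub>R sgn x))\<^sup>2 = (norm (y - ?X))\<^sup>2 + 2 * w * ((y - ?X) \<bullet> sgn x) + w\<^sup>2 * (sgn x \<bullet> sgn x)"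
    unfolding power2_norm_eq_inner
    by (simp add: inner_add_left inner_add_right inner_diff_left inner_diff_right inner_commute algebra_simps power2_eq_square)
  ultimately show ?thesis using s1 by simp
qed

text \<open>
  Add the inequality \<open>contact_ball\<close> for the two directions and apply Cauchy-Schwarz.
\<close>
lemma contact_lipschitz:
  assumes x: "x \<noteq> 0" and y: "y \<noteq> 0"
  shows "norm (contact x - contact y) \<le> w * norm (sgn x - sgn y)"
proof -
  let ?D = "contact x - contact y"
  have w0: "0 \<le> w" using diameter_le[OF contact(3)[OF x] contact(3)[OF x]] by simp
  have "(norm ?D)\<^sup>2 + 2 * w * (?D \<bullet> sgn y) \<le> 0" by (rule contact_ball[OF y contact(3)[OF x]])
  moreover have "(norm ?D)\<^sup>2 + 2 * w * (- ?D \<bullet> sgn x) \<le> 0"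
  proof -
    have eq: "contact y - contact x = - ?D" by simp
    show ?thesis using contact_ball[OF x contact(3)[OF y]] unfolding eq norm_minus_cancel inner_minus_left .
  qed
  moreover have "?D \<bullet> sgn y + - ?D \<bullet> sgn x = - (?D \<bullet> (sgn x - sgn y))"
    by (simp add: inner_diff_right inner_diff_left)
  ultimately have "2 * (norm ?D)\<^sup>2 \<le> 2 * (w * (?D \<bullet> (sgn x - sgn y)))"
    by (simp add: inner_diff_right inner_diff_left algebra_simps)
  also have "\<dots> \<le> 2 * (w * (norm ?D * norm (sgn x - sgn y)))"
    using w0 norm_cauchy_schwarz[of ?D "sgn x - sgn y"] by (intro mult_left_mono) auto
  finally have "norm ?D * norm ?D \<le> norm ?D * (w * norm (sgn x - sgn y))"
    by (simp add: power2_eq_square algebra_simps)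
  then show ?thesis
    using w0 by (cases "norm ?D = 0") auto
qed

lemma contact_locally_lipschitz:
  assumes a: "a \<noteq> 0"
  shows "\<forall>\<^sub>F x in nhds a. norm (contact x - contact a) \<le> (w * (2 / norm a)) * norm (x - a)"
proof -
  have w0: "0 \<le> w" using diameter_le[OF contact(3)[OF a] contact(3)[OF a]] by simp
  have "\<forall>\<^sub>F x in nhds a. x \<noteq> 0" using a by (rule t1_space_nhds)
  then show ?thesis
  proof eventually_elim
    case (elim x)
    then show ?case
      using order_trans[OF contact_lipschitz[OF elim a] mult_left_mono[OF norm_sgn_diff_le[OF a, of x] w0]]
      by (simp add: mult.assoc)
  qed
qed

lemma contact_isCont:
  assumes a: "a \<noteq> 0"
  shows "isCont contact a"
proof -
  have "((\<lambda>x. contact x - contact a) \<longlongrightarrow> 0) (at a)"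
  proof (rule Lim_null_comparison)
    show "\<forall>\<^sub>F x in at a. norm (contact x - contact a) \<le> (w * (2 / norm a)) * norm (x - a)"
      using contact_locally_lipschitz[OF a] by (simp add: eventually_at_filter eventually_mono)
    show "((\<lambda>x. (w * (2 / norm a)) * norm (x - a)) \<longlongrightarrow> 0) (at a)"
      using a by (auto intro!: tendsto_eq_intros)
  qed
  then show ?thesis by (simp add: isCont_def LIM_zero_iff)
qed

text \<open>
  Maximality of the contact points at \<open>a\<close> and at \<open>y\<close> squeezes the first-order remainder between \<open>0\<close> and
  \<open>(contact y - contact a) \<bullet> (y - a)\<close>.
\<close>
lemma support_has_derivative:
  assumes a: "a \<noteq> 0"
  shows "(H has_derivative (\<lambda>h. contact a \<bullet> h)) (at a)"
  unfolding has_derivative_at_alt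
proof (intro conjI allI impI)
  fix e :: real assume e: "e > 0"
  have "\<forall>\<^sub>F x in nhds a. dist (contact x) (contact a) < e"
    using contact_isCont[OF a] e by (simp add: isCont_def tendsto_nhds_iff tendstoD)
  moreover have "\<forall>\<^sub>F x in nhds a. x \<noteq> 0" using a by (rule t1_space_nhds)
  ultimately have "\<forall>\<^sub>F x in nhds a. dist (contact x) (contact a) < e \<and> x \<noteq> 0" by (rule eventually_conj)
  then obtain d where d: "d > 0" "\<And>x. dist x a < d \<Longrightarrow> norm (contact x - contact a) < e \<and> x \<noteq> 0"
    by (auto simp: eventually_nhds_metric dist_norm)
  show "\<exists>d>0. \<forall>y. norm (y - a) < d \<longrightarrow> norm (H y - H a - contact a \<bullet> (y - a)) \<le> e * norm (y - a)"
  proof (intro exI[of _ d] conjI allI impI)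
    fix y assume "norm (y - a) < d"
    then have y: "norm (contact y - contact a) < e" "y \<noteq> 0" using d(2)[of y] by (simp_all add: dist_norm)
    have "0 \<le> H y - H a - contact a \<bullet> (y - a)"
      using inner_le_support[OF y(2) contact(3)[OF a]] contact(2)[OF a] by (simp add: inner_diff_right)
    moreover have "H y - H a - contact a \<bullet> (y - a) \<le> (contact y - contact a) \<bullet> (y - a)"
      using inner_le_support[OF a contact(3)[OF y(2)]] contact(2)[OF y(2)]
      by (simp add: inner_diff_right inner_diff_left)
    moreover have "(contact y - contact a) \<bullet> (y - a) \<le> e * norm (y - a)"
      using norm_cauchy_schwarz[of "contact y - contact a" "y - a"] mult_right_mono[of "norm (contact y - contact a)" e "norm (y - a)"] y(1)
      by simp
    ultimately show "norm (H y - H a - contact a \<bullet> (y - a)) \<le> e * norm (y - a)" by simp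
  qed (rule d)
qed (rule bounded_linear_inner_right)

lemma eq_cball_if_support:
  assumes "\<And>x. x \<noteq> 0 \<Longrightarrow> H x = c \<bullet> x + \<rho> * norm x"
  shows "K = cball c \<rho>"
proof (intro set_eqI iffI)
  fix y assume y: "y \<in> K"
  show "y \<in> cball c \<rho>"
  proof (cases "y = c")
    case True
    obtain b :: 'a where b: "b \<in> Basis" using nonempty_Basis by blast
    have "b \<noteq> 0" using b by auto
    then have "y \<bullet> b \<le> c \<bullet> b + \<rho> * norm b" using inner_le_support[OF _ y] assms by simp
    then show ?thesis using True b by simp
  next
    case False
    then have d: "y - c \<noteq> 0" by simp
    have "y \<bullet> (y - c) \<le> c \<bullet> (y - c) + \<rho> * norm (y - c)"
      using inner_le_support[OF d y] assms[OF d] by simp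
    then have "norm (y - c) * norm (y - c) \<le> \<rho> * norm (y - c)"
      by (simp add: inner_diff_left flip: power2_eq_square power2_norm_eq_inner) (simp add: power2_norm_eq_inner inner_diff_left inner_diff_right)
    then show ?thesis using d by (simp add: dist_norm norm_minus_commute)
  qed
next
  fix y assume y: "y \<in> cball c \<rho>"
  show "y \<in> K"
  proof (rule ccontr)
    assume "y \<notin> K"
    then obtain a b where ab: "a \<bullet> y < b" "\<forall>x\<in>K. b < a \<bullet> x"
      using separating_hyperplane_closed_point[OF convex compact_imp_closed[OF compact]] by blast
    have a0: "a \<noteq> 0" using ab nonempty by fastforce
    then have a: "- a \<noteq> 0" by simp
    have "b < a \<bullet> contact (- a)" using ab contact(3)[OF a] by blast
    then have "H (- a) < - b" using contact(2)[OF a] by (simp add: inner_commute)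
    then have "c \<bullet> (- a) + \<rho> * norm a < - (a \<bullet> y)" using assms[OF a] ab(1) by simp
    moreover have "(c - y) \<bullet> a \<le> \<rho> * norm a"
      using norm_cauchy_schwarz[of "c - y" a] mult_right_mono[of "norm (c - y)" \<rho> "norm a"] y
      by (simp add: dist_norm)
    ultimately show False by (simp add: inner_diff_left inner_diff_right inner_commute)
  qed
qed

text \<open>
  A C1 map \<open>\<Phi>\<close> near \<open>contact a\<close> that recovers the direction, in the normalisation with
  \<open>\<Phi> (contact x) \<bullet> a = 1\<close>, from the contact point. The gradient \<open>\<gamma>\<close> of a defining function is normal to the
  surface, so \<open>\<gamma> / (\<gamma> \<bullet> a)\<close> does this without any choice of sign; adding the multiple \<open>g p\<close> of \<open>a\<close>, which
  is zero on the surface, makes the differential invertible. Indeed, a vector \<open>l\<close> orthogonal to its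
  range would give \<open>l \<bullet> \<Phi> (contact x)\<close> derivative zero at \<open>a\<close>, because \<open>contact\<close> is Lipschitz; as this
  function is \<open>(l \<bullet> x) / (x \<bullet> a)\<close>, the vector \<open>l\<close> would be a multiple of \<open>a\<close>, and the component of
  the differential along \<open>a\<close> is not zero.
\<close>
lemma contact_chart:
  assumes C2: "C2_hypersurface S" and a: "a \<noteq> 0"
  obtains U A and \<Phi> :: "'a \<Rightarrow> 'a" where
    "open U" "contact a \<in> U"
    "\<And>p. p \<in> U \<Longrightarrow> (\<Phi> has_derivative blinfun_apply (A p)) (at p)" "continuous_on U A"
    "\<And>x. x \<bullet> a > 0 \<Longrightarrow> contact x \<in> U \<Longrightarrow> \<Phi> (contact x) = (1 / (x \<bullet> a)) *\<^sub>R x"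
    "surj (blinfun_apply (A (contact a)))"
proof -
  let ?p = "contact a"
  obtain U0 and g :: "'a \<Rightarrow> real" where chart: "open U0 \<and> ?p \<in> U0 \<and> C2_on U0 g \<and>
      (\<forall>x\<in>U0. frechet_derivative g (at x) \<noteq> (\<lambda>_. 0)) \<and> S \<inter> U0 = {x \<in> U0. g x = 0}"
    using bspec[OF C2[unfolded C2_hypersurface_def] contact(1)[OF a]] by (elim exE)
  then have U0: "open U0" "?p \<in> U0" and SU: "S \<inter> U0 = {x \<in> U0. g x = 0}"
    and gn: "\<And>x. x \<in> U0 \<Longrightarrow> frechet_derivative g (at x) \<noteq> (\<lambda>_. 0)" by simp_all
  have "C2_on U0 g" using chart by simp
  then obtain g' :: "'a \<Rightarrow> 'a \<Rightarrow>\<^sub>L real" and g'' where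
    "(\<forall>x\<in>U0. (g has_derivative blinfun_apply (g' x)) (at x)) \<and>
     (\<forall>x\<in>U0. (g' has_derivative blinfun_apply (g'' x)) (at x)) \<and> continuous_on U0 g''"
    unfolding C2_on_def by (elim exE)
  then have dg: "\<And>x. x \<in> U0 \<Longrightarrow> (g has_derivative blinfun_apply (g' x)) (at x)"
    and dg': "\<And>x. x \<in> U0 \<Longrightarrow> (g' has_derivative blinfun_apply (g'' x)) (at x)"
    and cg'': "continuous_on U0 g''" by simp_all
  obtain G :: "('a \<Rightarrow>\<^sub>L real) \<Rightarrow>\<^sub>L 'a" where G: "\<And>\<phi> h. blinfun_apply G \<phi> \<bullet> h = blinfun_apply \<phi> h"
    using gradient_blinfun by blast
  define \<gamma> where "\<gamma> x = blinfun_apply G (g' x)" for x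
  have dg2: "(g has_derivative (\<lambda>h. \<gamma> x \<bullet> h)) (at x)" if "x \<in> U0" for x
    using dg[OF that] by (simp add: \<gamma>_def G)
  have d\<gamma>: "(\<gamma> has_derivative (\<lambda>h. blinfun_apply G (blinfun_apply (g'' x) h))) (at x)" if "x \<in> U0" for x
    unfolding \<gamma>_def by (intro bounded_linear.has_derivative[OF blinfun.bounded_linear_right] dg' that)
  have \<gamma>0: "\<gamma> x \<noteq> 0" if "x \<in> U0" for x
  proof
    assume "\<gamma> x = 0"
    then have "(g has_derivative (\<lambda>_. 0)) (at x)" using dg2[OF that] by simp
    then have "(\<lambda>_. 0) = frechet_derivative g (at x)" by (rule frechet_derivative_at)
    then show False using gn[OF that] by simp
  qed
  have cg: "continuous_on U0 g" "continuous_on U0 \<gamma>"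
    using has_derivative_continuous[OF dg] has_derivative_continuous[OF d\<gamma>]
    by (auto intro!: continuous_at_imp_continuous_on)
  have parallel: "\<exists>k. k \<noteq> 0 \<and> \<gamma> (contact x) = k *\<^sub>R x" if x: "x \<noteq> 0" "contact x \<in> U0" for x
  proof -
    have g0: "g (contact x) = 0" using SU contact(1)[OF x(1)] x(2) by blast
    have "(z - contact x) \<bullet> x \<le> 0" if "z \<in> U0" "g z = 0" for z
    proof -
      have "z \<in> K" using that SU S_subset by blast
      then show ?thesis using inner_le_support[OF x(1)] contact(2)[OF x(1)] by (simp add: inner_diff_left)
    qed
    then show ?thesis
      using gradient_parallel_support_direction[OF U0(1) x(2) g0 dg2[OF x(2)] cg(1) \<gamma>0[OF x(2)] x(1)] by blast
  qed
  define U where "U = {p \<in> U0. \<gamma> p \<bullet> a \<noteq> 0}"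
  have oU: "open U"
  proof -
    have "open (U0 \<inter> (\<lambda>p. \<gamma> p \<bullet> a) -` (- {0}))"
      by (intro continuous_open_preimage U0 continuous_intros cg)
    then show ?thesis by (simp add: U_def vimage_def Int_def)
  qed
  have pU: "?p \<in> U"
    using parallel[OF a U0(2)] U0(2) a by (auto simp: U_def)
  define \<Phi> where "\<Phi> p = (1 / (\<gamma> p \<bullet> a)) *\<^sub>R \<gamma> p + g p *\<^sub>R a" for p
  define D where "D p h = (1 / (\<gamma> p \<bullet> a)) *\<^sub>R blinfun_apply G (blinfun_apply (g'' p) h)
      - ((blinfun_apply G (blinfun_apply (g'' p) h) \<bullet> a) / (\<gamma> p \<bullet> a)\<^sup>2) *\<^sub>R \<gamma> p + (\<gamma> p \<bullet> h) *\<^sub>R a" for p h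
  define A where "A p = Blinfun (D p)" for p
  have d\<Phi>: "(\<Phi> has_derivative D p) (at p)" if "p \<in> U" for p
  proof -
    have p: "p \<in> U0" "\<gamma> p \<bullet> a \<noteq> 0" using that by (auto simp: U_def)
    show ?thesis
      unfolding \<Phi>_def D_def
      by (rule has_derivative_eq_rhs, (rule derivative_eq_intros d\<gamma>[OF p(1)] dg2[OF p(1)] refl p(2))+)
         (simp add: fun_eq_iff power2_eq_square divide_inverse)
  qed
  have A: "blinfun_apply (A p) = D p" if "p \<in> U" for p
    unfolding A_def by (rule bounded_linear_Blinfun_apply[OF has_derivative_bounded_linear[OF d\<Phi>[OF that]]])
  have cA: "continuous_on U A"
  proof (rule continuous_on_blinfun_componentwise)
    fix i :: 'a assume "i \<in> Basis"
    have "U \<subseteq> U0" by (auto simp: U_def)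
    then have c: "continuous_on U \<gamma>" "continuous_on U g''"
      using cg cg'' continuous_on_subset by blast+
    have "continuous_on U (\<lambda>p. D p i)"
      unfolding D_def by (intro continuous_intros c) (auto simp: U_def)
    then show "continuous_on U (\<lambda>p. blinfun_apply (A p) i)"
      by (rule continuous_on_eq) (simp add: A)
  qed
  have \<Phi>c: "\<Phi> (contact x) = (1 / (x \<bullet> a)) *\<^sub>R x" if x: "x \<bullet> a > 0" "contact x \<in> U" for x
  proof -
    have x0: "x \<noteq> 0" and xU: "contact x \<in> U0" using x by (auto simp: U_def)
    obtain k where k: "k \<noteq> 0" "\<gamma> (contact x) = k *\<^sub>R x" using parallel[OF x0 xU] by blast
    have "g (contact x) = 0" using SU contact(1)[OF x0] xU by blast
    then show ?thesis using k by (simp add: \<Phi>_def)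
  qed
  have "surj (blinfun_apply (A ?p))"
  proof (rule ccontr)
    assume ns: "\<not> surj (blinfun_apply (A ?p))"
    have sub: "subspace (range (blinfun_apply (A ?p)))"
      by (intro linear_subspace_image subspace_UNIV bounded_linear.linear blinfun.bounded_linear_right)
    have "dim (range (blinfun_apply (A ?p))) < DIM('a)"
    proof (rule ccontr)
      assume "\<not> dim (range (blinfun_apply (A ?p))) < DIM('a)"
      then have "dim (range (blinfun_apply (A ?p))) = DIM('a)" using dim_subset_UNIV[of "range (blinfun_apply (A ?p))"] by linarith
      then have "span (range (blinfun_apply (A ?p))) = UNIV" by (simp only: dim_eq_full)
      moreover have "span (range (blinfun_apply (A ?p))) = range (blinfun_apply (A ?p))"
        using sub by (simp only: span_eq_iff)
      ultimately show False using ns by simp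
    qed
    then obtain l where l: "l \<noteq> 0" "\<And>y. y \<in> span (range (blinfun_apply (A ?p))) \<Longrightarrow> orthogonal l y"
      using orthogonal_to_subspace_exists by blast
    have lD: "l \<bullet> D ?p h = 0" for h
      using l(2)[OF span_base[of "blinfun_apply (A ?p) h"]] by (simp add: orthogonal_def A[OF pU])
    have "((\<lambda>p. l \<bullet> \<Phi> p) has_derivative (\<lambda>h. l \<bullet> D ?p h)) (at ?p)"
      by (intro derivative_intros d\<Phi> pU)
    then have "((\<lambda>p. l \<bullet> \<Phi> p) has_derivative (\<lambda>_. 0)) (at ?p)" by (simp add: lD)
    then have 1: "((\<lambda>x. l \<bullet> \<Phi> (contact x)) has_derivative (\<lambda>_. 0)) (at a)"
      by (rule has_derivative_zero_compose_lipschitz[OF _ contact_locally_lipschitz[OF a]])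
    have aa: "a \<bullet> a > 0" using a by simp
    have ev: "\<forall>\<^sub>F x in nhds a. x \<bullet> a > 0 \<and> contact x \<in> U"
    proof (rule eventually_conj)
      have "continuous_on UNIV (\<lambda>x. x \<bullet> a)" by (intro continuous_intros)
      then have "open ((\<lambda>x. x \<bullet> a) -` {0<..})" by (simp add: open_vimage)
      then show "\<forall>\<^sub>F x in nhds a. x \<bullet> a > 0" using eventually_nhds_in_open[of "(\<lambda>x. x \<bullet> a) -` {0<..}" a] aa by simp
      show "\<forall>\<^sub>F x in nhds a. contact x \<in> U"
        unfolding eventually_nhds_conv_at
        using topological_tendstoD[OF contact_isCont[OF a, unfolded isCont_def] oU pU] pU by simp
    qed
    have 2: "((\<lambda>x. (l \<bullet> x) / (x \<bullet> a)) has_derivative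
        (\<lambda>h. ((l \<bullet> h) * (a \<bullet> a) - (l \<bullet> a) * (h \<bullet> a)) / ((a \<bullet> a) * (a \<bullet> a)))) (at a)"
      by (rule has_derivative_divide'[of "\<lambda>x. l \<bullet> x" "\<lambda>h. l \<bullet> h" a UNIV "\<lambda>x. x \<bullet> a" "\<lambda>h. h \<bullet> a", simplified])
         (use a in \<open>auto intro!: derivative_eq_intros\<close>)
    have eq: "l \<bullet> \<Phi> (contact x) = (l \<bullet> x) / (x \<bullet> a)" if "x \<bullet> a > 0 \<and> contact x \<in> U" for x
      using \<Phi>c that by simp
    have "((\<lambda>x. (l \<bullet> x) / (x \<bullet> a)) has_derivative (\<lambda>_. 0)) (at a)"
    proof (rule has_derivative_transform_eventually[OF 1])
      show "\<forall>\<^sub>F x in at a. l \<bullet> \<Phi> (contact x) = (l \<bullet> x) / (x \<bullet> a)"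
        using ev unfolding eventually_nhds_conv_at by (auto elim!: eventually_mono simp: eq)
      show "l \<bullet> \<Phi> (contact a) = (l \<bullet> a) / (a \<bullet> a)" using eq[of a] aa pU by simp
    qed simp
    from has_derivative_unique[OF 2 this]
    have "((l \<bullet> h) * (a \<bullet> a) - (l \<bullet> a) * (h \<bullet> a)) / ((a \<bullet> a) * (a \<bullet> a)) = 0" for h by meson
    then have z: "(l \<bullet> h) * (a \<bullet> a) = (l \<bullet> a) * (h \<bullet> a)" for h using aa by simp
    have la: "l \<bullet> a \<noteq> 0"
    proof
      assume "l \<bullet> a = 0"
      then have "(l \<bullet> l) * (a \<bullet> a) = 0" using z[of l] by simp
      then show False using l aa by simp
    qed
    have lh: "l \<bullet> h = (l \<bullet> a) / (a \<bullet> a) * (h \<bullet> a)" for h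
      using z[of h] aa by (simp add: field_simps)
    have "D ?p (\<gamma> ?p) \<bullet> a = (\<gamma> ?p \<bullet> \<gamma> ?p) * (a \<bullet> a)"
      using pU by (simp add: D_def U_def inner_add_left inner_diff_left power2_eq_square)
    then have "(\<gamma> ?p \<bullet> \<gamma> ?p) * (l \<bullet> a) = 0"
      using lD[of "\<gamma> ?p"] lh[of "D ?p (\<gamma> ?p)"] aa by auto
    then show False using la \<gamma>0[OF U0(2)] by simp
  qed
  with oU pU d\<Phi> A cA \<Phi>c show ?thesis by (intro that[of U \<Phi> A]) auto
qed

text \<open>
  Differentiability comes from \<open>lipschitz_inverse_has_derivative\<close> in a chart at each point. For
  continuity at \<open>a\<close> one fixed chart is used: the chain rule gives \<open>A (contact x) o X' x = T' x\<close>
  for all \<open>x\<close> near \<open>a\<close>, with \<open>A\<close> and \<open>T'\<close> continuous and \<open>A (contact a)\<close> invertible.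
\<close>
lemma contact_C1:
  assumes C2: "C2_hypersurface S"
  obtains X' :: "'a \<Rightarrow> 'a \<Rightarrow>\<^sub>L 'a" where
    "\<And>x. x \<noteq> 0 \<Longrightarrow> (contact has_derivative blinfun_apply (X' x)) (at x)" "continuous_on (- {0}) X'"
proof -
  define T where "T a x = (1 / (x \<bullet> a)) *\<^sub>R x" for a x :: 'a
  define T' where "T' a x h = (1 / (x \<bullet> a)) *\<^sub>R h - ((h \<bullet> a) / (x \<bullet> a)\<^sup>2) *\<^sub>R x" for a x h :: 'a
  have dT: "(T a has_derivative T' a x) (at x)" if "x \<bullet> a \<noteq> 0" for a x
    unfolding T_def T'_def
    by (rule has_derivative_eq_rhs, (rule derivative_eq_intros refl that)+)
       (simp add: fun_eq_iff power2_eq_square divide_inverse)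
  have blT: "blinfun_apply (Blinfun (T' a x)) = T' a x" if "x \<bullet> a \<noteq> 0" for a x
    by (rule bounded_linear_Blinfun_apply[OF has_derivative_bounded_linear[OF dT[OF that]]])
  have cT: "continuous_on {x. x \<bullet> a > 0} (\<lambda>x. Blinfun (T' a x))" for a
  proof (rule continuous_on_blinfun_componentwise)
    fix i :: 'a assume "i \<in> Basis"
    have "continuous_on {x. x \<bullet> a > 0} (\<lambda>x. T' a x i)"
      unfolding T'_def by (intro continuous_intros) auto
    then show "continuous_on {x. x \<bullet> a > 0} (\<lambda>x. blinfun_apply (Blinfun (T' a x)) i)"
      by (rule continuous_on_eq) (simp add: blT)
  qed
  define inverts where "inverts W B A a \<longleftrightarrow> open W \<and> a \<in> W \<and> W \<subseteq> {x. x \<noteq> 0 \<and> x \<bullet> a > 0} \<and> isCont (\<lambda>x. A (contact x)) a \<and>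
      B o\<^sub>L A (contact a) = id_blinfun \<and>
      (\<forall>x\<in>W. \<exists>\<Phi>. (\<Phi> has_derivative blinfun_apply (A (contact x))) (at (contact x)) \<and> (\<forall>y\<in>W. \<Phi> (contact y) = T a y))"
    for W and B :: "'a \<Rightarrow>\<^sub>L 'a" and A a
  have local: "\<exists>W B A. inverts W B A a"
    if a: "a \<noteq> 0" for a
  proof -
    obtain U A and \<Phi> :: "'a \<Rightarrow> 'a" where U: "open U" "contact a \<in> U"
      and d: "\<And>p. p \<in> U \<Longrightarrow> (\<Phi> has_derivative blinfun_apply (A p)) (at p)" and cA: "continuous_on U A"
      and eq: "\<And>x. x \<bullet> a > 0 \<Longrightarrow> contact x \<in> U \<Longrightarrow> \<Phi> (contact x) = (1 / (x \<bullet> a)) *\<^sub>R x"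
      and sj: "surj (blinfun_apply (A (contact a)))"
      using contact_chart[OF C2 a] by metis
    obtain f where f: "linear f" "\<And>x. f (blinfun_apply (A (contact a)) x) = x"
      using linear_surjective_isomorphism[OF bounded_linear.linear[OF blinfun.bounded_linear_right] sj] by blast
    have "blinfun_apply (Blinfun f) = f"
      using f(1) by (simp add: bounded_linear_Blinfun_apply linear_conv_bounded_linear)
    then have B: "Blinfun f o\<^sub>L A (contact a) = id_blinfun"
      by (intro blinfun_eqI) (simp add: f)
    define W where "W = {x. x \<bullet> a > 0} \<inter> ((- {0}) \<inter> contact -` U)"
    have cc: "continuous_on (- {0}) contact"
      using contact_isCont by (intro continuous_at_imp_continuous_on) auto
    have oW: "open W"
      unfolding W_def
    proof (rule open_Int)
      show "open {x. x \<bullet> a > 0}" by (intro open_Collect_less continuous_intros)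
      show "open (- {0} \<inter> contact -` U)" by (rule continuous_open_preimage[OF cc open_Compl[OF closed_singleton] U(1)])
    qed
    have aW: "a \<in> W" using a U by (simp add: W_def)
    have "isCont A (contact a)" using cA U by (simp add: continuous_on_eq_continuous_at)
    then have "isCont (\<lambda>x. A (contact x)) a" by (rule isCont_o2[OF contact_isCont[OF a]])
    then show ?thesis
      using oW aW B d eq
      by (intro exI[of _ W] exI[of _ "Blinfun f"] exI[of _ A]) (auto simp: inverts_def W_def T_def intro!: exI[of _ \<Phi>])
  qed
  define X' where "X' x = Blinfun (frechet_derivative contact (at x))" for x
  have dX: "(contact has_derivative blinfun_apply (X' a)) (at a)" if a: "a \<noteq> 0" for a
  proof -
    obtain W B A where "inverts W B A a" using local[OF a] by blast
    then have W: "open W" "a \<in> W" "W \<subseteq> {x. x \<noteq> 0 \<and> x \<bullet> a > 0}" and B: "B o\<^sub>L A (contact a) = id_blinfun"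
      and ch: "\<forall>x\<in>W. \<exists>\<Phi>. (\<Phi> has_derivative blinfun_apply (A (contact x))) (at (contact x)) \<and> (\<forall>y\<in>W. \<Phi> (contact y) = T a y)"
      unfolding inverts_def by - ((elim conjE, assumption)+)
    obtain \<Phi> where \<Phi>: "(\<Phi> has_derivative blinfun_apply (A (contact a))) (at (contact a))" "\<forall>y\<in>W. \<Phi> (contact y) = T a y"
      using ch W(2) by blast
    have "(contact has_derivative (\<lambda>h. blinfun_apply B (T' a a h))) (at a)"
    proof (rule lipschitz_inverse_has_derivative[OF \<Phi>(1) blinfun.bounded_linear_right _ dT _ contact_locally_lipschitz[OF a]])
      show "blinfun_apply B (blinfun_apply (A (contact a)) h) = h" for h
        using arg_cong[OF B, of "\<lambda>f. blinfun_apply f h"] by simp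
      show "\<forall>\<^sub>F x in nhds a. \<Phi> (contact x) = T a x"
        using eventually_nhds_in_open[OF W(1,2)] \<Phi>(2) by (auto elim: eventually_mono)
    qed (use a in simp)
    then have "(contact has_derivative frechet_derivative contact (at a)) (at a)"
      using frechet_derivative_works differentiableI by blast
    then show ?thesis
      unfolding X'_def by (simp add: bounded_linear_Blinfun_apply has_derivative_bounded_linear)
  qed
  have "isCont X' a" if a: "a \<noteq> 0" for a
  proof -
    obtain W B A where "inverts W B A a" using local[OF a] by blast
    then have W: "open W" "a \<in> W" "W \<subseteq> {x. x \<noteq> 0 \<and> x \<bullet> a > 0}" and B: "B o\<^sub>L A (contact a) = id_blinfun"
      and cA: "isCont (\<lambda>x. A (contact x)) a"
      and ch: "\<forall>x\<in>W. \<exists>\<Phi>. (\<Phi> has_derivative blinfun_apply (A (contact x))) (at (contact x)) \<and> (\<forall>y\<in>W. \<Phi> (contact y) = T a y)"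
      unfolding inverts_def by - ((elim conjE, assumption)+)
    let ?T = "\<lambda>x. Blinfun (T' a x)"
    have chain: "A (contact x) o\<^sub>L X' x = ?T x" if x: "x \<in> W" for x
    proof -
      have x0: "x \<noteq> 0" "x \<bullet> a \<noteq> 0" using x W(3) by auto
      obtain \<Phi> where \<Phi>: "(\<Phi> has_derivative blinfun_apply (A (contact x))) (at (contact x))" "\<forall>y\<in>W. \<Phi> (contact y) = T a y"
        using ch x by blast
      have 1: "((\<lambda>y. \<Phi> (contact y)) has_derivative (\<lambda>h. blinfun_apply (A (contact x)) (blinfun_apply (X' x) h))) (at x)"
        by (rule has_derivative_compose[OF dX[OF x0(1)] \<Phi>(1)])
      have "((\<lambda>y. \<Phi> (contact y)) has_derivative T' a x) (at x)"
        by (rule has_derivative_transform_within_open[OF dT[OF x0(2)] W(1) x]) (use \<Phi>(2) in simp)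
      from has_derivative_unique[OF 1 this] show ?thesis
        by (intro blinfun_eqI) (simp add: blT[OF x0(2)] fun_eq_iff)
    qed
    have cT': "isCont ?T a"
    proof -
      have "open {x. x \<bullet> a > 0}" by (intro open_Collect_less continuous_intros)
      then show ?thesis using cT[of a] a by (simp add: continuous_on_eq_continuous_at)
    qed
    define m where "m x = norm (B o\<^sub>L (A (contact a) - A (contact x)))" for x
    (* the chain rule solved for X' x by the inverse at a; the first term on the right is small
       relative to X' x, which bounds X' x near a and then gives the limit *)
    have id: "X' x = ((B o\<^sub>L (A (contact a) - A (contact x))) o\<^sub>L X' x) + (B o\<^sub>L ?T x)" if "x \<in> W" for x
    proof (rule blinfun_eqI)
      fix h
      have 1: "blinfun_apply B (blinfun_apply (A (contact a)) v) = v" for v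
        using arg_cong[OF B, of "\<lambda>f. blinfun_apply f v"] by simp
      have 2: "blinfun_apply (A (contact x)) (blinfun_apply (X' x) h) = blinfun_apply (?T x) h"
        using arg_cong[OF chain[OF that], of "\<lambda>f. blinfun_apply f h"] by simp
      have "blinfun_apply (((B o\<^sub>L (A (contact a) - A (contact x))) o\<^sub>L X' x) + (B o\<^sub>L ?T x)) h
          = blinfun_apply B (blinfun_apply (A (contact a)) (blinfun_apply (X' x) h)
              - blinfun_apply (A (contact x)) (blinfun_apply (X' x) h)) + blinfun_apply B (blinfun_apply (?T x) h)"
        by (simp only: blinfun_apply_blinfun_compose blinfun.diff_left blinfun.add_left)
      also have "\<dots> = blinfun_apply (X' x) h"
        by (simp only: blinfun.diff_right 1 2 diff_add_cancel)
      finally show "blinfun_apply (X' x) h = blinfun_apply (((B o\<^sub>L (A (contact a) - A (contact x))) o\<^sub>L X' x) + (B o\<^sub>L ?T x)) h" ..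
    qed
    have m0: "(m \<longlongrightarrow> 0) (at a)"
    proof -
      have "isCont m a"
        unfolding m_def by (intro continuous_intros bounded_bilinear.continuous[OF bounded_bilinear_blinfun_compose] cA)
      then show ?thesis by (simp add: isCont_def m_def)
    qed
    have T0: "((\<lambda>x. B o\<^sub>L ?T x) \<longlongrightarrow> B o\<^sub>L ?T a) (at a)"
      using cT' by (intro tendsto_intros bounded_bilinear.tendsto[OF bounded_bilinear_blinfun_compose]) (simp_all add: isCont_def)
    have evW: "\<forall>\<^sub>F x in at a. x \<in> W" using eventually_at_in_open'[OF W(1,2)] .
    have "\<forall>\<^sub>F x in at a. m x < 1/2" using order_tendstoD(2)[OF m0, of "1/2"] by simp
    with evW have bd: "\<forall>\<^sub>F x in at a. norm (X' x - X' a) \<le> m x * (2 * norm (B o\<^sub>L ?T x)) + norm ((B o\<^sub>L ?T x) - (B o\<^sub>L ?T a))"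
    proof eventually_elim
      case (elim x)
      have "norm (X' x) \<le> norm ((B o\<^sub>L (A (contact a) - A (contact x))) o\<^sub>L X' x) + norm (B o\<^sub>L ?T x)"
        by (subst id[OF elim(1)]) (rule norm_triangle_ineq)
      also have "norm ((B o\<^sub>L (A (contact a) - A (contact x))) o\<^sub>L X' x) \<le> m x * norm (X' x)"
        unfolding m_def by (rule norm_blinfun_compose)
      also have "m x * norm (X' x) \<le> (1/2) * norm (X' x)" using elim by (intro mult_right_mono) auto
      finally have bX: "norm (X' x) \<le> 2 * norm (B o\<^sub>L ?T x)" by simp
      have Xa: "X' a = B o\<^sub>L ?T a" using id[OF W(2)] by simp
      have "norm (X' x - X' a) = norm (((B o\<^sub>L (A (contact a) - A (contact x))) o\<^sub>L X' x) + ((B o\<^sub>L ?T x) - (B o\<^sub>L ?T a)))"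
        unfolding Xa by (subst id[OF elim(1)]) (simp add: algebra_simps)
      also have "\<dots> \<le> norm ((B o\<^sub>L (A (contact a) - A (contact x))) o\<^sub>L X' x) + norm ((B o\<^sub>L ?T x) - (B o\<^sub>L ?T a))"
        by (rule norm_triangle_ineq)
      also have "norm ((B o\<^sub>L (A (contact a) - A (contact x))) o\<^sub>L X' x) \<le> m x * norm (X' x)"
        unfolding m_def by (rule norm_blinfun_compose)
      also have "m x * norm (X' x) \<le> m x * (2 * norm (B o\<^sub>L ?T x))"
        using bX by (intro mult_left_mono) (auto simp: m_def)
      finally show ?case by simp
    qed
    have "((\<lambda>x. m x * (2 * norm (B o\<^sub>L ?T x)) + norm ((B o\<^sub>L ?T x) - (B o\<^sub>L ?T a))) \<longlongrightarrow>
        0 * (2 * norm (B o\<^sub>L ?T a)) + norm ((B o\<^sub>L ?T a) - (B o\<^sub>L ?T a))) (at a)"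
      by (intro tendsto_intros m0 T0)
    then have "((\<lambda>x. m x * (2 * norm (B o\<^sub>L ?T x)) + norm ((B o\<^sub>L ?T x) - (B o\<^sub>L ?T a))) \<longlongrightarrow> 0) (at a)" by simp
    from Lim_null_comparison[OF bd this] show ?thesis by (simp add: isCont_def LIM_zero_iff)
  qed
  then have "continuous_on (- {0}) X'" by (intro continuous_at_imp_continuous_on) auto
  with dX show ?thesis by (rule that)
qed

end

section \<open>Stereographic coordinates and the theorem\<close>

text \<open>
  The numerator of \<open>sphere_point\<close>. It is polynomial, which makes it easy to differentiate, and
  by homogeneity the support function at \<open>\<nu> \<xi>\<close> is \<open>(1 + |\<xi>|^2) r(\<xi>)\<close>.
\<close>
definition \<nu> :: "complex \<Rightarrow> real^3" where "\<nu> \<xi> = vector [2 * Re \<xi>, 2 * Im \<xi>, 1 - (cmod \<xi>)\<^sup>2]"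
definition \<nu>x :: "complex \<Rightarrow> real^3" where "\<nu>x \<xi> = vector [2, 0, - 2 * Re \<xi>]"
definition \<nu>y :: "complex \<Rightarrow> real^3" where "\<nu>y \<xi> = vector [0, 2, - 2 * Im \<xi>]"

lemma inner_3: "x \<bullet> y = x $ 1 * y $ 1 + x $ 2 * y $ 2 + x $ 3 * y $ 3" for x y :: "real^3"
  by (simp add: inner_vec_def sum_3)

lemma \<nu>_sphere_point: "\<nu> \<xi> = (1 + (cmod \<xi>)\<^sup>2) *\<^sub>R sphere_point \<xi>"
  using one_plus_cmod_pos[of \<xi>] by (simp add: sphere_point_def \<nu>_def)

lemma norm_\<nu>: "norm (\<nu> \<xi>) = 1 + (cmod \<xi>)\<^sup>2"
  using one_plus_cmod_pos[of \<xi>] by (simp add: \<nu>_sphere_point norm_sphere_point)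

lemma \<nu>_nonzero: "\<nu> \<xi> \<noteq> 0"
  using norm_\<nu>[of \<xi>] one_plus_cmod_pos[of \<xi>] by auto

lemma \<nu>_has_derivative:
  "(\<nu> has_derivative (\<lambda>h. Re h *\<^sub>R \<nu>x \<xi> + Im h *\<^sub>R \<nu>y \<xi>)) (at \<xi>)"
  "(\<nu>x has_derivative (\<lambda>h. Re h *\<^sub>R axis 3 (- 2))) (at \<xi>)"
  "(\<nu>y has_derivative (\<lambda>h. Im h *\<^sub>R axis 3 (- 2))) (at \<xi>)"
proof -
  have vec: "(f has_derivative f') (at \<xi>)"
    if "\<And>i. ((\<lambda>x. f x $ i) has_derivative (\<lambda>h. f' h $ i)) (at \<xi>)" for f f' :: "complex \<Rightarrow> real^3"
    using that by (subst has_derivative_componentwise_within) (auto simp: Basis_vec_def inner_axis)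
  have d: "(Re has_derivative Re) (at \<xi>)" "(Im has_derivative Im) (at \<xi>)"
    by (auto intro!: bounded_linear_imp_has_derivative bounded_linear_Re bounded_linear_Im)
  show "(\<nu> has_derivative (\<lambda>h. Re h *\<^sub>R \<nu>x \<xi> + Im h *\<^sub>R \<nu>y \<xi>)) (at \<xi>)"
  proof (rule vec)
    fix i :: 3
    show "((\<lambda>x. \<nu> x $ i) has_derivative (\<lambda>h. (Re h *\<^sub>R \<nu>x \<xi> + Im h *\<^sub>R \<nu>y \<xi>) $ i)) (at \<xi>)"
      unfolding \<nu>_def \<nu>x_def \<nu>y_def cmod_power2 using exhaust_3[of i]
      by (auto intro!: derivative_eq_intros d simp: fun_eq_iff)
  qed
  show "(\<nu>x has_derivative (\<lambda>h. Re h *\<^sub>R axis 3 (- 2))) (at \<xi>)"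
  proof (rule vec)
    fix i :: 3
    show "((\<lambda>x. \<nu>x x $ i) has_derivative (\<lambda>h. (Re h *\<^sub>R axis 3 (- 2)) $ i)) (at \<xi>)"
      unfolding \<nu>x_def using exhaust_3[of i]
      by (auto intro!: derivative_eq_intros d simp: fun_eq_iff axis_def)
  qed
  show "(\<nu>y has_derivative (\<lambda>h. Im h *\<^sub>R axis 3 (- 2))) (at \<xi>)"
  proof (rule vec)
    fix i :: 3
    show "((\<lambda>x. \<nu>y x $ i) has_derivative (\<lambda>h. (Im h *\<^sub>R axis 3 (- 2)) $ i)) (at \<xi>)"
      unfolding \<nu>y_def using exhaust_3[of i]
      by (auto intro!: derivative_eq_intros d simp: fun_eq_iff axis_def)
  qed
qed

lemma direction_cases:
  fixes x :: "real^3"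
  assumes "norm x = 1"
  obtains \<xi> where "x = sphere_point \<xi>" | "x = - sphere_point 0"
proof (cases "x $ 3 = - 1")
  case True
  have "(x $ 1)\<^sup>2 + (x $ 2)\<^sup>2 + (x $ 3)\<^sup>2 = 1"
    using assms power2_norm_eq_inner[of x] by (simp add: inner_3 power2_eq_square)
  then have "x $ 1 = 0" "x $ 2 = 0" using True by (simp_all add: add_nonneg_eq_0_iff)
  then have "x = - sphere_point 0" using True by (simp add: vec_eq_iff forall_3 sphere_point_def)
  then show ?thesis using that(2) by blast
next
  case False
  define z where "z = 1 + x $ 3"
  have z: "z \<noteq> 0" using False by (simp add: z_def)
  have n: "(x $ 1)\<^sup>2 + (x $ 2)\<^sup>2 + (z - 1)\<^sup>2 = 1"
    using assms power2_norm_eq_inner[of x] by (simp add: inner_3 power2_eq_square z_def)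
  then have n': "(x $ 1)\<^sup>2 + (x $ 2)\<^sup>2 = z * (2 - z)" by (simp add: power2_eq_square algebra_simps)
  (* stereographic projection from the south pole *)
  define \<xi> where "\<xi> = Complex (x $ 1 / z) (x $ 2 / z)"
  have c: "(cmod \<xi>)\<^sup>2 = (2 - z) / z"
  proof -
    have "(cmod \<xi>)\<^sup>2 = ((x $ 1)\<^sup>2 + (x $ 2)\<^sup>2) / z\<^sup>2"
      by (simp add: \<xi>_def cmod_power2 power_divide add_divide_distrib)
    also have "\<dots> = (2 - z) / z" unfolding n' using z by (simp add: power2_eq_square)
    finally show ?thesis .
  qed
  have "1 + (2 - z) / z = 2 / z" "1 - (2 - z) / z = 2 * (z - 1) / z" using z by (simp_all add: field_simps)
  then have "x = sphere_point \<xi>"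
    unfolding sphere_point_def c using z by (simp add: vec_eq_iff forall_3 \<xi>_def) (simp add: z_def)
  then show ?thesis using that(1) by blast
qed

theorem theorem3:
  fixes K S :: "(real ^ 3) set" and w :: real and r :: "complex \<Rightarrow> real"
  assumes "convex_body K"
    and "S = frontier K"
    and "C2_hypersurface S"
    and "has_constant_width S w"
    and "r = (\<lambda>\<xi>. support_function S (sphere_point \<xi>))"
  shows "let I = (LINT \<xi>|sphere_area.
            (cmod (slope_sigma r \<xi>))\<^sup>2 - (r \<xi> - w / 2 + Re (slope_psi r \<xi>))\<^sup>2)
         in 0 \<le> I \<and> (I = 0 \<longrightarrow> (\<exists>c. S = sphere c (w / 2)))"
proof -
  interpret constant_width_body K S w
    using assms interior_empty by unfold_locales (auto simp: convex_body_def)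
  obtain X' :: "real^3 \<Rightarrow> ((real^3) \<Rightarrow>\<^sub>L (real^3))" where
    X': "\<And>x. x \<noteq> 0 \<Longrightarrow> (contact has_derivative blinfun_apply (X' x)) (at x)" "continuous_on (- {0}) X'"
    using contact_C1[OF assms(3)] by blast
  (* the conformal factor times r - w/2, for the body translated by - c *)
  define V where "V c \<xi> = H (\<nu> \<xi>) - c \<bullet> \<nu> \<xi> - w / 2 * (1 + (Re \<xi>)\<^sup>2 + (Im \<xi>)\<^sup>2)" for c \<xi>
  define Vx where "Vx c \<xi> = (contact (\<nu> \<xi>) - c) \<bullet> \<nu>x \<xi> - w * Re \<xi>" for c \<xi>
  define Vy where "Vy c \<xi> = (contact (\<nu> \<xi>) - c) \<bullet> \<nu>y \<xi> - w * Im \<xi>" for c \<xi>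
  define Vxx where "Vxx c \<xi> = blinfun_apply (X' (\<nu> \<xi>)) (\<nu>x \<xi>) \<bullet> \<nu>x \<xi> + (contact (\<nu> \<xi>) - c) \<bullet> axis 3 (- 2) - w" for c \<xi>
  define Vyy where "Vyy c \<xi> = blinfun_apply (X' (\<nu> \<xi>)) (\<nu>y \<xi>) \<bullet> \<nu>y \<xi> + (contact (\<nu> \<xi>) - c) \<bullet> axis 3 (- 2) - w" for c \<xi>
  define Vxy where "Vxy \<xi> = blinfun_apply (X' (\<nu> \<xi>)) (\<nu>y \<xi>) \<bullet> \<nu>x \<xi>" for \<xi>
  define Vyx where "Vyx \<xi> = blinfun_apply (X' (\<nu> \<xi>)) (\<nu>x \<xi>) \<bullet> \<nu>y \<xi>" for \<xi>
  have dRe: "(Re has_derivative Re) (at \<xi>)" "(Im has_derivative Im) (at \<xi>)" for \<xi>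
    by (auto intro!: bounded_linear_imp_has_derivative bounded_linear_Re bounded_linear_Im)
  have dH: "((\<lambda>\<xi>. H (\<nu> \<xi>)) has_derivative (\<lambda>h. contact (\<nu> \<xi>) \<bullet> (Re h *\<^sub>R \<nu>x \<xi> + Im h *\<^sub>R \<nu>y \<xi>))) (at \<xi>)" for \<xi>
    by (rule has_derivative_compose[OF \<nu>_has_derivative(1) support_has_derivative[OF \<nu>_nonzero]])
  have dX: "((\<lambda>\<xi>. contact (\<nu> \<xi>)) has_derivative
      (\<lambda>h. blinfun_apply (X' (\<nu> \<xi>)) (Re h *\<^sub>R \<nu>x \<xi> + Im h *\<^sub>R \<nu>y \<xi>))) (at \<xi>)" for \<xi>
    by (rule has_derivative_compose[OF \<nu>_has_derivative(1) X'(1)[OF \<nu>_nonzero]])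
  have dV: "(V c has_derivative (\<lambda>h. Re h * Vx c \<xi> + Im h * Vy c \<xi>)) (at \<xi>)" for c \<xi>
  proof -
    have "((\<lambda>\<xi>. w / 2 * (1 + (Re \<xi>)\<^sup>2 + (Im \<xi>)\<^sup>2)) has_derivative (\<lambda>h. w * (Re h * Re \<xi> + Im h * Im \<xi>))) (at \<xi>)"
      by (auto intro!: derivative_eq_intros dRe simp: fun_eq_iff algebra_simps)
    note d = has_derivative_diff[OF has_derivative_diff[OF dH has_derivative_inner_right[OF \<nu>_has_derivative(1), of c]] this]
    show ?thesis
      unfolding V_def Vx_def Vy_def
      by (rule has_derivative_eq_rhs[OF d])
         (simp add: fun_eq_iff inner_add_right inner_diff_left algebra_simps)
  qed
  note dcontact = has_derivative_diff[OF dX has_derivative_const]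
  have dVx: "(Vx c has_derivative (\<lambda>h. Re h * Vxx c \<xi> + Im h * Vxy \<xi>)) (at \<xi>)" for c \<xi>
    unfolding Vx_def Vxx_def Vxy_def
    by (rule has_derivative_eq_rhs[OF has_derivative_diff[OF
          has_derivative_inner[OF dcontact \<nu>_has_derivative(2)] has_derivative_mult_right[OF dRe(1)]]])
       (simp add: fun_eq_iff inner_add_left blinfun.add_right blinfun.scaleR_right algebra_simps)
  have dVy': "(Vy c has_derivative (\<lambda>h. Re h * Vyx \<xi> + Im h * Vyy c \<xi>)) (at \<xi>)" for c \<xi>
    unfolding Vy_def Vyx_def Vyy_def
    by (rule has_derivative_eq_rhs[OF has_derivative_diff[OF
          has_derivative_inner[OF dcontact \<nu>_has_derivative(3)] has_derivative_mult_right[OF dRe(2)]]])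
       (simp add: fun_eq_iff inner_add_left blinfun.add_right blinfun.scaleR_right algebra_simps)
  have c\<nu>: "continuous_on A \<nu>" "continuous_on A \<nu>x" "continuous_on A \<nu>y" "continuous_on A (\<lambda>\<xi>. contact (\<nu> \<xi>))" for A
    using has_derivative_continuous[OF \<nu>_has_derivative(1)] has_derivative_continuous[OF \<nu>_has_derivative(2)]
      has_derivative_continuous[OF \<nu>_has_derivative(3)] has_derivative_continuous[OF dX]
    by (auto intro!: continuous_at_imp_continuous_on)
  have cX': "continuous_on A (\<lambda>\<xi>. X' (\<nu> \<xi>))" for A
    by (rule continuous_on_compose2[OF X'(2) c\<nu>(1)]) (use \<nu>_nonzero in auto)
  have cont: "continuous_on UNIV (Vxx c)" "continuous_on UNIV Vxy" "continuous_on UNIV Vyx" "continuous_on UNIV (Vyy c)" for c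
    unfolding Vxx_def Vxy_def Vyx_def Vyy_def by (intro continuous_intros c\<nu> cX')+
  have sym: "Vyx = Vxy"
  proof
    fix \<xi>
    have dC: "((\<lambda>x. Complex x y) has_derivative (\<lambda>h. of_real h)) (at x)"
      "((\<lambda>y. Complex x y) has_derivative (\<lambda>h. \<i> * of_real h)) (at y)" for x y
    proof -
      have "((\<lambda>x. of_real x + \<i> * of_real y :: complex) has_derivative (\<lambda>h. of_real h + 0)) (at x)"
        by (intro derivative_intros bounded_linear_imp_has_derivative bounded_linear_of_real)
      then show "((\<lambda>x. Complex x y) has_derivative (\<lambda>h. of_real h)) (at x)" by (simp add: Complex_eq)
      have "((\<lambda>y. of_real x + \<i> * of_real y :: complex) has_derivative (\<lambda>h. 0 + \<i> * of_real h)) (at y)"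
        by (intro derivative_intros has_derivative_mult_right bounded_linear_imp_has_derivative bounded_linear_of_real)
      then show "((\<lambda>y. Complex x y) has_derivative (\<lambda>h. \<i> * of_real h)) (at y)" by (simp add: Complex_eq)
    qed
    have part: "((\<lambda>x. f (Complex x y)) has_real_derivative fx) (at x)"
      "((\<lambda>y. f (Complex x y)) has_real_derivative fy) (at y)"
      if "(f has_derivative (\<lambda>h. Re h * fx + Im h * fy)) (at (Complex x y))" for f fx fy x y
      unfolding has_field_derivative_def
      by (rule has_derivative_eq_rhs[OF has_derivative_compose[OF dC(1) that]], simp add: fun_eq_iff)
         (rule has_derivative_eq_rhs[OF has_derivative_compose[OF dC(2) that]], simp add: fun_eq_iff)
    have cC: "continuous_on UNIV (\<lambda>z. f (Complex (fst z) (snd z)))" if "continuous_on UNIV f" for f :: "complex \<Rightarrow> real"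
      by (rule continuous_on_compose2[OF that]) (auto simp: Complex_eq intro!: continuous_intros)
    have "Vxy (Complex (Re \<xi>) (Im \<xi>)) = Vyx (Complex (Re \<xi>) (Im \<xi>))"
    proof (rule mixed_partials_commute[of "\<lambda>x y. V 0 (Complex x y)" "\<lambda>x y. Vx 0 (Complex x y)" "\<lambda>x y. Vy 0 (Complex x y)"
          "\<lambda>x y. Vxy (Complex x y)" "\<lambda>x y. Vyx (Complex x y)"])
      show "continuous_on UNIV (\<lambda>z. Vy 0 (Complex (fst z) (snd z)))"
        by (rule cC) (use has_derivative_continuous[OF dVy'] in \<open>auto intro!: continuous_at_imp_continuous_on\<close>)
      show "continuous_on UNIV (\<lambda>z. Vyx (Complex (fst z) (snd z)))" by (rule cC[OF cont(3)])
    qed (rule part[OF dV] part[OF dVx] part[OF dVy'])+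
    then show "Vyx \<xi> = Vxy \<xi>" by simp
  qed
  note dVy = dVy'[unfolded sym]
  have C2: "plane_C2 (V c) (Vx c) (Vy c) (Vxx c) Vxy (Vyy c)" for c
    by unfold_locales (rule dV dVx dVy cont)+
  let ?e = "\<nu> 0"
  (* the midpoint of the chord joining the two contact points with horizontal tangent plane; this
     is the centre for which the support function agrees with that of a ball of radius w/2 to first
     order at the north pole *)
  define c where "c = contact ?e - (w / 2) *\<^sub>R ?e"
  interpret P: antipodal_plane "V c" "Vx c" "Vy c" "Vxx c" Vxy "Vyy c"
  proof (intro antipodal_plane.intro C2 antipodal_plane_axioms.intro)
    have ee: "?e \<bullet> ?e = 1" "?e \<bullet> \<nu>x 0 = 0" "?e \<bullet> \<nu>y 0 = 0"
      by (simp_all add: inner_3 \<nu>_def \<nu>x_def \<nu>y_def)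
    show "V c 0 = 0"
      using contact(2)[OF \<nu>_nonzero, of 0] ee by (simp add: V_def c_def inner_diff_left)
    show "Vx c 0 = 0" "Vy c 0 = 0" using ee by (simp_all add: Vx_def Vy_def c_def)
    show "V c (- 1 / cnj \<xi>) = - V c \<xi> / (cmod \<xi>)\<^sup>2" if "\<xi> \<noteq> 0" for \<xi>
    proof -
      define m where "m = (cmod \<xi>)\<^sup>2"
      have m: "m > 0" using that by (simp add: m_def)
      have n: "(cmod (- 1 / cnj \<xi>))\<^sup>2 = 1 / m" by (simp add: norm_divide power_divide m_def)
      have m': "1 + 1 / m = (1 / m) * (1 + m)" using m by (simp add: field_simps)
      have 1: "\<nu> (- 1 / cnj \<xi>) = (1 / m) *\<^sub>R (- \<nu> \<xi>)"
        unfolding \<nu>_sphere_point n sphere_point_antipodal[OF that] m_def[symmetric] m' by simp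
      have 2: "H ((1 / m) *\<^sub>R (- \<nu> \<xi>)) = (1 / m) * (w * (1 + m) - H (\<nu> \<xi>))"
      proof -
        have "H (- \<nu> \<xi>) = w * (1 + m) - H (\<nu> \<xi>)"
          using support_width[OF \<nu>_nonzero, of \<xi>] by (simp add: norm_\<nu> m_def)
        then show ?thesis using support_scaleR[of "1 / m" "- \<nu> \<xi>"] m by simp
      qed
      have 3: "1 + (Re (- 1 / cnj \<xi>))\<^sup>2 + (Im (- 1 / cnj \<xi>))\<^sup>2 = (1 / m) * (1 + m)"
        using n m' cmod_power2[of "- 1 / cnj \<xi>"] by linarith
      have 4: "1 + (Re \<xi>)\<^sup>2 + (Im \<xi>)\<^sup>2 = 1 + m"
        unfolding m_def cmod_power2 by simp
      have 5: "c \<bullet> ((1 / m) *\<^sub>R (- \<nu> \<xi>)) = - ((1 / m) * (c \<bullet> \<nu> \<xi>))" by simp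
      have gen: "(1 / m) * (w * N - a) - - ((1 / m) * b) - w / 2 * ((1 / m) * N) = - (a - b - w / 2 * N) / m"
        for a b N using m by (simp add: field_simps)
      show ?thesis unfolding V_def 1 2 3 4 5 m_def[symmetric] by (rule gen)
    qed
  qed
  have r: "r = (\<lambda>\<xi>. w / 2 + V 0 \<xi> / (1 + (cmod \<xi>)\<^sup>2))"
  proof
    fix \<xi>
    have D: "1 + (cmod \<xi>)\<^sup>2 > 0" by (rule one_plus_cmod_pos)
    have "H (\<nu> \<xi>) = (1 + (cmod \<xi>)\<^sup>2) * r \<xi>"
      unfolding assms(5) \<nu>_sphere_point by (rule support_scaleR[OF D])
    moreover have "1 + (Re \<xi>)\<^sup>2 + (Im \<xi>)\<^sup>2 = 1 + (cmod \<xi>)\<^sup>2" by (simp add: cmod_power2)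
    ultimately show "r \<xi> = w / 2 + V 0 \<xi> / (1 + (cmod \<xi>)\<^sup>2)"
      unfolding V_def using D by (simp add: field_simps)
  qed
  (* the integrand does not change under translations of the body *)
  have Z: "plane_C2.integrand (V 0) (Vx 0) (Vy 0) (Vxx 0) Vxy (Vyy 0) \<xi> = P.integrand \<xi>" for \<xi>
  proof -
    have 1: "Vxx 0 \<xi> - Vyy 0 \<xi> = Vxx c \<xi> - Vyy c \<xi>" by (simp add: Vxx_def Vyy_def)
    have "(1 + (cmod \<xi>)\<^sup>2) / 8 * (Vxx 0 \<xi> + Vyy 0 \<xi>) - (Re \<xi> * Vx 0 \<xi> + Im \<xi> * Vy 0 \<xi>) / 2 + V 0 \<xi> / 2
      = (1 + (cmod \<xi>)\<^sup>2) / 8 * (Vxx c \<xi> + Vyy c \<xi>) - (Re \<xi> * Vx c \<xi> + Im \<xi> * Vy c \<xi>) / 2 + V c \<xi> / 2"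
    proof -
      have d: "Vxx 0 \<xi> = Vxx c \<xi> - 2 * c $ 3" "Vyy 0 \<xi> = Vyy c \<xi> - 2 * c $ 3"
        "Vx 0 \<xi> = Vx c \<xi> + c \<bullet> \<nu>x \<xi>" "Vy 0 \<xi> = Vy c \<xi> + c \<bullet> \<nu>y \<xi>" "V 0 \<xi> = V c \<xi> + c \<bullet> \<nu> \<xi>"
        by (simp_all add: V_def Vx_def Vy_def Vxx_def Vyy_def inner_diff_left inner_axis)
      show ?thesis
        unfolding d inner_3 \<nu>_def \<nu>x_def \<nu>y_def cmod_power2 by (simp add: field_simps power2_eq_square)
    qed
    then show ?thesis unfolding plane_C2.integrand_def[OF C2] P.integrand_def 1 by simp
  qed
  have integrand: "(cmod (slope_sigma r \<xi>))\<^sup>2 - (r \<xi> - w / 2 + Re (slope_psi r \<xi>))\<^sup>2 = P.integrand \<xi>" for \<xi>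
    unfolding plane_C2.slope_integrand[OF C2 r] Z ..
  have "\<exists>c. S = sphere c (w / 2)" if I: "(LINT \<xi>|sphere_area. P.integrand \<xi>) = 0"
  proof -
    have V0: "V c \<xi> = 0" for \<xi> using P.sphere_integral_nonneg(2)[OF I] .
    have unit: "H (sphere_point \<xi>) = c \<bullet> sphere_point \<xi> + w / 2" for \<xi>
    proof -
      have D: "1 + (cmod \<xi>)\<^sup>2 > 0" by (rule one_plus_cmod_pos)
      have "(1 + (cmod \<xi>)\<^sup>2) * (H (sphere_point \<xi>) - c \<bullet> sphere_point \<xi> - w / 2) = V c \<xi>"
        unfolding V_def \<nu>_sphere_point support_scaleR[OF D] by (simp add: cmod_power2 algebra_simps)
      then show ?thesis using D V0 by simp
    qed
    have "H x = c \<bullet> x + w / 2 * norm x" if x: "x \<noteq> 0" for x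
    proof -
      have "H (sgn x) = c \<bullet> sgn x + w / 2"
      proof (rule direction_cases[of "sgn x"])
        show "norm (sgn x) = 1" using x by (simp add: norm_sgn)
        show "H (sgn x) = c \<bullet> sgn x + w / 2" if "sgn x = sphere_point \<xi>" for \<xi> using unit that by simp
        assume s: "sgn x = - sphere_point 0"
        have "H (sphere_point 0) + H (- sphere_point 0) = w"
          using support_width[of "sphere_point 0"] norm_sphere_point[of 0] by force
        then show "H (sgn x) = c \<bullet> sgn x + w / 2" using unit[of 0] s by simp
      qed
      moreover have "H x = norm x * H (sgn x)"
        using support_scaleR[of "norm x" "sgn x"] x by (simp add: sgn_div_norm)
      moreover have "norm x * (c \<bullet> sgn x) = c \<bullet> x" using x by (simp add: sgn_div_norm)
      ultimately show ?thesis by (simp add: algebra_simps)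
    qed
    then have "K = cball c (w / 2)" by (rule eq_cball_if_support)
    then show ?thesis using S by auto
  qed
  then show ?thesis unfolding Let_def integrand using P.sphere_integral_nonneg(1) by blast
qed

end
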